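(* Let $\mathcal{M}$ be a $d$-dimensional Riemannian manifold with a retraction $\mathrm{Retr}$ and let $f\colon\mathcal{M}\to\mathbb{R}$ be twice continuously differentiable, with pullbacks $\hat f_x = f\circ\mathrm{Retr}_x$. Assume: (A1) there is $f^*\in\mathbb{R}$ with $f(x)\ge f^*$ for all $x\in\mathcal{M}$; (A2) there are $b_1>0$, $L>0$ such that $\|\nabla\hat f_x(s)-\nabla\hat f_x(0)\|\le L\|s\|$ for all $x\in\mathcal{M}$ and all $s\in \mathrm{T}_x\mathcal{M}$ with $\|s\|\le b_1$; (A3) there are $b_2>0$, $\rho>0$ such that $\|\nabla^2\hat f_x(s)-\nabla^2\hat f_x(0)\|\le\rho\|s\|$ (operator norm) for all $x\in\mathcal{M}$ and all $s\in \mathrm{T}_x\mathcal{M}$ with $\|s\|\le b_2$. Let $b=\min\{b_1,b_2\}$, and let $\ell\in[L,L+\rho b]$ be such that for every $x\in\mathcal{M}$ the map $\nabla\hat f_x$ is $\ell$-Lipschitz continuous on the ball $B_{x,b}(0)$. Let $x_0\in\mathcal{M}$, $0<\epsilon\le b^2\rho$, $L\ge\sqrt{\rho\epsilon}$, $\epsilon^{3/2}\le 3\sqrt{\rho}\,(f(x_0)-f^* )$ and $\delta\in(0,1)$. Choose $\chi>1/4$ with $$\chi\ge 4\log_2\left(2^{31}\frac{\ell^2\sqrt d\,(f(x_0)-f^* )}{\delta\sqrt\rho\,\epsilon^{5/2}}\right)$$ and such that $\mathscr{T}$ below is an integer, and set $$\eta=\frac1\ell,\qquad r=\frac{\epsilon}{400\chi^3},\qquad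 \mathscr{T}=\frac{\ell\chi}{\sqrt{\rho\epsilon}},\qquad \mathscr{F}=\frac{1}{50\chi^3}\sqrt{\frac{\epsilon^3}{\rho}},$$ $$T=8\max\left\{\frac{\mathscr{T}}{3},\ \frac{(f(x_0)-f^* )\mathscr{T}}{\mathscr{F}},\ \frac{f(x_0)-f^*}{\eta\epsilon^2}\right\}=O\!\left(\frac{\ell(f(x_0)-f^* )}{\epsilon^2}(\log d)^4\right).$$ Then the algorithm $\mathrm{PRGD}(x_0,\eta,r,\mathscr{T},\epsilon,T,b)$ visits at least two iterates $x_t\in\mathcal{M}$ satisfying $\|\mathrm{grad} f(x_t)\|\le\epsilon$. With probability at least $1-\delta$, at least two-thirds of those iterates satisfy $$\|\mathrm{grad} f(x_t)\|\le\epsilon\quad\text{and}\quad\lambda_{\min}(\nabla^2\hat f_{x_t}(0))\ge-\sqrt{\rho\epsilon}.$$ The algorithm uses at most $T+\mathscr{T}\le 2T$ gradient queries (and no function or Hessian queries).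
   Context: Retraction: a smooth map $\mathrm{Retr}$ from the tangent bundle $\mathrm{T}\mathcal{M}$ to $\mathcal{M}$ whose restriction $\mathrm{Retr}_x\colon \mathrm{T}_x\mathcal{M}\to\mathcal{M}$ satisfies $\mathrm{Retr}_x(0)=x$ and $\mathrm{D}\,\mathrm{Retr}_x(0)=\mathrm{Id}$ for every $x$. The pullback $\hat f_x=f\circ\mathrm{Retr}_x$ is a function on the inner product space $\mathrm{T}_x\mathcal{M}$ (Riemannian metric at $x$); $\nabla\hat f_x$, $\nabla^2\hat f_x$ are its classical gradient and Hessian. $\mathrm{grad} f$ is the Riemannian gradient; $\mathrm{grad} f(x)=\nabla\hat f_x(0)$. $\lambda_{\min}$ is the smallest eigenvalue. $B_{x,r}(s)=\{\dot s\in \mathrm{T}_x\mathcal{M}:\|\dot s-s\|_x\le r\}$, and $\mathrm{Uniform}(B_{x,r}(s))$ is the uniform distribution on it. The value $b=+\infty$ is allowed (then the balls are whole tangent spaces). Procedure $\mathrm{TangentSpaceSteps}(x,s_0,\eta,b,\mathscr{T})$: for $j=0,1,\dots,\mathscr{T}-1$, set $s_{j+1}=s_j-\eta\nabla\hat f_x(s_j)$; if $\|s_{j+1}\|\ge b$, set instead $s_{\mathscr{T}}=s_j-\alpha\eta\nabla\hat f_x(s_j)$, where $\alpha\in(0,1]$ is such that $\|s_j-\alpha\eta\nabla\hat f_x(s_j)\|=b$, and exit the loop. Return $\mathrm{Retr}_x(s_{\mathscr{T}})$. Algorithm $\mathrm{PRGD}(x_0,\eta,r,\mathscr{T},\epsilon,T,b)$: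 set $t=0$. While $t\le T$: if $\|\mathrm{grad} f(x_t)\|>\epsilon$, set $x_{t+1}=\mathrm{TangentSpaceSteps}(x_t,0,\eta,b,1)$ and increase $t$ by $1$; otherwise draw $\xi\sim\mathrm{Uniform}(B_{x_t,r}(0))$ (fresh, independent randomness), set $s_0=\eta\xi$, set $x_{t+\mathscr{T}}=\mathrm{TangentSpaceSteps}(x_t,s_0,\eta,b,\mathscr{T})$ and increase $t$ by $\mathscr{T}$. The iterates visited are the points $x_t$ at which the body of the while-loop is executed. Gradient queries are counted by the counter $t$: one for each step $x_t\mapsto x_{t+1}$ and $\mathscr{T}$ for each perturbed round $x_t\mapsto x_{t+\mathscr{T}}$. In the $O(\cdot)$ expression for $T$, $\chi$ is understood to be of the order of its lower bound, and logarithmic factors in $\ell$, $f(x_0)-f^*$, $1/\delta$, $1/\rho$, $1/\epsilon$ are suppressed. *)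

theory Defs
  imports "HOL-Probability.Probability"
begin

section \<open>Differentiability of finite and infinite order\<close>

text \<open>Only used for open \<open>S\<close>; over a finite-dimensional domain, continuity of all iterated
  directional derivatives in fixed directions is continuity of the iterated Frechet derivatives.\<close>

primrec Ck_on :: "nat \<Rightarrow> 'a::real_normed_vector set \<Rightarrow> ('a \<Rightarrow> 'b::real_normed_vector) \<Rightarrow> bool" where
  "Ck_on 0 S h \<longleftrightarrow> continuous_on S h"
| "Ck_on (Suc n) S h \<longleftrightarrow> (\<forall>y\<in>S. h differentiable (at y)) \<and>
     (\<forall>v. Ck_on n S (\<lambda>y. frechet_derivative h (at y) v))"

definition smooth_on :: "'a::real_normed_vector set \<Rightarrow> ('a \<Rightarrow> 'b::real_normed_vector) \<Rightarrow> bool" where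
  "smooth_on S h \<longleftrightarrow> (\<forall>n. Ck_on n S h)"

section \<open>Smooth manifolds\<close>

text \<open>The manifold is a (Hausdorff, second countable) type \<open>'m\<close>, modelled on the Euclidean space
  \<open>'e\<close>, so its dimension is \<open>DIM('e)\<close>. A chart is a pair of its domain and its coordinate map.\<close>

type_synonym ('m, 'e) chart = "'m set \<times> ('m \<Rightarrow> 'e)"

definition chart_inv :: "('m, 'e) chart \<Rightarrow> 'e \<Rightarrow> 'm" where
  "chart_inv c = inv_into (fst c) (snd c)"

definition chart_im :: "('m, 'e) chart \<Rightarrow> 'e set" where
  "chart_im c = snd c ` fst c"

definition is_chart :: "('m::topological_space, 'e::euclidean_space) chart \<Rightarrow> bool" where
  "is_chart c \<longleftrightarrow> open (fst c) \<and> open (chart_im c) \<and>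
     homeomorphism (fst c) (chart_im c) (snd c) (chart_inv c)"

definition smooth_atlas ::
  "('m::{t2_space, second_countable_topology}, 'e::euclidean_space) chart set \<Rightarrow> bool" where
  "smooth_atlas A \<longleftrightarrow> (\<forall>c\<in>A. is_chart c) \<and> (\<Union>c\<in>A. fst c) = UNIV \<and>
     (\<forall>c\<in>A. \<forall>c'\<in>A. smooth_on (snd c ` (fst c \<inter> fst c')) (snd c' \<circ> chart_inv c))"

definition C2_fun ::
  "('m, 'e::euclidean_space) chart set \<Rightarrow> ('m \<Rightarrow> real) \<Rightarrow> bool" where
  "C2_fun A f \<longleftrightarrow> (\<forall>c\<in>A. Ck_on 2 (chart_im c) (f \<circ> chart_inv c))"

section \<open>Tangent spaces\<close>

text \<open>Every point \<open>p\<close> gets a preferred chart \<open>chart_at A p\<close> around it, and the tangent space at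
  \<open>p\<close> is identified with \<open>'e\<close> through this chart. Hence a tangent vector at \<open>p\<close> is an element
  \<open>v\<close> of \<open>'e\<close>, and its components in another chart \<open>c\<close> around \<open>p\<close> are
  \<open>transition_deriv (chart_at A p) c p v\<close>. The preferred chart is the first suitable one in an
  enumerated countable subatlas (one exists by second countability), so that there are countably
  many preferred charts, each preferred on a Borel set, and the tangent bundle is as a measurable
  space the product of \<open>'m\<close> and \<open>'e\<close>.\<close>

definition chart_enum :: "('m, 'e) chart set \<Rightarrow> nat \<Rightarrow> ('m, 'e) chart" where
  "chart_enum A = (SOME e. range e \<subseteq> A \<and> (\<Union>i. fst (e i)) = UNIV)"

definition chart_at :: "('m, 'e) chart set \<Rightarrow> 'm \<Rightarrow> ('m, 'e) chart" where
  "chart_at A p = chart_enum A (LEAST i. p \<in> fst (chart_enum A i))"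

definition transition_deriv ::
  "('m, 'e::euclidean_space) chart \<Rightarrow> ('m, 'e) chart \<Rightarrow> 'm \<Rightarrow> 'e \<Rightarrow> 'e" where
  "transition_deriv c c' p = frechet_derivative (snd c' \<circ> chart_inv c) (at (snd c p))"

text \<open>The inverse of the chart of the tangent bundle induced by \<open>c\<close>.\<close>

definition bundle_chart_inv ::
  "('m, 'e::euclidean_space) chart set \<Rightarrow> ('m, 'e) chart \<Rightarrow> 'e \<times> 'e \<Rightarrow> 'm \<times> 'e" where
  "bundle_chart_inv A c = (\<lambda>(y, u).
     (chart_inv c y, transition_deriv c (chart_at A (chart_inv c y)) (chart_inv c y) u))"

definition riemannian_metric ::
  "('m, 'e::euclidean_space) chart set \<Rightarrow> ('m \<Rightarrow> 'e \<Rightarrow> 'e \<Rightarrow> real) \<Rightarrow> bool" where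
  "riemannian_metric A g \<longleftrightarrow>
     (\<forall>p. bilinear (g p) \<and> (\<forall>u v. g p u v = g p v u) \<and> (\<forall>v. v \<noteq> 0 \<longrightarrow> 0 < g p v v)) \<and>
     (\<forall>c\<in>A. \<forall>u v. smooth_on (chart_im c)
        (\<lambda>y. g (chart_inv c y) (snd (bundle_chart_inv A c (y, u))) (snd (bundle_chart_inv A c (y, v)))))"

definition tnorm :: "('m \<Rightarrow> 'e \<Rightarrow> 'e \<Rightarrow> real) \<Rightarrow> 'm \<Rightarrow> 'e \<Rightarrow> real" where
  "tnorm g x v = sqrt (g x v v)"

text \<open>The derivative in the last clause is taken from the tangent space at \<open>x\<close> to itself, both in
  the coordinates of the preferred chart at \<open>x\<close>.\<close>

definition manifold_retraction ::
  "('m::topological_space, 'e::euclidean_space) chart set \<Rightarrow> ('m \<Rightarrow> 'e \<Rightarrow> 'm) \<Rightarrow> bool" where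
  "manifold_retraction A Retr \<longleftrightarrow>
     (\<forall>c\<in>A. continuous_on (chart_im c \<times> UNIV) (case_prod Retr \<circ> bundle_chart_inv A c)) \<and>
     (\<forall>c\<in>A. \<forall>c'\<in>A.
        smooth_on {z \<in> chart_im c \<times> UNIV. case_prod Retr (bundle_chart_inv A c z) \<in> fst c'}
          (snd c' \<circ> case_prod Retr \<circ> bundle_chart_inv A c)) \<and>
     (\<forall>x. Retr x 0 = x \<and> ((snd (chart_at A x) \<circ> Retr x) has_derivative (\<lambda>v. v)) (at 0))"

section \<open>Gradients and Hessians\<close>

text \<open>Gradient with respect to an inner product \<open>ip\<close> on \<open>'e\<close>.\<close>

definition gradient_wrt ::
  "('e::euclidean_space \<Rightarrow> 'e \<Rightarrow> real) \<Rightarrow> ('e \<Rightarrow> real) \<Rightarrow> 'e \<Rightarrow> 'e" where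
  "gradient_wrt ip h s = (THE G. (h has_derivative (\<lambda>v. ip G v)) (at s))"

definition riem_grad ::
  "('m, 'e::euclidean_space) chart set \<Rightarrow> ('m \<Rightarrow> 'e \<Rightarrow> 'e \<Rightarrow> real) \<Rightarrow> ('m \<Rightarrow> real) \<Rightarrow> 'm \<Rightarrow> 'e" where
  "riem_grad A g f x =
     gradient_wrt (g x) (f \<circ> chart_inv (chart_at A x)) (snd (chart_at A x) x)"

definition pullback :: "('m \<Rightarrow> real) \<Rightarrow> ('m \<Rightarrow> 'e \<Rightarrow> 'm) \<Rightarrow> 'm \<Rightarrow> 'e \<Rightarrow> real" where
  "pullback f Retr x = f \<circ> Retr x"

definition pb_grad ::
  "('m \<Rightarrow> 'e::euclidean_space \<Rightarrow> 'e \<Rightarrow> real) \<Rightarrow> ('m \<Rightarrow> 'e \<Rightarrow> 'm) \<Rightarrow> ('m \<Rightarrow> real) \<Rightarrow> 'm \<Rightarrow> 'e \<Rightarrow> 'e" where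
  "pb_grad g Retr f x s = gradient_wrt (g x) (pullback f Retr x) s"

text \<open>The Hessian as a linear operator on the tangent space: the derivative of the gradient field.\<close>

definition pb_hess ::
  "('m \<Rightarrow> 'e::euclidean_space \<Rightarrow> 'e \<Rightarrow> real) \<Rightarrow> ('m \<Rightarrow> 'e \<Rightarrow> 'm) \<Rightarrow> ('m \<Rightarrow> real) \<Rightarrow>
     'm \<Rightarrow> 'e \<Rightarrow> 'e \<Rightarrow> 'e" where
  "pb_hess g Retr f x s = frechet_derivative (pb_grad g Retr f x) (at s)"

definition opnorm_at ::
  "('m \<Rightarrow> 'e::euclidean_space \<Rightarrow> 'e \<Rightarrow> real) \<Rightarrow> 'm \<Rightarrow> ('e \<Rightarrow> 'e) \<Rightarrow> real" where
  "opnorm_at g x H = (SUP v. tnorm g x (H v) / tnorm g x v)"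

definition lambda_min :: "('e::euclidean_space \<Rightarrow> 'e) \<Rightarrow> real" where
  "lambda_min H = Min {\<mu>. \<exists>v. v \<noteq> 0 \<and> H v = \<mu> *\<^sub>R v}"

section \<open>The algorithm\<close>

text \<open>The algorithm accesses the cost function only through its arguments \<open>gr\<close> (the Riemannian
  gradient) and \<open>pgr\<close> (the gradients of the pullbacks); no function values and no Hessians are
  available to it. \<open>nrm\<close> is the family of norms on the tangent spaces.\<close>

primrec tangent_loop ::
  "('e::real_normed_vector \<Rightarrow> real) \<Rightarrow> ('e \<Rightarrow> 'e) \<Rightarrow> real \<Rightarrow> ereal \<Rightarrow> nat \<Rightarrow> 'e \<Rightarrow> 'e" where
  "tangent_loop nrm G \<eta> b 0 s = s"
| "tangent_loop nrm G \<eta> b (Suc n) s =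
     (let s' = s - \<eta> *\<^sub>R G s in
      if b \<le> ereal (nrm s')
      then s - ((SOME \<alpha>. 0 < \<alpha> \<and> \<alpha> \<le> 1 \<and> ereal (nrm (s - (\<alpha> * \<eta>) *\<^sub>R G s)) = b) * \<eta>) *\<^sub>R G s
      else tangent_loop nrm G \<eta> b n s')"

definition tangent_space_steps ::
  "('m \<Rightarrow> 'e::real_normed_vector \<Rightarrow> real) \<Rightarrow> ('m \<Rightarrow> 'e \<Rightarrow> 'e) \<Rightarrow> ('m \<Rightarrow> 'e \<Rightarrow> 'm) \<Rightarrow>
     'm \<Rightarrow> 'e \<Rightarrow> real \<Rightarrow> ereal \<Rightarrow> nat \<Rightarrow> 'm" where
  "tangent_space_steps nrm pgr Retr x s\<^sub>0 \<eta> b n =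
     Retr x (tangent_loop (nrm x) (pgr x) \<eta> b n s\<^sub>0)"

text \<open>The state is the pair of the counter \<open>t\<close> and the current point. \<open>prgd \<dots> w k\<close> is the state
  before the \<open>k\<close>-th pass (counted from 0) through the body of the while-loop, when the draw in the
  \<open>k\<close>-th pass, if that pass makes one, is \<open>w k\<close>. Once \<open>t > T\<close>, the state is frozen, so the passes
  that are executed are exactly those \<open>k\<close> with counter at most \<open>T\<close>.\<close>

primrec prgd ::
  "('m \<Rightarrow> 'e::real_normed_vector \<Rightarrow> real) \<Rightarrow> ('m \<Rightarrow> 'e) \<Rightarrow> ('m \<Rightarrow> 'e \<Rightarrow> 'e) \<Rightarrow> ('m \<Rightarrow> 'e \<Rightarrow> 'm) \<Rightarrow>
     'm \<Rightarrow> real \<Rightarrow> nat \<Rightarrow> real \<Rightarrow> real \<Rightarrow> ereal \<Rightarrow> (nat \<Rightarrow> 'e) \<Rightarrow> nat \<Rightarrow> nat \<times> 'm" where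
  "prgd nrm gr pgr Retr x\<^sub>0 \<eta> N \<epsilon> T b w 0 = (0, x\<^sub>0)"
| "prgd nrm gr pgr Retr x\<^sub>0 \<eta> N \<epsilon> T b w (Suc k) =
     (let (t, x) = prgd nrm gr pgr Retr x\<^sub>0 \<eta> N \<epsilon> T b w k in
      if real t \<le> T then
        if nrm x (gr x) > \<epsilon>
        then (t + 1, tangent_space_steps nrm pgr Retr x 0 \<eta> b 1)
        else (t + N, tangent_space_steps nrm pgr Retr x (\<eta> *\<^sub>R w k) \<eta> b N)
      else (t, x))"

definition tball :: "('m \<Rightarrow> 'e \<Rightarrow> 'e \<Rightarrow> real) \<Rightarrow> real \<Rightarrow> 'm \<Rightarrow> 'e::real_normed_vector set" where
  "tball g r x = {v. tnorm g x v \<le> r}"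

text \<open>Lebesgue measure on \<open>'e\<close> and Lebesgue measure of the inner product space at \<open>x\<close> differ by a
  constant factor only, so they define the same uniform distribution.\<close>

definition uniform_tball :: "('m \<Rightarrow> 'e \<Rightarrow> 'e \<Rightarrow> real) \<Rightarrow> real \<Rightarrow> 'm \<Rightarrow> 'e::euclidean_space measure" where
  "uniform_tball g r x = uniform_measure lborel (tball g r x)"

text \<open>In the following two definitions, \<open>run w k\<close> is the state before pass \<open>k\<close> and \<open>draws st\<close> says
  that a pass starting in state \<open>st\<close> is executed and makes a draw.\<close>

definition admissible_draws ::
  "('m \<Rightarrow> 'e \<Rightarrow> 'e \<Rightarrow> real) \<Rightarrow> real \<Rightarrow> ((nat \<Rightarrow> 'e) \<Rightarrow> nat \<Rightarrow> nat \<times> 'm) \<Rightarrow> (nat \<times> 'm \<Rightarrow> bool) \<Rightarrow>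
     (nat \<Rightarrow> 'e::euclidean_space) \<Rightarrow> bool" where
  "admissible_draws g r run draws w \<longleftrightarrow>
     (\<forall>k. draws (run w k) \<longrightarrow> w k \<in> tball g r (snd (run w k)))"

text \<open>\<open>\<xi> \<omega> k\<close> is the draw in pass \<open>k\<close>. The integral identity says that, given the previous draws
  (which determine the state before pass \<open>k\<close>), on the event that pass \<open>k\<close> makes a draw, \<open>\<xi> \<omega> k\<close> is
  uniformly distributed on the ball in the tangent space at the current point. In the other passes
  \<open>\<xi> \<omega> k\<close> is not used by the algorithm and not constrained.\<close>

definition fresh_uniform_draws ::
  "'w measure \<Rightarrow> ('m \<Rightarrow> 'e \<Rightarrow> 'e \<Rightarrow> real) \<Rightarrow> real \<Rightarrow> ((nat \<Rightarrow> 'e) \<Rightarrow> nat \<Rightarrow> nat \<times> 'm) \<Rightarrow>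
     (nat \<times> 'm \<Rightarrow> bool) \<Rightarrow> ('w \<Rightarrow> nat \<Rightarrow> 'e::euclidean_space) \<Rightarrow> bool" where
  "fresh_uniform_draws P g r run draws \<xi> \<longleftrightarrow>
     (\<forall>k. (\<lambda>\<omega>. \<xi> \<omega> k) \<in> borel_measurable P) \<and>
     (\<forall>\<omega>\<in>space P. admissible_draws g r run draws (\<xi> \<omega>)) \<and>
     (\<forall>k. \<forall>C \<in> sets (PiM {..<k} (\<lambda>_. borel) \<Otimes>\<^sub>M borel).
        emeasure P {\<omega> \<in> space P. draws (run (\<xi> \<omega>) k) \<and> (restrict (\<xi> \<omega>) {..<k}, \<xi> \<omega> k) \<in> C} =
        (\<integral>\<^sup>+\<omega>. indicator {\<omega>. draws (run (\<xi> \<omega>) k)} \<omega> *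
             emeasure (uniform_tball g r (snd (run (\<xi> \<omega>) k))) {v. (restrict (\<xi> \<omega>) {..<k}, v) \<in> C} \<partial>P))"

section \<open>Parameters\<close>

text \<open>In the following, \<open>\<Delta>\<close> stands for \<open>f x\<^sub>0 - f\<^sup>*\<close>.\<close>

definition chi_bound :: "nat \<Rightarrow> real \<Rightarrow> real \<Rightarrow> real \<Rightarrow> real \<Rightarrow> real \<Rightarrow> real" where
  "chi_bound d l \<Delta> \<delta> \<rho> \<epsilon> =
     4 * log 2 (2 ^ 31 * (l\<^sup>2 * sqrt (real d) * \<Delta>) / (\<delta> * sqrt \<rho> * \<epsilon> powr (5/2)))"

definition round_length :: "real \<Rightarrow> real \<Rightarrow> real \<Rightarrow> real \<Rightarrow> real" where
  "round_length l \<rho> \<epsilon> chi = l * chi / sqrt (\<rho> * \<epsilon>)"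

definition round_decrease :: "real \<Rightarrow> real \<Rightarrow> real \<Rightarrow> real" where
  "round_decrease \<rho> \<epsilon> chi = 1 / (50 * chi ^ 3) * sqrt (\<epsilon> ^ 3 / \<rho>)"

definition horizon :: "real \<Rightarrow> real \<Rightarrow> real \<Rightarrow> real \<Rightarrow> real \<Rightarrow> real" where
  "horizon l \<Delta> \<rho> \<epsilon> chi =
     8 * Max {round_length l \<rho> \<epsilon> chi / 3,
              \<Delta> * round_length l \<rho> \<epsilon> chi / round_decrease \<rho> \<epsilon> chi,
              \<Delta> / (1 / l * \<epsilon>\<^sup>2)}"

end

(*
A round started at a point with large gradient decreases f by at least eta * epsilon^2 / 2, and a
perturbed round increases f at most by 27/200 F. For a perturbed round at a strict saddle x, the
initial perturbations from which the descent decreases the pullback by less than F form a set that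
is thin in the direction of an eigenvector e of the least eigenvalue of the Hessian: two descents
that both fail stay within distance 6 Lambda / (25 chi) of the origin ("improve or localize"), where
the dynamics is so close to the linear one that a difference of t e between their starting points
grows by a factor exp (chi / 2), which bounds t by gap. A thin set has small volume, because its
translates by multiples of gap are disjoint and remain, up to radius r / sqrt d, in a slightly
larger ball. By a union bound over the at most T / N + 1 perturbed rounds, with probability at least
1 - delta every perturbed round at a strict saddle decreases f by at least F - 27/200 F, and then
the lower bound for f does not leave room for more than one third of saddles.

The probability of the event makes sense only if the run is a measurable function of the draws. The
gradients of the pullbacks are limits of difference quotients, turned into vectors by Gram-Schmidt
measurably in the metric.
*)

theory Submission
  imports Defs
begin

text \<open>The constants are matched as follows. \<open>N\<close> and \<open>F\<close> satisfy
  \<open>2 * \<eta> * N * F = (\<Lambda> / (5 * chi))\<^sup>2\<close>, so a failing descent stays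
  inside the ball of radius \<Lambda>, and \<Lambda> \<le> \<open>b\<close> is what
  \<open>\<epsilon> \<le> b\<^sup>2 * \<rho>\<close> says. It therefore never takes the truncated
  exit step and is a plain iteration of the gradient map, which can be compared with a linear map.
  Along it the Hessian differs so little from the one at the origin that over \<open>N\<close> steps
  the error stays below 3/5 of the linear growth. One draw fails with probability of order chi^2
  exp(- chi / 2), and there are of order chi^3 draws; the logarithmic lower bound on
  \<open>chi\<close> spends exp(- chi / 4) on the other parameters, and the remaining exp(- chi / 4)
  absorbs chi^5 and the numerical factors. Two things obstruct measurability. Tangent vectors are
  coordinates in preferred charts, which jump, so maps on the tangent bundle are only piecewise
  continuous; and the exit step picks its factor by \<open>SOME\<close>. The run is therefore
  replaced by a copy with an explicit root, which agrees with it for admissible draws.\<close>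

section \<open>Inner products on a Euclidean space\<close>

definition ipnorm :: "('e \<Rightarrow> 'e \<Rightarrow> real) \<Rightarrow> 'e \<Rightarrow> real" where
  "ipnorm ip v = sqrt (ip v v)"

lemma tnorm_eq_ipnorm: "tnorm g x = ipnorm (g x)"
  by (simp add: fun_eq_iff tnorm_def ipnorm_def)

text \<open>The metric at a point is an arbitrary positive definite form, while topology and
  Lebesgue measure come from \<open>'e\<close>. The analysis within one tangent space is done over
  such a form, detached from the manifold.\<close>

locale posdef_form =
  fixes ip :: "'e::euclidean_space \<Rightarrow> 'e \<Rightarrow> real"
  assumes bilinear: "bilinear ip"
    and sym: "ip u v = ip v u"
    and pos: "v \<noteq> 0 \<Longrightarrow> 0 < ip v v"
begin

lemma bounded_bilinear: "bounded_bilinear ip"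
  using bilinear bilinear_conv_bounded_bilinear by blast

lemma continuous_on_ip [continuous_intros]:
  "continuous_on S p \<Longrightarrow> continuous_on S q \<Longrightarrow> continuous_on S (\<lambda>x. ip (p x) (q x))"
  by (rule bounded_bilinear.continuous_on[OF bounded_bilinear])

lemmas ip_simps =
  bilinear_ladd[OF bilinear] bilinear_radd[OF bilinear] bilinear_lsub[OF bilinear]
  bilinear_rsub[OF bilinear] bilinear_lmul[OF bilinear] bilinear_rmul[OF bilinear]
  bilinear_lneg[OF bilinear] bilinear_rneg[OF bilinear]

lemma ip_zero [simp]: "ip 0 v = 0" "ip v 0 = 0"
  by (simp_all add: bilinear_lzero[OF bilinear] bilinear_rzero[OF bilinear])

lemma ip_nonneg [simp]: "0 \<le> ip v v"
  using pos[of v] by (cases "v = 0") auto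

abbreviation nrm :: "'e \<Rightarrow> real" where "nrm \<equiv> ipnorm ip"

lemma nrm_sq: "(nrm v)\<^sup>2 = ip v v"
  by (simp add: ipnorm_def)

lemma nrm_nonneg [simp]: "0 \<le> nrm v"
  by (simp add: ipnorm_def)

lemma nrm_zero [simp]: "nrm 0 = 0"
  by (simp add: ipnorm_def)

lemma nrm_eq_0_iff [simp]: "nrm v = 0 \<longleftrightarrow> v = 0"
  using pos[of v] by (cases "v = 0") (auto simp: ipnorm_def)

lemma nrm_pos: "v \<noteq> 0 \<Longrightarrow> 0 < nrm v"
  using pos[of v] by (simp add: ipnorm_def)

lemma nrm_scaleR [simp]: "nrm (c *\<^sub>R v) = \<bar>c\<bar> * nrm v"
  by (simp add: ipnorm_def ip_simps real_sqrt_mult flip: mult.assoc)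

lemma nrm_minus [simp]: "nrm (- v) = nrm v"
  by (simp add: ipnorm_def ip_simps)

lemma nrm_minus_commute: "nrm (u - v) = nrm (v - u)"
  using nrm_minus[of "u - v"] by simp

lemma Cauchy_Schwarz: "\<bar>ip u v\<bar> \<le> nrm u * nrm v"
proof (cases "v = 0")
  case False
  have "0 \<le> ip (ip v v *\<^sub>R u - ip u v *\<^sub>R v) (ip v v *\<^sub>R u - ip u v *\<^sub>R v)"
    by (rule ip_nonneg)
  also have "\<dots> = ip v v * (ip v v * ip u u - (ip u v)\<^sup>2)"
    by (simp add: ip_simps sym[of v u] power2_eq_square algebra_simps)
  finally have "(ip u v)\<^sup>2 \<le> ip u u * ip v v"
    using pos[OF False] by (simp add: zero_le_mult_iff mult.commute)
  then have "\<bar>ip u v\<bar> \<le> sqrt (ip u u * ip v v)"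
    using real_le_rsqrt[of "\<bar>ip u v\<bar>"] by simp
  then show ?thesis by (simp add: ipnorm_def real_sqrt_mult)
qed simp

lemma ip_le: "ip u v \<le> nrm u * nrm v"
  using Cauchy_Schwarz[of u v] by linarith

lemma nrm_add_sq: "(nrm (u + v))\<^sup>2 = (nrm u)\<^sup>2 + 2 * ip u v + (nrm v)\<^sup>2"
  by (simp add: nrm_sq ip_simps sym[of v u])

lemma nrm_triangle: "nrm (u + v) \<le> nrm u + nrm v"
proof (rule power2_le_imp_le)
  show "(nrm (u + v))\<^sup>2 \<le> (nrm u + nrm v)\<^sup>2"
    using ip_le[of u v] by (simp add: nrm_add_sq power2_sum)
qed simp

lemma nrm_triangle_diff: "nrm (u - v) \<le> nrm u + nrm v"
  using nrm_triangle[of u "- v"] by simp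

lemma nrm_triangle_rev: "nrm u - nrm v \<le> nrm (u - v)"
  using nrm_triangle[of "u - v" v] by simp

lemma continuous_on_nrm [continuous_intros]:
  "continuous_on S p \<Longrightarrow> continuous_on S (\<lambda>x. nrm (p x))"
  unfolding ipnorm_def by (intro continuous_intros)

lemma nrm_convex: "nrm u \<le> r \<Longrightarrow> nrm v \<le> r \<Longrightarrow> 0 \<le> t \<Longrightarrow> t \<le> 1 \<Longrightarrow> nrm (u + t *\<^sub>R (v - u)) \<le> r"
proof -
  assume *: "nrm u \<le> r" "nrm v \<le> r" "0 \<le> t" "t \<le> 1"
  have "u + t *\<^sub>R (v - u) = (1 - t) *\<^sub>R u + t *\<^sub>R v"
    by (simp add: algebra_simps)
  then have "nrm (u + t *\<^sub>R (v - u)) \<le> (1 - t) * nrm u + t * nrm v"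
    using nrm_triangle[of "(1 - t) *\<^sub>R u" "t *\<^sub>R v"] * by simp
  also have "\<dots> \<le> (1 - t) * r + t * r"
    using * by (intro add_mono mult_left_mono) auto
  finally show ?thesis by (simp add: algebra_simps)
qed

text \<open>The minimum of \<open>nrm\<close> over the compact Euclidean unit sphere is positive.
  This half of the equivalence of norms makes the balls of \<open>nrm\<close> compact.\<close>

lemma norm_le_nrm: "\<exists>c>0. \<forall>v. norm v \<le> c * nrm v"
proof -
  let ?S = "sphere (0::'e) 1"
  obtain b :: 'e where "b \<in> Basis" using nonempty_Basis by blast
  then have "?S \<noteq> {}" by (auto intro!: exI[of _ b])
  moreover have "continuous_on ?S nrm" by (intro continuous_intros)
  ultimately obtain v0 where v0: "v0 \<in> ?S" "\<And>v. v \<in> ?S \<Longrightarrow> nrm v0 \<le> nrm v"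
    using continuous_attains_inf[of ?S nrm] by auto
  have p: "0 < nrm v0" using v0(1) by (intro nrm_pos) auto
  show ?thesis
  proof (intro exI[of _ "1 / nrm v0"] conjI allI)
    fix v :: 'e
    show "norm v \<le> 1 / nrm v0 * nrm v"
    proof (cases "v = 0")
      case False
      have "nrm v0 \<le> nrm ((1 / norm v) *\<^sub>R v)" using False by (intro v0) auto
      then show ?thesis using False p by (simp add: field_simps)
    qed simp
  qed (use p in auto)
qed

lemma nrm_le_norm: "\<exists>C>0. \<forall>v. nrm v \<le> C * norm v"
proof -
  obtain K where K: "0 < K" "\<And>a b. norm (ip a b) \<le> norm a * norm b * K"
    using bounded_bilinear.pos_bounded[OF bounded_bilinear] by blast
  show ?thesis
  proof (intro exI[of _ "sqrt K"] conjI allI)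
    fix v :: 'e
    have "nrm v \<le> sqrt (norm v * norm v * K)"
      using K(2)[of v v] by (simp add: ipnorm_def)
    then show "nrm v \<le> sqrt K * norm v" by (simp add: real_sqrt_mult mult.commute)
  qed (use K in auto)
qed

lemma ip_eqI: "(\<And>v. ip u v = ip w v) \<Longrightarrow> u = w"
proof -
  assume *: "\<And>v. ip u v = ip w v"
  have "ip (u - w) (u - w) = 0" using *[of "u - w"] by (simp only: ip_simps)
  then show ?thesis using pos[of "u - w"] by auto
qed

lemma compact_nrm_ball: "compact {v. nrm v \<le> r}"
proof -
  obtain c where c: "0 < c" "\<And>v. norm v \<le> c * nrm v" using norm_le_nrm by blast
  have "bounded {v. nrm v \<le> r}"
  proof (rule boundedI)
    fix v assume "v \<in> {v. nrm v \<le> r}"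
    then have "c * nrm v \<le> c * r" using c by simp
    then show "norm v \<le> c * r" using c(2)[of v] by linarith
  qed
  moreover have "closed {v. nrm v \<le> r}"
    by (intro closed_Collect_le continuous_intros)
  ultimately show ?thesis by (simp add: compact_eq_bounded_closed)
qed

lemma nrm_ball_borel [measurable]: "{v. nrm v \<le> r} \<in> sets borel"
  by (intro borel_closed closed_Collect_le continuous_intros)

lemma emeasure_nrm_ball_finite: "emeasure lborel {v. nrm v \<le> r} < \<infinity>"
  by (intro emeasure_bounded_finite compact_imp_bounded compact_nrm_ball)

lemma emeasure_nrm_ball_pos:
  assumes "0 < r" shows "0 < emeasure lborel {v. nrm v \<le> r}"
proof -
  obtain C where C: "0 < C" "\<And>v. nrm v \<le> C * norm v" using nrm_le_norm by blast
  have sub: "ball 0 (r / C) \<subseteq> {v. nrm v \<le> r}"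
  proof
    fix v :: 'e assume "v \<in> ball 0 (r / C)"
    then have "C * norm v \<le> r" using C(1) by (simp add: field_simps)
    then show "v \<in> {v. nrm v \<le> r}" using C(2)[of v] by simp
  qed
  have "0 < measure lborel (ball (0::'e) (r / C))"
    using content_ball_pos[of "r / C" "0::'e"] assms C(1) by simp
  then have "0 < emeasure lborel (ball (0::'e) (r / C))"
    unfolding measure_def enn2real_positive_iff by blast
  also have "\<dots> \<le> emeasure lborel {v. nrm v \<le> r}"
    by (intro emeasure_mono sub) simp
  finally show ?thesis .
qed

end

text \<open>Gram--Schmidt, one basis vector at a time: this gives the Riesz representation of a
  functional, measurably in a parameter of the form and of the functional.\<close>

lemma riesz_measurable_span:
  fixes ip :: "'w \<Rightarrow> 'e::euclidean_space \<Rightarrow> 'e \<Rightarrow> real"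
  assumes form: "\<And>x. x \<in> space M \<Longrightarrow> posdef_form (ip x)"
    and ip_meas: "\<And>u v. (\<lambda>x. ip x u v) \<in> borel_measurable M"
    and "finite B" "independent B"
    and lin: "\<And>x. x \<in> space M \<Longrightarrow> linear (\<phi> x)"
    and phi_meas: "\<And>v. (\<lambda>x. \<phi> x v) \<in> borel_measurable M"
  shows "\<exists>S\<in>borel_measurable M. \<forall>x\<in>space M. S x \<in> span B \<and> (\<forall>v\<in>span B. ip x (S x) v = \<phi> x v)"
  using assms(3-)
proof (induction B arbitrary: \<phi> rule: finite_induct)
  case empty
  show ?case
    by (rule bexI[of _ "\<lambda>_. 0"])
      (use empty.prems(2) in \<open>auto simp: linear_0 bilinear_lzero[OF posdef_form.bilinear[OF form]]\<close>)
next
  case (insert b B)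
  have ind: "independent B" and b: "b \<notin> span B"
    using insert.hyps insert.prems(1) by (auto simp: independent_insert split: if_splits)
  \<comment> \<open>A moving functional at a moving vector is measurable: expanding the vector in
    \<open>Basis\<close> leaves the functional at fixed vectors only.\<close>
  have meas_lin: "(\<lambda>x. \<psi> x (S x)) \<in> borel_measurable M"
    if lin: "\<And>x. x \<in> space M \<Longrightarrow> linear (\<psi> x)" and m: "\<And>v. (\<lambda>x. \<psi> x v) \<in> borel_measurable M"
      and [measurable]: "S \<in> borel_measurable M" for \<psi> :: "'w \<Rightarrow> 'e \<Rightarrow> real" and S
  proof -
    note [measurable] = m
    have "\<psi> x (S x) = (\<Sum>i\<in>Basis. (S x \<bullet> i) * \<psi> x i)" if "x \<in> space M" for x
    proof -
      have "\<psi> x (S x) = \<psi> x (\<Sum>i\<in>Basis. (S x \<bullet> i) *\<^sub>R i)" by (simp add: euclidean_representation)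
      then show ?thesis by (simp add: linear_sum[OF lin[OF that]] linear_cmul[OF lin[OF that]])
    qed
    then show ?thesis by (subst measurable_cong) auto
  qed
  have ip_lin: "linear (ip x u)" "linear (\<lambda>u. ip x u v)" if "x \<in> space M" for x u v
    using posdef_form.bilinear[OF form[OF that]] by (auto simp: bilinear_def)
  have "\<exists>S\<in>borel_measurable M. \<forall>x\<in>space M. S x \<in> span B \<and> (\<forall>v\<in>span B. ip x (S x) v = ip x b v)"
    by (rule insert.IH) (use ind ip_lin ip_meas in auto)
  then obtain p where p [measurable]: "p \<in> borel_measurable M"
    and p': "\<And>x. x \<in> space M \<Longrightarrow> p x \<in> span B"
      "\<And>x v. x \<in> space M \<Longrightarrow> v \<in> span B \<Longrightarrow> ip x (p x) v = ip x b v" by blast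
  have "\<exists>S\<in>borel_measurable M. \<forall>x\<in>space M. S x \<in> span B \<and> (\<forall>v\<in>span B. ip x (S x) v = \<phi> x v)"
    by (rule insert.IH) (use ind insert.prems in auto)
  then obtain S where S [measurable]: "S \<in> borel_measurable M"
    and S': "\<And>x. x \<in> space M \<Longrightarrow> S x \<in> span B"
      "\<And>x v. x \<in> space M \<Longrightarrow> v \<in> span B \<Longrightarrow> ip x (S x) v = \<phi> x v" by blast
  \<comment> \<open>\<open>q x\<close> is the component of \<open>b\<close> orthogonal to
    \<open>span B\<close>, nonzero by independence. Adding a multiple of it to \<open>S x\<close>
    corrects the value at \<open>q x\<close>, hence at \<open>b\<close>, and keeps the values on
    \<open>span B\<close>.\<close>
  define q where "q x = b - p x" for x
  define S2 where "S2 x = S x + (\<phi> x (q x) / ip x b (q x)) *\<^sub>R q x" for x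
  have q_meas [measurable]: "q \<in> borel_measurable M" unfolding q_def by measurable
  have [measurable]: "(\<lambda>x. \<phi> x (q x)) \<in> borel_measurable M" "(\<lambda>x. ip x b (q x)) \<in> borel_measurable M"
    by (rule meas_lin; use insert.prems ip_meas ip_lin q_meas in blast)+
  have "S2 \<in> borel_measurable M" unfolding S2_def by measurable
  moreover have "S2 x \<in> span (insert b B) \<and> (\<forall>v\<in>span (insert b B). ip x (S2 x) v = \<phi> x v)"
    if x: "x \<in> space M" for x
  proof
    interpret posdef_form "ip x" by (rule form[OF x])
    have sub: "span B \<subseteq> span (insert b B)" by (rule span_mono) auto
    have qs: "q x \<in> span (insert b B)" unfolding q_def
      by (rule span_diff[OF span_base]) (use p'(1)[OF x] sub in auto)
    then show "S2 x \<in> span (insert b B)" unfolding S2_def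
      using S'(1)[OF x] sub by (intro span_add span_scale) auto
    have qv: "ip x (q x) v = 0" if "v \<in> span B" for v
      using p'(2)[OF x that] by (simp add: q_def ip_simps)
    have "q x \<noteq> 0" using b p'(1)[OF x] by (auto simp: q_def)
    then have "0 < ip x (q x) (q x)" by (rule pos)
    moreover have "ip x (q x) (q x) = ip x b (q x)"
      using qv[OF p'(1)[OF x]] by (simp add: q_def ip_simps sym)
    ultimately have qq: "ip x b (q x) \<noteq> 0" by simp
    show "\<forall>v\<in>span (insert b B). ip x (S2 x) v = \<phi> x v"
    proof
      fix v assume "v \<in> span (insert b B)"
      then obtain k where k: "v - k *\<^sub>R b \<in> span B" by (auto simp: span_insert)
      define w where "w = v - k *\<^sub>R b + k *\<^sub>R p x"
      have w: "w \<in> span B" unfolding w_def using k p'(1)[OF x] by (intro span_add span_scale)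
      have v: "v = w + k *\<^sub>R q x" by (simp add: w_def q_def algebra_simps)
      have "ip x (S x) (q x) = 0"
        using qv[OF S'(1)[OF x]] by (simp add: sym)
      then have "ip x (S2 x) v = \<phi> x w + k * \<phi> x (q x) * (ip x (q x) (q x) / ip x b (q x))"
        using qv[OF w] S'(2)[OF x w] by (simp add: v S2_def ip_simps)
      then show "ip x (S2 x) v = \<phi> x v"
        using qq \<open>ip x (q x) (q x) = ip x b (q x)\<close> insert.prems(2)[OF x]
        by (simp add: v linear_add linear_cmul)
    qed
  qed
  ultimately show ?case by blast
qed

text \<open>The representing vector is unique, so a field \<open>G\<close> known only through the
  functionals it represents, such as a gradient defined by \<open>THE\<close>, inherits
  measurability from Gram-Schmidt.\<close>

lemma riesz_measurable:
  fixes ip :: "'w \<Rightarrow> 'e::euclidean_space \<Rightarrow> 'e \<Rightarrow> real"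
  assumes form: "\<And>x. x \<in> space M \<Longrightarrow> posdef_form (ip x)"
    and ip_meas: "\<And>u v. (\<lambda>x. ip x u v) \<in> borel_measurable M"
    and lin: "\<And>x. x \<in> space M \<Longrightarrow> linear (\<phi> x)"
    and phi_meas: "\<And>v. (\<lambda>x. \<phi> x v) \<in> borel_measurable M"
    and G: "\<And>x v. x \<in> space M \<Longrightarrow> ip x (G x) v = \<phi> x v"
  shows "G \<in> borel_measurable M"
proof -
  obtain S where S: "S \<in> borel_measurable M" "\<And>x v. x \<in> space M \<Longrightarrow> ip x (S x) v = \<phi> x v"
    using riesz_measurable_span[OF form ip_meas finite_Basis independent_Basis lin phi_meas]
    by auto
  have "S x = G x" if "x \<in> space M" for x
    by (rule posdef_form.ip_eqI[OF form[OF that]]) (simp add: S(2) G that)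
  then show ?thesis using S(1) by (simp cong: measurable_cong)
qed

context posdef_form
begin

lemma riesz:
  assumes "linear \<phi>" obtains G where "\<And>v. ip G v = \<phi> v"
proof -
  \<comment> \<open>Over a one-point parameter space the measurable version is the ordinary Riesz
    representation.\<close>
  have "\<exists>S\<in>borel_measurable (count_space (UNIV :: unit set)). \<forall>x\<in>space (count_space (UNIV :: unit set)).
      S x \<in> span Basis \<and> (\<forall>v\<in>span Basis. ip (S x) v = \<phi> v)"
    by (rule riesz_measurable_span) (use assms posdef_form_axioms independent_Basis in auto)
  then show thesis using that by auto
qed

lemma gradient_wrt_eqI:
  assumes "(h has_derivative ip G) (at s)" shows "gradient_wrt ip h s = G"
  unfolding gradient_wrt_def
proof (rule the_equality)
  show "(h has_derivative (\<lambda>v. ip G v)) (at s)" using assms .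
  fix G' assume "(h has_derivative (\<lambda>v. ip G' v)) (at s)"
  then have "(\<lambda>v. ip G' v) = ip G" using assms by (rule has_derivative_unique)
  then show "G' = G" by (intro ip_eqI) metis
qed

lemma gradient_wrt_derivative:
  assumes "h differentiable (at s)"
  shows "(h has_derivative ip (gradient_wrt ip h s)) (at s)"
proof -
  obtain D where D: "(h has_derivative D) (at s)" using assms by (auto simp: differentiable_def)
  obtain G where "\<And>v. ip G v = D v" using riesz has_derivative_linear[OF D] by blast
  then have "ip G = D" by auto
  with D have "(h has_derivative ip G) (at s)" by simp
  then show ?thesis using gradient_wrt_eqI by metis
qed

end

section \<open>Symmetric operators\<close>

context posdef_form
begin

text \<open>Expand the form of \<open>M\<close> at \<open>c v - M v\<close>.\<close>

lemma nrm_symmetric_le: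
  assumes "linear M" and symM: "\<And>u v. ip (M u) v = ip u (M v)"
    and psd: "\<And>v. 0 \<le> ip (M v) v" and le: "\<And>v. ip (M v) v \<le> c * ip v v" and c: "0 < c"
  shows "nrm (M v) \<le> c * nrm v"
proof (rule power2_le_imp_le)
  define w where "w = M v"
  have "0 \<le> ip (M (c *\<^sub>R v - w)) (c *\<^sub>R v - w)" by (rule psd)
  also have "\<dots> = c\<^sup>2 * ip (M v) v - 2 * c * ip w w + ip (M w) w"
    using symM[of w v] by (simp add: linear_diff[OF assms(1)] linear_cmul[OF assms(1)] ip_simps
      sym[of v w] power2_eq_square algebra_simps flip: w_def)
  also have "\<dots> \<le> c\<^sup>2 * (c * ip v v) - 2 * c * ip w w + c * ip w w"
    using le c by (intro add_mono diff_mono mult_left_mono) auto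
  also have "\<dots> = c * (c\<^sup>2 * ip v v - ip w w)" by (simp add: algebra_simps)
  finally have "ip w w \<le> c\<^sup>2 * ip v v" using c by (simp add: zero_le_mult_iff)
  then show "(nrm (M v))\<^sup>2 \<le> (c * nrm v)\<^sup>2"
    by (simp add: power_mult_distrib nrm_sq flip: w_def)
qed (use c in simp)

text \<open>\<open>lambda_min\<close> is a \<open>Min\<close>, which is meaningful only for a finite
  set. Eigenvectors to distinct eigenvalues are orthogonal, hence independent, hence finitely
  many.\<close>

lemma finite_eigenvalues:
  assumes symH: "\<And>u v. ip (H u) v = ip u (H v)"
  shows "finite {\<mu>. \<exists>v. v \<noteq> 0 \<and> H v = \<mu> *\<^sub>R v}" (is "finite ?E")
proof -
  have "\<forall>\<mu>\<in>?E. \<exists>v. v \<noteq> 0 \<and> H v = \<mu> *\<^sub>R v" by blast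
  then obtain v where v: "\<And>\<mu>. \<mu> \<in> ?E \<Longrightarrow> v \<mu> \<noteq> 0 \<and> H (v \<mu>) = \<mu> *\<^sub>R v \<mu>"
    by metis
  have orth: "ip (v \<mu>) (v \<nu>) = 0" if "\<mu> \<in> ?E" "\<nu> \<in> ?E" "\<mu> \<noteq> \<nu>" for \<mu> \<nu>
  proof -
    have "\<mu> * ip (v \<mu>) (v \<nu>) = \<nu> * ip (v \<mu>) (v \<nu>)"
      using symH[of "v \<mu>" "v \<nu>"] v[OF that(1)] v[OF that(2)] by (simp add: ip_simps)
    then show ?thesis using that(3) by simp
  qed
  have inj: "inj_on v ?E"
  proof (rule inj_onI)
    fix \<mu> \<nu> assume *: "\<mu> \<in> ?E" "\<nu> \<in> ?E" "v \<mu> = v \<nu>"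
    have "\<mu> *\<^sub>R v \<mu> = \<nu> *\<^sub>R v \<mu>" using v[OF *(1)] v[OF *(2)] unfolding *(3) by metis
    then show "\<mu> = \<nu>" using v[OF *(1)] by simp
  qed
  have "independent (v ` ?E)"
    unfolding dependent_explicit
  proof (rule notI, elim exE conjE bexE)
    fix T a x assume T: "finite T" "T \<subseteq> v ` ?E" "(\<Sum>y\<in>T. a y *\<^sub>R y) = 0" "x \<in> T" "a x \<noteq> 0"
    have "ip (\<Sum>y\<in>T. a y *\<^sub>R y) x = (\<Sum>y\<in>T. a y * ip y x)"
      by (simp add: bounded_bilinear.sum_left[OF bounded_bilinear] ip_simps)
    also have "\<dots> = (\<Sum>y\<in>T. if y = x then a x * ip x x else 0)"
    proof (intro sum.cong refl)
      fix y assume y: "y \<in> T"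
      obtain \<mu> \<nu> where "\<mu> \<in> ?E" "y = v \<mu>" "\<nu> \<in> ?E" "x = v \<nu>" using T(2,4) y by blast
      then show "a y * ip y x = (if y = x then a x * ip x x else 0)"
        using orth[of \<mu> \<nu>] by (cases "\<mu> = \<nu>") auto
    qed
    also have "\<dots> = a x * ip x x" using T(1,4) by simp
    finally have "a x * ip x x = 0" using T(3) by simp
    then have "x = 0" using T(5) pos[of x] by auto
    moreover obtain \<mu> where "\<mu> \<in> ?E" "x = v \<mu>" using T(2,4) by blast
    ultimately show False using v[of \<mu>] by simp
  qed
  then have "finite (v ` ?E)" by (rule independent_imp_finite)
  then show ?thesis using inj by (simp add: finite_image_iff)
qed

text \<open>A minimizer \<open>e\<close> of the Rayleigh quotient is an eigenvector: if the residual
  \<open>w\<close> were not zero, moving from \<open>e\<close> against \<open>w\<close> would lower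
  the form by \<open>2 * t * ip w w\<close> to first order, which the term
  \<open>t\<^sup>2 * q\<close> cannot make up for small \<open>t\<close>.\<close>

lemma lambda_min_props:
  assumes "linear H" and symH: "\<And>u v. ip (H u) v = ip u (H v)"
  shows "\<exists>e. nrm e = 1 \<and> H e = lambda_min H *\<^sub>R e"
    and "lambda_min H * ip v v \<le> ip (H v) v"
proof -
  let ?S = "{v. nrm v = 1}"
  obtain b :: 'e where b: "b \<in> Basis" using nonempty_Basis by blast
  then have "(1 / nrm b) *\<^sub>R b \<in> ?S" using nrm_pos[of b] by auto
  then have "?S \<noteq> {}" by blast
  moreover have "closed ?S" by (intro closed_Collect_eq continuous_intros)
  then have "compact ({v. nrm v \<le> 1} \<inter> ?S)" by (intro compact_Int_closed compact_nrm_ball)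
  then have "compact ?S" by (rule back_subst[of compact]) auto
  moreover have "continuous_on ?S (\<lambda>v. ip (H v) v)"
    by (intro continuous_intros linear_continuous_on linear_conv_bounded_linear[THEN iffD1] assms)
  ultimately obtain e where e: "nrm e = 1" "\<And>v. nrm v = 1 \<Longrightarrow> ip (H e) e \<le> ip (H v) v"
    using continuous_attains_inf[of ?S "\<lambda>v. ip (H v) v"] by auto
  define \<mu> where "\<mu> = ip (H e) e"
  have min: "\<mu> * ip v v \<le> ip (H v) v" for v
  proof (cases "v = 0")
    case False
    then have p: "0 < nrm v" by (rule nrm_pos)
    have "\<mu> \<le> ip (H ((1 / nrm v) *\<^sub>R v)) ((1 / nrm v) *\<^sub>R v)"
      unfolding \<mu>_def using False by (intro e) simp
    also have "\<dots> = ip (H v) v / (nrm v)\<^sup>2"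
      by (simp add: linear_cmul[OF assms(1)] ip_simps power2_eq_square)
    finally show ?thesis using pos[OF False] by (simp add: pos_le_divide_eq nrm_sq)
  qed (simp add: linear_0[OF assms(1)])
  define w where "w = H e - \<mu> *\<^sub>R e"
  have "w = 0"
  proof (rule ccontr)
    assume "w \<noteq> 0"
    then have n: "0 < ip w w" by (rule pos)
    define q where "q = ip (H w) w - \<mu> * ip w w"
    have q: "0 \<le> q" using min[of w] by (simp add: q_def)
    have "ip e e = 1" using e(1) nrm_sq[of e] by simp
    have *: "0 \<le> t * (t * q - 2 * ip w w)" for t
    proof -
      have "\<mu> * ip (e - t *\<^sub>R w) (e - t *\<^sub>R w) \<le> ip (H (e - t *\<^sub>R w)) (e - t *\<^sub>R w)" by (rule min)
      also have "ip (H (e - t *\<^sub>R w)) (e - t *\<^sub>R w)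
          = ip (H e) e - 2 * t * ip (H e) w + t\<^sup>2 * ip (H w) w"
        using symH[of w e] by (simp add: linear_diff[OF assms(1)] linear_cmul[OF assms(1)] ip_simps
            sym[of w "H e"] power2_eq_square algebra_simps)
      finally have "0 \<le> - 2 * t * (ip (H e) w - \<mu> * ip e w) + t\<^sup>2 * q"
        using \<open>ip e e = 1\<close> by (simp add: ip_simps sym[of w e] \<mu>_def q_def power2_eq_square algebra_simps)
      moreover have "ip (H e) w - \<mu> * ip e w = ip w w"
        by (simp add: w_def ip_simps sym algebra_simps)
      ultimately show ?thesis by (simp add: power2_eq_square algebra_simps)
    qed
    \<comment> \<open>With this \<open>t\<close> the product \<open>t * q\<close> stays below
      \<open>ip w w\<close>; the summand 1 covers \<open>q = 0\<close>.\<close>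
    define t where "t = ip w w / (q + 1)"
    have t: "0 < t" using n q by (simp add: t_def)
    then have "2 * ip w w \<le> t * q" using *[of t] by (simp add: zero_le_mult_iff)
    also have "t * q = ip w w * (q / (q + 1))" by (simp add: t_def)
    also have "\<dots> \<le> ip w w * 1" using n q by (intro mult_left_mono) auto
    finally show False using n by simp
  qed
  then have He: "H e = \<mu> *\<^sub>R e" by (simp add: w_def)
  have "lambda_min H = \<mu>"
    unfolding lambda_min_def
  proof (rule Min_eqI)
    show "finite {\<mu>. \<exists>v. v \<noteq> 0 \<and> H v = \<mu> *\<^sub>R v}" by (rule finite_eigenvalues[OF symH])
    show "\<mu> \<in> {\<mu>. \<exists>v. v \<noteq> 0 \<and> H v = \<mu> *\<^sub>R v}" using He e(1) by (auto intro!: exI[of _ e])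
    fix \<nu> assume "\<nu> \<in> {\<mu>. \<exists>v. v \<noteq> 0 \<and> H v = \<mu> *\<^sub>R v}"
    then obtain v where "v \<noteq> 0" "H v = \<nu> *\<^sub>R v" by blast
    then show "\<mu> \<le> \<nu>" using min[of v] pos[of v] by (simp add: ip_simps)
  qed
  then show "\<exists>e. nrm e = 1 \<and> H e = lambda_min H *\<^sub>R e" "lambda_min H * ip v v \<le> ip (H v) v"
    using e(1) He min by auto
qed

text \<open>Replaces the \<open>Min\<close> over eigenvalues by a condition on single vectors, which
  a countable dense set can test; this is how sets defined through \<open>lambda_min\<close> become
  Borel.\<close>

lemma le_lambda_min_iff:
  assumes "linear H" and symH: "\<And>u v. ip (H u) v = ip u (H v)"
  shows "a \<le> lambda_min H \<longleftrightarrow> (\<forall>v. a * ip v v \<le> ip (H v) v)"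
proof
  assume "a \<le> lambda_min H"
  then have "a * ip v v \<le> lambda_min H * ip v v" for v by (rule mult_right_mono) simp
  then show "\<forall>v. a * ip v v \<le> ip (H v) v"
    using lambda_min_props(2)[OF assms] order_trans by blast
next
  assume *: "\<forall>v. a * ip v v \<le> ip (H v) v"
  obtain e where e: "nrm e = 1" "H e = lambda_min H *\<^sub>R e"
    using lambda_min_props(1)[OF assms] by blast
  have "ip e e = 1" using nrm_sq[of e] e(1) by simp
  then show "a \<le> lambda_min H" using *[rule_format, of e] e(2) by (simp add: ip_simps)
qed

end

section \<open>Gradient descent in one tangent space\<close>

locale gd_space = posdef_form ip
  for ip :: "'e::euclidean_space \<Rightarrow> 'e \<Rightarrow> real" +
  fixes h :: "'e \<Rightarrow> real" and G :: "'e \<Rightarrow> 'e" and l \<eta> :: real and b :: ereal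
  assumes grad: "(h has_derivative ip (G s)) (at s)"
    and l_pos: "0 < l" and eta: "\<eta> = 1 / l"
    and lip: "ereal (nrm s) \<le> b \<Longrightarrow> ereal (nrm s') \<le> b \<Longrightarrow> nrm (G s - G s') \<le> l * nrm (s - s')"
begin

lemma eta_pos: "0 < \<eta>"
  using l_pos by (simp add: eta)

lemma convex_ball:
  assumes "ereal (nrm u) \<le> b" "ereal (nrm v) \<le> b" "0 \<le> t" "t \<le> 1"
  shows "ereal (nrm (u + t *\<^sub>R (v - u))) \<le> b"
proof -
  \<comment> \<open>The larger of the two norms serves as a real radius, because \<open>b\<close>
    may be infinite.\<close>
  have "nrm (u + t *\<^sub>R (v - u)) \<le> max (nrm u) (nrm v)"
    using assms by (intro nrm_convex) auto
  then have "ereal (nrm (u + t *\<^sub>R (v - u))) \<le> ereal (max (nrm u) (nrm v))"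
    by (simp only: ereal_less_eq)
  also have "\<dots> \<le> b" using assms by (simp add: max_def)
  finally show ?thesis .
qed

text \<open>Along the segment, the gradient changes by at most \<open>l * t * nrm d\<close>, so
  \<open>h\<close> minus its quadratic upper model has nonpositive derivative.\<close>

lemma descent:
  assumes s: "ereal (nrm s) \<le> b" and s': "ereal (nrm s') \<le> b"
  shows "h s' \<le> h s + ip (G s) (s' - s) + l / 2 * (nrm (s' - s))\<^sup>2"
proof -
  define d where "d = s' - s"
  define \<phi> where "\<phi> t = h (s + t *\<^sub>R d) - t * ip (G s) d - l / 2 * t\<^sup>2 * (nrm d)\<^sup>2" for t
  have der: "(\<phi> has_real_derivative (ip (G (s + t *\<^sub>R d)) d - ip (G s) d - l * t * (nrm d)\<^sup>2)) (at t)" for t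
  proof -
    have "((\<lambda>t. h (s + t *\<^sub>R d)) has_derivative (\<lambda>x. ip (G (s + t *\<^sub>R d)) (x *\<^sub>R d))) (at t)"
      by (rule has_derivative_compose[OF _ grad]) (auto intro!: derivative_eq_intros)
    then have 1: "((\<lambda>t. h (s + t *\<^sub>R d)) has_real_derivative ip (G (s + t *\<^sub>R d)) d) (at t)"
      by (simp add: has_field_derivative_def ip_simps mult_commute_abs)
    show ?thesis unfolding \<phi>_def[abs_def]
      by (rule derivative_eq_intros 1 refl | simp)+
  qed
  have "\<phi> 1 \<le> \<phi> 0"
  proof (rule DERIV_nonpos_imp_nonincreasing[of 0 1 \<phi>])
    fix t :: real assume t: "0 \<le> t" "t \<le> 1"
    have "ip (G (s + t *\<^sub>R d) - G s) d \<le> nrm (G (s + t *\<^sub>R d) - G s) * nrm d" by (rule ip_le)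
    also have "\<dots> \<le> (l * nrm (s + t *\<^sub>R d - s)) * nrm d"
      unfolding d_def by (intro mult_right_mono lip convex_ball s s' t) simp
    also have "\<dots> = l * t * (nrm d)\<^sup>2" using t by (simp add: power2_eq_square)
    finally show "\<exists>y. (\<phi> has_real_derivative y) (at t) \<and> y \<le> 0"
      using der[of t] by (auto simp: ip_simps intro!: exI)
  qed simp
  then show ?thesis by (simp add: \<phi>_def d_def)
qed

text \<open>As \<eta> is the inverse of \<open>l\<close>, the linear term of \<open>descent\<close>
  is \<open>- 2 * Q\<close> and the quadratic one \<open>a * Q\<close>, which leaves a gain of at
  least \<open>Q\<close>. The second conclusion is "improve or localize" for one step: its squared
  length is paid for by the decrease.\<close>

lemma partial_step_descent:
  assumes s: "ereal (nrm s) \<le> b" and s': "ereal (nrm (s - (a * \<eta>) *\<^sub>R G s)) \<le> b" and a: "0 \<le> a" "a \<le> 1"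
  shows "h (s - (a * \<eta>) *\<^sub>R G s) \<le> h s - a * \<eta> / 2 * (nrm (G s))\<^sup>2"
    and "(nrm (s - (a * \<eta>) *\<^sub>R G s - s))\<^sup>2 \<le> 2 * \<eta> * (h s - h (s - (a * \<eta>) *\<^sub>R G s))"
proof -
  let ?s' = "s - (a * \<eta>) *\<^sub>R G s"
  define Q where "Q = a * \<eta> / 2 * (nrm (G s))\<^sup>2"
  have "0 \<le> Q" using a eta_pos by (simp add: Q_def)
  have "ip (G s) (- (a * \<eta>) *\<^sub>R G s) = - 2 * Q" by (simp add: Q_def ip_simps nrm_sq)
  moreover have "l / 2 * (nrm (- (a * \<eta>) *\<^sub>R G s))\<^sup>2 = a * Q"
    using l_pos a by (simp add: Q_def eta power2_eq_square mult_ac)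
  moreover have "a * Q \<le> 1 * Q" using a(2) \<open>0 \<le> Q\<close> by (rule mult_right_mono)
  moreover have "?s' - s = - (a * \<eta>) *\<^sub>R G s" by simp
  ultimately have "h ?s' \<le> h s - Q"
    using descent[OF s s'] by (simp only:)
  then show 1: "h ?s' \<le> h s - a * \<eta> / 2 * (nrm (G s))\<^sup>2" by (simp only: Q_def)
  have "(nrm (?s' - s))\<^sup>2 = a * (a * \<eta>\<^sup>2 * (nrm (G s))\<^sup>2)"
    by (simp add: power_mult_distrib power2_eq_square)
  also have "\<dots> \<le> 1 * (a * \<eta>\<^sup>2 * (nrm (G s))\<^sup>2)"
    using a by (intro mult_right_mono) auto
  also have "\<dots> = 2 * \<eta> * (a * \<eta> / 2 * (nrm (G s))\<^sup>2)" by (simp add: power2_eq_square)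
  also have "\<dots> \<le> 2 * \<eta> * (h s - h ?s')"
    using 1 eta_pos by (intro mult_left_mono) auto
  finally show "(nrm (?s' - s))\<^sup>2 \<le> 2 * \<eta> * (h s - h ?s')" .
qed

section \<open>The descent loop with its truncated exit step\<close>

definition step :: "'e \<Rightarrow> 'e" where "step s = s - \<eta> *\<^sub>R G s"

definition exit_factor :: "'e \<Rightarrow> real" where
  "exit_factor s = (SOME \<alpha>. 0 < \<alpha> \<and> \<alpha> \<le> 1 \<and> ereal (nrm (s - (\<alpha> * \<eta>) *\<^sub>R G s)) = b)"

text \<open>The choice is possible by the intermediate value theorem: the norm along the step is
  below \<open>b\<close> at factor 0 and at least \<open>b\<close> at factor 1.\<close>

lemma exit_factor:
  assumes s: "ereal (nrm s) < b" and s': "b \<le> ereal (nrm (step s))"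
  shows "0 < exit_factor s" "exit_factor s \<le> 1"
    "ereal (nrm (s - (exit_factor s * \<eta>) *\<^sub>R G s)) = b"
proof -
  obtain B where B: "b = ereal B" using s s' by (cases b) auto
  let ?f = "\<lambda>\<alpha>. nrm (s - (\<alpha> * \<eta>) *\<^sub>R G s)"
  have "\<exists>\<alpha>. 0 \<le> \<alpha> \<and> \<alpha> \<le> 1 \<and> ?f \<alpha> = B"
    by (rule IVT') (use s s' B in \<open>auto simp: step_def intro!: continuous_intros\<close>)
  then obtain \<alpha> where \<alpha>: "0 \<le> \<alpha>" "\<alpha> \<le> 1" "?f \<alpha> = B" by blast
  have "\<alpha> \<noteq> 0" using \<alpha>(3) s B by auto
  then have "\<exists>\<alpha>. 0 < \<alpha> \<and> \<alpha> \<le> 1 \<and> ereal (?f \<alpha>) = b" using \<alpha> B by (auto intro!: exI[of _ \<alpha>])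
  from someI_ex[OF this] show "0 < exit_factor s" "exit_factor s \<le> 1" "ereal (?f (exit_factor s)) = b"
    unfolding exit_factor_def by auto
qed

abbreviation loop :: "nat \<Rightarrow> 'e \<Rightarrow> 'e" where "loop \<equiv> tangent_loop nrm G \<eta> b"

lemma loop_Suc:
  "loop (Suc n) s = (if b \<le> ereal (nrm (step s)) then s - (exit_factor s * \<eta>) *\<^sub>R G s else loop n (step s))"
  by (simp add: step_def exit_factor_def Let_def)

lemma step_props:
  assumes "ereal (nrm s) \<le> b" "ereal (nrm (step s)) \<le> b"
  shows "h (step s) \<le> h s" "(nrm (step s - s))\<^sup>2 \<le> 2 * \<eta> * (h s - h (step s))"
proof -
  show 1: "(nrm (step s - s))\<^sup>2 \<le> 2 * \<eta> * (h s - h (step s))"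
    using partial_step_descent(2)[of s 1] assms by (simp add: step_def)
  have "0 \<le> \<eta> * (h s - h (step s))" using 1 zero_le_power2[of "nrm (step s - s)"] by linarith
  then show "h (step s) \<le> h s" using eta_pos by (simp add: zero_le_mult_iff)
qed

text \<open>By Cauchy-Schwarz the squared path length is at most the number of steps times the sum
  of the squared step lengths, and each of these is at most \<open>2 * \<eta>\<close> times the
  decrease in that step. A truncated last step obeys the same bound.\<close>

lemma loop_props:
  assumes "ereal (nrm s) < b"
  shows "ereal (nrm (loop n s)) \<le> b \<and> h (loop n s) \<le> h s \<and>
    (nrm (loop n s - s))\<^sup>2 \<le> 2 * \<eta> * n * (h s - h (loop n s))"
  using assms
proof (induction n arbitrary: s)
  case (Suc n)
  show ?case
  proof (cases "b \<le> ereal (nrm (step s))")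
    case True
    note ex = exit_factor[OF Suc.prems True]
    let ?s' = "s - (exit_factor s * \<eta>) *\<^sub>R G s"
    have le: "ereal (nrm s) \<le> b" "ereal (nrm ?s') \<le> b" using Suc.prems ex(3) by auto
    note d = partial_step_descent[OF le less_imp_le[OF ex(1)] ex(2)]
    have "0 \<le> exit_factor s * \<eta> / 2 * (nrm (G s))\<^sup>2" using ex(1) eta_pos by simp
    then have hle: "h ?s' \<le> h s" using d(1) by linarith
    have "2 * \<eta> * (h s - h ?s') \<le> 2 * \<eta> * Suc n * (h s - h ?s')"
      using hle eta_pos by (intro mult_right_mono) auto
    then have "(nrm (?s' - s))\<^sup>2 \<le> 2 * \<eta> * Suc n * (h s - h ?s')" using d(2) by linarith
    then show ?thesis using le hle by (simp only: loop_Suc True if_True)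
  next
    let ?z = "loop n (step s)"
    case False
    then have lt: "ereal (nrm (step s)) < b" by simp
    note IH = Suc.IH[OF lt]
    note sp = step_props[OF less_imp_le[OF Suc.prems] less_imp_le[OF lt]]
    define x where "x = nrm (?z - step s)"
    define y where "y = nrm (step s - s)"
    define X where "X = 2 * \<eta> * (h (step s) - h ?z)"
    define Y where "Y = 2 * \<eta> * (h s - h (step s))"
    have x: "0 \<le> x" "x\<^sup>2 \<le> n * X" and X: "0 \<le> X"
      using IH eta_pos by (auto simp: x_def X_def algebra_simps)
    have y: "0 \<le> y" "y\<^sup>2 \<le> Y" using sp by (auto simp: y_def Y_def)
    have "(x + y)\<^sup>2 \<le> (n + 1) * (X + Y)"
    proof (cases "n = 0")
      case False
      \<comment> \<open>Cauchy-Schwarz for one more step: this square bounds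
        \<open>2 * (x * y)\<close> by \<open>X + n * Y\<close> after division by \<open>n\<close>.
        For \<open>n = 0\<close> the bound on \<open>x\<close> already forces
        \<open>x = 0\<close>.\<close>
      have "0 \<le> (x - n * y)\<^sup>2" by simp
      then have "2 * n * (x * y) \<le> x\<^sup>2 + n\<^sup>2 * y\<^sup>2"
        by (simp add: power2_diff power_mult_distrib mult_ac)
      also have "\<dots> \<le> n * X + n\<^sup>2 * Y" using x y by (intro add_mono mult_left_mono) auto
      finally have "n * (2 * (x * y)) \<le> n * (X + n * Y)" by (simp add: algebra_simps power2_eq_square)
      then have "2 * (x * y) \<le> X + n * Y" using False by simp
      then show ?thesis using x y by (simp add: power2_sum algebra_simps)
    qed (use x y X in simp)
    moreover have "nrm (?z - s) \<le> x + y"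
      using nrm_triangle[of "?z - step s" "step s - s"] by (simp add: x_def y_def)
    then have "(nrm (?z - s))\<^sup>2 \<le> (x + y)\<^sup>2" by (intro power_mono) auto
    moreover have "(n + 1) * (X + Y) = 2 * \<eta> * Suc n * (h s - h ?z)"
      by (simp add: X_def Y_def algebra_simps)
    ultimately have "(nrm (?z - s))\<^sup>2 \<le> 2 * \<eta> * Suc n * (h s - h ?z)"
      by linarith
    moreover have "h ?z \<le> h s" "ereal (nrm ?z) \<le> b"
      using IH sp by auto
    ultimately show ?thesis using False by (simp only: loop_Suc if_False)
  qed
qed simp

lemma loop_eq_funpow:
  assumes "\<forall>j\<le>n. ereal (nrm ((step ^^ j) s)) < b"
  shows "loop n s = (step ^^ n) s"
  using assms
proof (induction n arbitrary: s)
  case (Suc n)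
  have "\<forall>j\<le>n. ereal (nrm ((step ^^ j) (step s))) < b"
    using Suc.prems by (metis Suc_le_mono funpow_Suc_right comp_apply)
  moreover have "\<not> b \<le> ereal (nrm (step s))" using Suc.prems[rule_format, of 1] by simp
  ultimately show ?case using Suc.IH by (simp add: loop_Suc funpow_Suc_right del: funpow.simps tangent_loop.simps)
qed simp

text \<open>A truncated step ends the loop exactly on the sphere of radius \<open>b\<close>, so a
  final point strictly inside the ball certifies that all steps were full.\<close>

lemma loop_cases:
  assumes "ereal (nrm s) < b"
  shows "ereal (nrm (loop n s)) = b \<or> (\<forall>j\<le>n. ereal (nrm ((step ^^ j) s)) < b)"
  using assms
proof (induction n arbitrary: s)
  case (Suc n)
  show ?case
  proof (cases "b \<le> ereal (nrm (step s))")
    case True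
    then show ?thesis using exit_factor(3)[OF Suc.prems True] by (simp only: loop_Suc) simp
  next
    case False
    then have "ereal (nrm (loop n (step s))) = b \<or> (\<forall>j\<le>n. ereal (nrm ((step ^^ j) (step s))) < b)"
      by (intro Suc.IH) simp
    moreover have "\<forall>j\<le>Suc n. ereal (nrm ((step ^^ j) s)) < b"
      if "\<forall>j\<le>n. ereal (nrm ((step ^^ j) (step s))) < b"
    proof (intro allI impI)
      fix j assume "j \<le> Suc n"
      then show "ereal (nrm ((step ^^ j) s)) < b"
        using that Suc.prems by (cases j) (simp_all add: funpow_Suc_right del: funpow.simps)
    qed
    ultimately show ?thesis using False by (simp only: loop_Suc if_False) blast
  qed
qed simp

text \<open>A small total decrease first keeps the end point within \<open>R\<close> of the start.
  That excludes an exit, so the loop is a plain iteration, and then every intermediate point can be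
  treated like an end point.\<close>

lemma localize:
  assumes s: "ereal (nrm s) < b" and F: "h s - h (loop n s) < F" "2 * \<eta> * n * F \<le> R\<^sup>2"
    and R: "0 \<le> R" "ereal (nrm s + R) < b"
  shows "\<forall>j\<le>n. nrm ((step ^^ j) s) \<le> nrm s + R"
proof -
  have hF: "2 * \<eta> * n * (h s - h (loop n s)) \<le> R\<^sup>2"
  proof -
    have "2 * \<eta> * n * (h s - h (loop n s)) \<le> 2 * \<eta> * n * F"
      using F(1) eta_pos by (intro mult_left_mono) auto
    then show ?thesis using F(2) by linarith
  qed
  then have "(nrm (loop n s - s))\<^sup>2 \<le> R\<^sup>2" using loop_props[OF s, of n] by linarith
  then have "nrm (loop n s - s) \<le> R" using R(1) by (rule power2_le_imp_le)
  then have "ereal (nrm (loop n s)) \<le> ereal (nrm s + R)"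
    using nrm_triangle[of s "loop n s - s"] by simp
  then have "ereal (nrm (loop n s)) < b" using R(2) by (rule order.strict_trans1)
  then have pure: "\<forall>j\<le>n. ereal (nrm ((step ^^ j) s)) < b"
    using loop_cases[OF s, of n] by auto
  show ?thesis
  proof (intro allI impI)
    fix j assume j: "j \<le> n"
    have lj: "loop j s = (step ^^ j) s" using pure j by (intro loop_eq_funpow) auto
    \<comment> \<open>The rest of the loop does not increase \<open>h\<close>, so the decrease up to
      iterate \<open>j\<close> is at most the total decrease.\<close>
    have "loop (n - j) ((step ^^ j) s) = (step ^^ (n - j)) ((step ^^ j) s)"
    proof (intro loop_eq_funpow allI impI)
      fix i assume "i \<le> n - j"
      then show "ereal (nrm ((step ^^ i) ((step ^^ j) s))) < b"
        using pure[rule_format, of "i + j"] j by (simp add: funpow_add)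
    qed
    also have "\<dots> = loop n s"
      using loop_eq_funpow[OF pure] j funpow_add[of "n - j" j step] by simp
    finally have "h (loop n s) \<le> h ((step ^^ j) s)"
      using loop_props[of "(step ^^ j) s" "n - j"] pure j by simp
    then have 1: "2 * \<eta> * j * (h s - h ((step ^^ j) s)) \<le> 2 * \<eta> * j * (h s - h (loop n s))"
      using eta_pos by (intro mult_left_mono) auto
    have 2: "2 * \<eta> * j * (h s - h (loop n s)) \<le> 2 * \<eta> * n * (h s - h (loop n s))"
      using eta_pos j loop_props[OF s, of n] by (intro mult_right_mono mult_left_mono) auto
    have "(nrm ((step ^^ j) s - s))\<^sup>2 \<le> R\<^sup>2"
      using loop_props[OF s, of j] 1 2 hF unfolding lj by linarith
    then have "nrm ((step ^^ j) s - s) \<le> R" using R(1) by (rule power2_le_imp_le)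
    then show "nrm ((step ^^ j) s) \<le> nrm s + R"
      using nrm_triangle[of s "(step ^^ j) s - s"] by simp
  qed
qed

text \<open>A step truncated at the boundary has length \<open>b\<close>, hence at least
  \<open>\<eta> * \<epsilon>\<close>, and gains half its length times the gradient norm; this
  matches the gain of a full step. \<beta> is a real stand-in for \<open>b\<close>, which may be
  infinite.\<close>

lemma first_step_descent:
  assumes b: "0 < b" and \<beta>: "0 < \<beta>" "ereal \<beta> \<le> b" "\<eta> * \<epsilon> \<le> \<beta>" and \<epsilon>: "0 < \<epsilon>" "\<epsilon> \<le> nrm (G 0)"
  shows "h (loop 1 0) \<le> h 0 - \<eta> * \<epsilon>\<^sup>2 / 2"
proof -
  have b0: "ereal (nrm 0) < b" using b by (simp add: zero_ereal_def)
  have sq: "\<epsilon>\<^sup>2 \<le> (nrm (G 0))\<^sup>2" using \<epsilon> by (intro power_mono) auto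
  show ?thesis
  proof (cases "b \<le> ereal (nrm (step 0))")
    case True
    note ex = exit_factor[OF b0 True]
    let ?a = "exit_factor 0"
    let ?s' = "0 - (?a * \<eta>) *\<^sub>R G 0"
    have "h ?s' \<le> h 0 - ?a * \<eta> / 2 * (nrm (G 0))\<^sup>2"
      by (rule partial_step_descent) (use b0 ex in auto)
    also have "?a * \<eta> / 2 * (nrm (G 0))\<^sup>2 = nrm ?s' * nrm (G 0) / 2"
      using ex(1) eta_pos by (simp add: power2_eq_square)
    finally have 1: "h ?s' \<le> h 0 - nrm ?s' * nrm (G 0) / 2" .
    have "ereal \<beta> \<le> ereal (nrm ?s')" using \<beta>(2) ex(3) by (simp only:)
    then have "\<eta> * \<epsilon> \<le> nrm ?s'" using \<beta>(3) by simp
    then have "(\<eta> * \<epsilon>) * \<epsilon> \<le> nrm ?s' * nrm (G 0)" using \<epsilon> eta_pos by (intro mult_mono) auto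
    then have "h ?s' \<le> h 0 - \<eta> * \<epsilon>\<^sup>2 / 2" using 1 by (simp add: power2_eq_square)
    then show ?thesis using True by (simp only: One_nat_def loop_Suc if_True)
  next
    case False
    have "h (0 - (1 * \<eta>) *\<^sub>R G 0) \<le> h 0 - 1 * \<eta> / 2 * (nrm (G 0))\<^sup>2"
      by (rule partial_step_descent) (use b0 False in \<open>auto simp: step_def\<close>)
    moreover have "\<eta> * \<epsilon>\<^sup>2 \<le> \<eta> * (nrm (G 0))\<^sup>2" using sq eta_pos by simp
    ultimately have "h (step 0) \<le> h 0 - \<eta> * \<epsilon>\<^sup>2 / 2" by (simp add: step_def)
    then show ?thesis using False by (simp only: One_nat_def loop_Suc if_False tangent_loop.simps(1))
  qed
qed

lemma perturbation_increase:
  assumes b: "0 \<le> b" and s: "ereal (nrm s) < b" "nrm s \<le> \<eta> * r" and \<epsilon>: "nrm (G 0) \<le> \<epsilon>" and r: "0 \<le> r"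
  shows "h s \<le> h 0 + \<eta> * \<epsilon> * r + \<eta> * r\<^sup>2 / 2"
proof -
  have "h s \<le> h 0 + ip (G 0) (s - 0) + l / 2 * (nrm (s - 0))\<^sup>2"
    by (rule descent) (use s b in \<open>auto simp: zero_ereal_def\<close>)
  then have "h s \<le> h 0 + ip (G 0) s + l / 2 * (nrm s)\<^sup>2" by simp
  moreover have "ip (G 0) s \<le> \<epsilon> * (\<eta> * r)"
    by (rule order_trans[OF ip_le]) (use s \<epsilon> in \<open>intro mult_mono; auto intro: order_trans[OF nrm_nonneg]\<close>)
  moreover have "(nrm s)\<^sup>2 \<le> (\<eta> * r)\<^sup>2" using s by (intro power_mono) auto
  then have "l / 2 * (nrm s)\<^sup>2 \<le> l / 2 * (\<eta> * r)\<^sup>2" using l_pos by (intro mult_left_mono) auto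
  moreover have "l / 2 * (\<eta> * r)\<^sup>2 = \<eta> * r\<^sup>2 / 2" using l_pos by (simp add: eta power2_eq_square)
  moreover have "\<epsilon> * (\<eta> * r) = \<eta> * \<epsilon> * r" by simp
  ultimately show ?thesis by linarith
qed

end

section \<open>Two coupled descents near a strict saddle\<close>

locale gd_space_hess = gd_space ip h G l \<eta> b
  for ip :: "'e::euclidean_space \<Rightarrow> 'e \<Rightarrow> real" and h G l \<eta> b +
  fixes Hs :: "'e \<Rightarrow> 'e \<Rightarrow> 'e" and \<rho> :: real
  assumes b_pos: "0 < b"
    and hess: "(G has_derivative Hs s) (at s)"
    and hess_sym: "ip (Hs 0 u) v = ip u (Hs 0 v)"
    and hess_lip: "ereal (nrm s) \<le> b \<Longrightarrow> nrm (Hs s v - Hs 0 v) \<le> \<rho> * nrm s * nrm v"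
    and rho_pos: "0 < \<rho>"
begin

lemma hess_linear: "linear (Hs s)"
  using hess has_derivative_linear by blast

text \<open>The mean value theorem is applied to the component along the error vector
  \<open>z\<close> itself. The scalar theorem then bounds \<open>(nrm z)\<^sup>2\<close> by a
  multiple of \<open>nrm z\<close>, which is cancelled.\<close>

lemma gradient_difference:
  assumes u: "nrm u \<le> R" and w: "nrm w \<le> R" and R: "ereal R \<le> b"
  shows "nrm (G u - G w - Hs 0 (u - w)) \<le> \<rho> * R * nrm (u - w)"
proof -
  define d where "d = u - w"
  define z where "z = G u - G w - Hs 0 d"
  define \<phi> where "\<phi> t = ip (G (w + t *\<^sub>R d) - t *\<^sub>R Hs 0 d) z" for t
  have der: "(\<phi> has_real_derivative ip (Hs (w + t *\<^sub>R d) d - Hs 0 d) z) (at t)" for t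
  proof -
    have 1: "((\<lambda>t. G (w + t *\<^sub>R d)) has_derivative (\<lambda>x. Hs (w + t *\<^sub>R d) (x *\<^sub>R d))) (at t)"
      by (rule has_derivative_compose[OF _ hess]) (auto intro!: derivative_eq_intros)
    have "(\<phi> has_derivative (\<lambda>x. ip (Hs (w + t *\<^sub>R d) (x *\<^sub>R d) - x *\<^sub>R Hs 0 d) z)) (at t)"
      unfolding \<phi>_def[abs_def]
      by (rule bounded_linear.has_derivative[OF bounded_bilinear.bounded_linear_left[OF bounded_bilinear]])
        (auto intro!: derivative_eq_intros 1)
    then show ?thesis
      by (simp add: has_field_derivative_def linear_cmul[OF hess_linear] ip_simps mult_commute_abs
          flip: right_diff_distrib)
  qed
  obtain t where t: "0 < t" "t < 1" "\<phi> 1 - \<phi> 0 = (1 - 0) * ip (Hs (w + t *\<^sub>R d) d - Hs 0 d) z"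
    using MVT2[of 0 1 \<phi> "\<lambda>t. ip (Hs (w + t *\<^sub>R d) d - Hs 0 d) z"] der by auto
  have "nrm (w + t *\<^sub>R d) \<le> R" unfolding d_def using t by (intro nrm_convex u w) auto
  have "nrm (Hs (w + t *\<^sub>R d) d - Hs 0 d) \<le> \<rho> * nrm (w + t *\<^sub>R d) * nrm d"
    using \<open>nrm (w + t *\<^sub>R d) \<le> R\<close> by (intro hess_lip order_trans[OF _ R]) simp
  also have "\<dots> \<le> \<rho> * R * nrm d"
    using \<open>nrm (w + t *\<^sub>R d) \<le> R\<close> rho_pos by (intro mult_right_mono mult_left_mono) auto
  finally have le: "nrm (Hs (w + t *\<^sub>R d) d - Hs 0 d) \<le> \<rho> * R * nrm d" .
  have "(nrm z)\<^sup>2 = \<phi> 1 - \<phi> 0"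
    by (simp add: \<phi>_def nrm_sq d_def z_def ip_simps algebra_simps)
  also have "\<dots> \<le> nrm (Hs (w + t *\<^sub>R d) d - Hs 0 d) * nrm z" using t ip_le by simp
  also have "\<dots> \<le> (\<rho> * R * nrm d) * nrm z" by (intro mult_right_mono le) simp
  finally have "nrm z * nrm z \<le> (\<rho> * R * nrm d) * nrm z" by (simp add: power2_eq_square)
  moreover have "0 \<le> \<rho> * R * nrm d" using le nrm_nonneg order_trans by blast
  ultimately have "nrm z \<le> \<rho> * R * nrm d"
    by (cases "nrm z = 0") (auto simp: mult_le_cancel_right dest: nrm_pos)
  then show ?thesis by (simp add: z_def d_def)
qed

text \<open>If the quadratic form exceeded \<open>l\<close> in direction \<open>v\<close>, then
  \<phi> would increase to the right of 0, against the Lipschitz bound on a short segment inside the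
  ball.\<close>

lemma hess_le: "ip (Hs 0 v) v \<le> l * ip v v"
proof (cases "v = 0")
  case False
  define \<phi> where "\<phi> t = ip (G (t *\<^sub>R v)) v - l * t * ip v v" for t
  have "((\<lambda>t. G (t *\<^sub>R v)) has_derivative (\<lambda>x. Hs 0 (x *\<^sub>R v))) (at 0)"
    by (rule has_derivative_compose[where g = G and f = "\<lambda>t. t *\<^sub>R v"])
      (use hess[of 0] in \<open>auto intro!: derivative_eq_intros\<close>)
  then have "((\<lambda>t. ip (G (t *\<^sub>R v)) v) has_derivative (\<lambda>x. ip (Hs 0 (x *\<^sub>R v)) v)) (at 0)"
    by (rule bounded_linear.has_derivative[OF bounded_bilinear.bounded_linear_left[OF bounded_bilinear]])
  then have 1: "((\<lambda>t. ip (G (t *\<^sub>R v)) v) has_real_derivative ip (Hs 0 v) v) (at 0)"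
    by (simp add: has_field_derivative_def linear_cmul[OF hess_linear] ip_simps mult_commute_abs)
  have der: "(\<phi> has_real_derivative (ip (Hs 0 v) v - l * ip v v)) (at 0)"
    unfolding \<phi>_def[abs_def] by (rule derivative_eq_intros 1 refl | simp)+
  show ?thesis
  proof (rule ccontr)
    assume "\<not> ?thesis"
    then have "0 < ip (Hs 0 v) v - l * ip v v" by simp
    from DERIV_pos_inc_right[OF der this] obtain \<delta> where
      \<delta>: "0 < \<delta>" "\<And>t. 0 < t \<Longrightarrow> t < \<delta> \<Longrightarrow> \<phi> 0 < \<phi> t" by auto
    obtain B where B: "0 < B" "ereal B \<le> b"
    proof (cases b)
      case (real r) then show ?thesis using that[of r] b_pos by auto
    next
      case PInf then show ?thesis using that[of 1] by auto
    qed (use b_pos in auto)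
    define t where "t = min (\<delta> / 2) (B / nrm v)"
    have v: "0 < nrm v" using False by (rule nrm_pos)
    have t: "0 < t" "t < \<delta>" "t * nrm v \<le> B"
      using \<delta> B v by (auto simp: t_def min_def field_simps)
    have "nrm (G (t *\<^sub>R v) - G 0) \<le> l * nrm (t *\<^sub>R v - 0)"
      using t B b_pos by (intro lip) (auto simp: zero_ereal_def intro: order_trans[of _ "ereal B"])
    then have "nrm (G (t *\<^sub>R v) - G 0) * nrm v \<le> l * (t * nrm v) * nrm v"
      using t(1) by (intro mult_right_mono) auto
    then have "ip (G (t *\<^sub>R v) - G 0) v \<le> l * t * ip v v"
      using ip_le[of "G (t *\<^sub>R v) - G 0" v] nrm_sq[of v] by (simp add: power2_eq_square algebra_simps)
    then have "\<phi> t \<le> \<phi> 0" by (simp add: \<phi>_def ip_simps)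
    then show False using \<delta>(2)[OF t(1,2)] by simp
  qed
qed (simp add: linear_0[OF hess_linear])

text \<open>The starting points differ by a multiple of the eigenvector \<open>e\<close>, so the
  linear map \<open>M\<close> stretches the difference by exactly \<open>c\<close>, and
  \<open>c\<close> also bounds the norm of \<open>M\<close>. The error relative to this growth hence
  grows by \<open>c\<close> too, apart from a factor \<open>1 + \<kappa>\<close> per step for the
  variation of the Hessian.\<close>

lemma coupled_difference:
  assumes e: "Hs 0 e = - \<gamma> *\<^sub>R e" and \<gamma>: "0 \<le> \<gamma>" "\<And>v. - \<gamma> * ip v v \<le> ip (Hs 0 v) v"
    and uw: "u - w = \<tau> *\<^sub>R e" and R: "ereal R \<le> b"
    and u: "\<forall>j\<le>n. nrm ((step ^^ j) u) \<le> R" and w: "\<forall>j\<le>n. nrm ((step ^^ j) w) \<le> R"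
  shows "nrm ((step ^^ n) u - (step ^^ n) w - (1 + \<eta> * \<gamma>) ^ n *\<^sub>R (u - w))
    \<le> ((1 + \<eta> * \<rho> * R) ^ n - 1) * ((1 + \<eta> * \<gamma>) ^ n * nrm (u - w))"
  using u w
proof (induction n)
  case (Suc n)
  define c where "c = 1 + \<eta> * \<gamma>"
  define \<kappa> where "\<kappa> = \<eta> * \<rho> * R"
  define M where "M v = v - \<eta> *\<^sub>R Hs 0 v" for v
  have c: "1 \<le> c" using \<gamma> eta_pos by (simp add: c_def)
  have "0 \<le> R" using Suc.prems(1)[rule_format, of 0] nrm_nonneg order_trans by blast
  then have \<kappa>: "0 \<le> \<kappa>" using eta_pos rho_pos by (simp add: \<kappa>_def)
  have linM: "linear M" unfolding M_def
    by (intro linear_compose_sub linear_ident linear_compose_scale_right hess_linear)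
  have M: "nrm (M v) \<le> c * nrm v" for v
  proof (rule nrm_symmetric_le[OF linM])
    fix v
    show "ip (M u) v = ip u (M v)" for u by (simp add: M_def ip_simps hess_sym)
    \<comment> \<open>Here the step size matters: with \<eta> the inverse of \<open>l\<close>, the
      map \<open>M\<close> is positive semidefinite, so no direction is flipped and the upper bound
      \<open>c\<close> alone controls its norm.\<close>
    have "\<eta> * ip (Hs 0 v) v \<le> \<eta> * (l * ip v v)" using eta_pos hess_le by (intro mult_left_mono) auto
    then show "0 \<le> ip (M v) v" using l_pos by (simp add: M_def ip_simps eta)
    have "\<eta> * (- \<gamma> * ip v v) \<le> \<eta> * ip (Hs 0 v) v" using eta_pos \<gamma>(2) by (intro mult_left_mono) auto
    then show "ip (M v) v \<le> c * ip v v" by (simp add: M_def ip_simps c_def algebra_simps)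
  qed (use c in simp)
  let ?u = "(step ^^ n) u" and ?w = "(step ^^ n) w"
  define D where "D = ?u - ?w - c ^ n *\<^sub>R (u - w)"
  define z where "z = G ?u - G ?w - Hs 0 (?u - ?w)"
  define K where "K = c ^ n * nrm (u - w)"
  have K: "0 \<le> K" using c by (simp add: K_def)
  have IH: "nrm D \<le> ((1 + \<kappa>) ^ n - 1) * K" using Suc by (simp add: D_def c_def \<kappa>_def K_def)
  have "nrm z \<le> \<rho> * R * nrm (?u - ?w)"
    unfolding z_def using Suc.prems by (intro gradient_difference R) auto
  also have "nrm (?u - ?w) \<le> nrm D + K"
    using nrm_triangle[of D "c ^ n *\<^sub>R (u - w)"] c by (simp add: D_def K_def)
  finally have z: "\<eta> * nrm z \<le> \<kappa> * (nrm D + K)"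
    using eta_pos rho_pos \<open>0 \<le> R\<close> unfolding \<kappa>_def by (simp add: mult_left_mono mult.assoc)
  have "M (c ^ n *\<^sub>R (u - w)) = c ^ Suc n *\<^sub>R (u - w)"
    by (simp add: uw M_def e linear_cmul[OF hess_linear] c_def algebra_simps)
  then have "M D = M (?u - ?w) - c ^ Suc n *\<^sub>R (u - w)"
    unfolding D_def by (simp only: linear_diff[OF linM])
  then have "(step ^^ Suc n) u - (step ^^ Suc n) w - c ^ Suc n *\<^sub>R (u - w) = M D - \<eta> *\<^sub>R z"
    by (simp add: step_def M_def z_def algebra_simps)
  then have "nrm ((step ^^ Suc n) u - (step ^^ Suc n) w - c ^ Suc n *\<^sub>R (u - w)) \<le> nrm (M D) + \<eta> * nrm z"
    using nrm_triangle_diff[of "M D" "\<eta> *\<^sub>R z"] eta_pos by simp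
  \<comment> \<open>Granting the nonlinear error a factor \<open>c \<ge> 1\<close> as well lets
    \<open>c ^ Suc n\<close> be factored out of the bound.\<close>
  also have "\<dots> \<le> c * nrm D + c * (\<kappa> * (nrm D + K))"
  proof (intro add_mono M)
    have "0 \<le> \<kappa> * (nrm D + K)" using \<kappa> K by simp
    then have "1 * (\<kappa> * (nrm D + K)) \<le> c * (\<kappa> * (nrm D + K))" by (rule mult_right_mono[OF c])
    then show "\<eta> * nrm z \<le> c * (\<kappa> * (nrm D + K))" using z by linarith
  qed
  also have "\<dots> = c * ((1 + \<kappa>) * nrm D + \<kappa> * K)" by (simp add: algebra_simps)
  also have "\<dots> \<le> c * ((1 + \<kappa>) * (((1 + \<kappa>) ^ n - 1) * K) + \<kappa> * K)"
    using c \<kappa> IH by (intro mult_left_mono add_right_mono) auto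
  also have "\<dots> = ((1 + \<kappa>) ^ Suc n - 1) * (c ^ Suc n * nrm (u - w))"
    by (simp add: K_def algebra_simps)
  finally show ?case by (simp only: c_def \<kappa>_def)
qed simp

text \<open>The error is at most 3/5 of the linear growth, because 2/5 + (2/5)^2 = 14/25. At least
  2/5 of the growth is thus visible in the true distance, which is at most
  \<open>2 * R\<close>.\<close>

lemma coupled_separation:
  assumes e: "Hs 0 e = - \<gamma> *\<^sub>R e" and \<gamma>: "0 \<le> \<gamma>" "\<And>v. - \<gamma> * ip v v \<le> ip (Hs 0 v) v"
    and uw: "u - w = \<tau> *\<^sub>R e" and R: "ereal R \<le> b" "\<eta> * \<rho> * R * n \<le> 2 / 5"
    and u: "\<forall>j\<le>n. nrm ((step ^^ j) u) \<le> R" and w: "\<forall>j\<le>n. nrm ((step ^^ j) w) \<le> R"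
  shows "(1 + \<eta> * \<gamma>) ^ n * nrm (u - w) \<le> 5 * R"
proof -
  let ?C = "(1 + \<eta> * \<gamma>) ^ n *\<^sub>R (u - w)" and ?X = "(step ^^ n) u - (step ^^ n) w"
  define \<kappa> where "\<kappa> = \<eta> * \<rho> * R"
  define K where "K = (1 + \<eta> * \<gamma>) ^ n * nrm (u - w)"
  have "0 \<le> R" using u[rule_format, of 0] nrm_nonneg order_trans by blast
  then have \<kappa>: "0 \<le> \<kappa>" using eta_pos rho_pos by (simp add: \<kappa>_def)
  have "0 \<le> K" using \<gamma> eta_pos by (simp add: K_def)
  have "(1 + \<kappa>) ^ n \<le> exp \<kappa> ^ n" using \<kappa> by (intro power_mono exp_ge_add_one_self) auto
  also have "\<dots> = exp (\<kappa> * n)" by (simp add: exp_of_nat2_mult)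
  also have "\<dots> \<le> 1 + \<kappa> * n + (\<kappa> * n)\<^sup>2" using \<kappa> R(2) by (intro exp_bound) (auto simp: \<kappa>_def)
  also have "\<dots> \<le> 1 + 2 / 5 + (2 / 5)\<^sup>2"
    using \<kappa> R(2) by (intro add_mono power_mono) (auto simp: \<kappa>_def)
  finally have le: "(1 + \<kappa>) ^ n - 1 \<le> 3 / 5" by (simp add: power2_eq_square)
  have "K = nrm (?C)" using \<gamma> eta_pos by (simp add: K_def)
  also have "\<dots> \<le> nrm (?X - ?C) + nrm ?X"
    using nrm_triangle_rev[of ?C ?X]
      nrm_minus_commute[of ?C ?X] by linarith
  also have "\<dots> \<le> ((1 + \<kappa>) ^ n - 1) * K + (R + R)"
    unfolding K_def \<kappa>_def
  proof (intro add_mono coupled_difference[OF e \<gamma> uw R(1) u w])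
    show "nrm ?X \<le> R + R"
      using nrm_triangle_diff[of "(step ^^ n) u" "(step ^^ n) w"] u[rule_format, of n] w[rule_format, of n]
      by simp
  qed
  also have "\<dots> \<le> 3 / 5 * K + (R + R)" using le \<open>0 \<le> K\<close> by (intro add_mono mult_right_mono) auto
  finally show ?thesis by (simp add: K_def)
qed

end

section \<open>The volume of thin subsets of a ball\<close>

lemma emeasure_lborel_translate:
  fixes S :: "'e::euclidean_space set"
  assumes "S \<in> sets borel"
  shows "emeasure lborel {v. c + v \<in> S} = emeasure lborel S"
proof -
  have "emeasure lborel S = emeasure (distr lborel borel ((+) c)) S"
    by (simp only: lborel_distr_plus)
  also have "\<dots> = emeasure lborel {v. c + v \<in> S}"
    using assms by (subst emeasure_distr) (auto simp: vimage_def)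
  finally show ?thesis by simp
qed

context posdef_form
begin

lemma emeasure_nrm_ball_scale:
  assumes a: "0 < a"
  shows "emeasure lborel {v. nrm v \<le> a * r} = ennreal (a ^ DIM('e)) * emeasure lborel {v. nrm v \<le> r}"
proof -
  have "emeasure lborel {v. nrm v \<le> a * r} =
      emeasure (density (distr lborel borel (\<lambda>x. 0 + a *\<^sub>R x)) (\<lambda>_. ennreal (\<bar>a\<bar> ^ DIM('e)))) {v. nrm v \<le> a * r}"
    using a by (subst lborel_affine[of a 0]) auto
  also have "\<dots> = ennreal (a ^ DIM('e)) * emeasure lborel ((\<lambda>x. a *\<^sub>R x) -` {v. nrm v \<le> a * r})"
    using a by (simp add: emeasure_density_const emeasure_distr)
  also have "(\<lambda>x. a *\<^sub>R x) -` {v. nrm v \<le> a * r} = {v. nrm v \<le> r}" using a by auto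
  finally show ?thesis .
qed

text \<open>The translates of \<open>X\<close> by multiples of \<open>t\<^sub>0 e\<close> are disjoint, and as \<open>X\<close> lies in the half ball
  where \<open>ip u e \<le> 0\<close>, translating it by at most \<open>r / sqrt d\<close> increases the radius at most by the
  factor \<open>sqrt (1 + 1 / d)\<close>, hence the volume at most by the factor \<open>sqrt (exp 1)\<close>.\<close>

lemma emeasure_thin_half:
  assumes X: "X \<in> sets borel" "\<And>u. u \<in> X \<Longrightarrow> nrm u \<le> r" "\<And>u. u \<in> X \<Longrightarrow> ip u e \<le> 0"
    and e: "nrm e = 1" and r: "0 < r" and t0: "0 < t\<^sub>0"
    and thin: "\<And>u w t. u \<in> X \<Longrightarrow> w \<in> X \<Longrightarrow> u - w = t *\<^sub>R e \<Longrightarrow> t < t\<^sub>0"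
  shows "emeasure lborel X \<le> ennreal (2 * sqrt DIM('e) * t\<^sub>0 / r) * emeasure lborel {v. nrm v \<le> r}"
proof -
  let ?d = "real DIM('e)"
  \<comment> \<open>\<open>m\<close> steps of length \<open>t\<^sub>0\<close> make up
    \<open>r / sqrt d\<close>. With the untranslated copy there are \<open>k + 1\<close> translates,
    which is at least \<open>m\<close>.\<close>
  define m where "m = r / (sqrt ?d * t\<^sub>0)"
  define k where "k = nat \<lfloor>m\<rfloor>"
  define a where "a = sqrt (1 + 1 / ?d)"
  define T where "T i = {v. - ((real i * t\<^sub>0) *\<^sub>R e) + v \<in> X}" for i :: nat
  have d: "1 \<le> ?d" by (simp add: Suc_le_eq)
  have m: "0 < m" using r t0 d by (simp add: m_def)
  have k: "real k \<le> m" "m \<le> real k + 1" using m by (auto simp: k_def)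
  have a: "0 < a" using d by (auto simp: a_def intro: add_pos_nonneg)
  have Tsets: "T i \<in> sets borel" for i
    unfolding T_def using X(1) by measurable
  have disj: "disjoint_family_on T {..k}"
  proof -
    have False if "i < j" "v \<in> T i" "v \<in> T j" for i j v
    proof -
      have "(- ((real i * t\<^sub>0) *\<^sub>R e) + v) - (- ((real j * t\<^sub>0) *\<^sub>R e) + v) = ((real j - real i) * t\<^sub>0) *\<^sub>R e"
        by (simp add: algebra_simps)
      then have "(real j - real i) * t\<^sub>0 < t\<^sub>0" using thin that by (auto simp: T_def)
      moreover have "1 * t\<^sub>0 \<le> (real j - real i) * t\<^sub>0" using that(1) t0 by (intro mult_right_mono) auto
      ultimately show False by simp
    qed
    then show ?thesis unfolding disjoint_family_on_def by (metis disjoint_iff linorder_neqE_nat)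
  qed
  have sub: "(\<Union>i\<le>k. T i) \<subseteq> {v. nrm v \<le> a * r}"
  proof (clarify)
    fix i v assume i: "i \<le> k" "v \<in> T i"
    define u where "u = - ((real i * t\<^sub>0) *\<^sub>R e) + v"
    define t where "t = real i * t\<^sub>0"
    have u: "nrm u \<le> r" "ip u e \<le> 0" using i X by (auto simp: u_def T_def)
    have v: "v = u + t *\<^sub>R e" by (simp add: u_def t_def)
    have t: "0 \<le> t" using t0 by (simp add: t_def)
    have "t \<le> m * t\<^sub>0" unfolding t_def using i k t0 by (intro mult_right_mono) auto
    also have "m * t\<^sub>0 = r / sqrt ?d" using t0 by (simp add: m_def)
    finally have "t\<^sup>2 \<le> (r / sqrt ?d)\<^sup>2" using t by (intro power_mono) auto
    then have tsq: "t\<^sup>2 \<le> r\<^sup>2 / ?d" by (simp add: power_divide)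
    have "(nrm v)\<^sup>2 = (nrm u)\<^sup>2 + 2 * (t * ip u e) + t\<^sup>2"
      using e by (simp add: v nrm_add_sq ip_simps power_mult_distrib)
    also have "\<dots> \<le> r\<^sup>2 + 2 * 0 + r\<^sup>2 / ?d"
      using u t tsq by (intro add_mono power_mono mult_left_mono) (auto simp: mult_le_0_iff)
    also have "\<dots> = (a * r)\<^sup>2" using d by (simp add: a_def power_mult_distrib algebra_simps)
    finally show "nrm v \<le> a * r" using a r by (intro power2_le_imp_le[of "nrm v"]) auto
  qed
  have pw: "a ^ DIM('e) \<le> 2"
  proof (rule power2_le_imp_le)
    have "(a ^ DIM('e))\<^sup>2 = (1 + 1 / ?d) ^ DIM('e)"
      using d by (simp add: a_def power2_eq_square flip: power_mult_distrib)
    also have "\<dots> \<le> exp (1 / ?d) ^ DIM('e)" by (intro power_mono exp_ge_add_one_self) auto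
    also have "\<dots> = exp 1" using d by (simp flip: exp_of_nat_mult)
    also have "\<dots> \<le> 2\<^sup>2" using exp_le by simp
    finally show "(a ^ DIM('e))\<^sup>2 \<le> 2\<^sup>2" .
  qed simp
  have "ennreal m * emeasure lborel X \<le> ennreal (real k + 1) * emeasure lborel X"
    using k by (intro mult_right_mono ennreal_leI) auto
  also have "\<dots> = (\<Sum>i\<le>k. emeasure lborel (T i))"
  proof -
    have "emeasure lborel (T i) = emeasure lborel X" for i
      unfolding T_def by (rule emeasure_lborel_translate[OF X(1)])
    then show ?thesis by (simp add: ennreal_of_nat_eq_real_of_nat add.commute)
  qed
  also have "\<dots> = emeasure lborel (\<Union>i\<le>k. T i)"
    using Tsets disj by (intro sum_emeasure) auto
  also have "\<dots> \<le> emeasure lborel {v. nrm v \<le> a * r}"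
    by (intro emeasure_mono sub) simp
  also have "\<dots> = ennreal (a ^ DIM('e)) * emeasure lborel {v. nrm v \<le> r}"
    by (rule emeasure_nrm_ball_scale[OF a])
  also have "\<dots> \<le> ennreal 2 * emeasure lborel {v. nrm v \<le> r}"
    using pw by (intro mult_right_mono ennreal_leI) auto
  finally have le: "ennreal m * emeasure lborel X \<le> ennreal 2 * emeasure lborel {v. nrm v \<le> r}" .
  have "emeasure lborel X = ennreal (1 / m) * (ennreal m * emeasure lborel X)"
  proof -
    have "ennreal (1 / m) * ennreal m = 1" using m by (simp flip: ennreal_mult)
    then show ?thesis by (simp only: mult.assoc[symmetric] mult_1)
  qed
  also have "\<dots> \<le> ennreal (1 / m) * (ennreal 2 * emeasure lborel {v. nrm v \<le> r})"
    by (rule mult_left_mono[OF le]) simp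
  also have "\<dots> = ennreal (2 * sqrt ?d * t\<^sub>0 / r) * emeasure lborel {v. nrm v \<le> r}"
  proof -
    have "1 / m * 2 = 2 * sqrt ?d * t\<^sub>0 / r" by (simp add: m_def)
    then have "ennreal (1 / m) * ennreal 2 = ennreal (2 * sqrt ?d * t\<^sub>0 / r)"
      using m by (simp only: ennreal_mult[symmetric] less_imp_le zero_le_divide_1_iff zero_le_numeral)
    then show ?thesis by (simp only: mult.assoc[symmetric])
  qed
  finally show ?thesis .
qed

text \<open>The ball is cut by the hyperplane orthogonal to \<open>e\<close>, and each half is
  translated across it, along \<open>e\<close> or \<open>- e\<close>, so that the mixed term of the
  squared norm is nonpositive. This is why thinness is two-sided here, and why the factor 2 becomes
  4.\<close>

lemma emeasure_thin:
  assumes X: "X \<in> sets borel" "\<And>u. u \<in> X \<Longrightarrow> nrm u \<le> r"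
    and e: "nrm e = 1" and r: "0 < r" and t0: "0 < t\<^sub>0"
    and thin: "\<And>u w t. u \<in> X \<Longrightarrow> w \<in> X \<Longrightarrow> u - w = t *\<^sub>R e \<Longrightarrow> \<bar>t\<bar> < t\<^sub>0"
  shows "emeasure lborel X \<le> ennreal (4 * sqrt DIM('e) * t\<^sub>0 / r) * emeasure lborel {v. nrm v \<le> r}"
proof -
  let ?c = "2 * sqrt (real DIM('e)) * t\<^sub>0 / r"
  have half: "emeasure lborel (X \<inter> {u. ip u e' \<le> 0}) \<le> ennreal ?c * emeasure lborel {v. nrm v \<le> r}"
    if e': "e' = e \<or> e' = - e" for e'
  proof (rule emeasure_thin_half[where e = e'])
    have "{u. ip u e' \<le> 0} \<in> sets borel"
      by (intro borel_closed closed_Collect_le continuous_intros)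
    then show "X \<inter> {u. ip u e' \<le> 0} \<in> sets borel" using X(1) by simp
    fix u w t assume *: "u \<in> X \<inter> {u. ip u e' \<le> 0}" "w \<in> X \<inter> {u. ip u e' \<le> 0}" "u - w = t *\<^sub>R e'"
    then have "u - w = t *\<^sub>R e \<or> u - w = (- t) *\<^sub>R e" using e' by auto
    then show "t < t\<^sub>0" using thin[of u w t] thin[of u w "- t"] *(1,2) by auto
  qed (use X e e' r t0 in auto)
  have "emeasure lborel X = emeasure lborel ((X \<inter> {u. ip u e \<le> 0}) \<union> (X \<inter> {u. ip u (- e) \<le> 0}))"
    by (rule arg_cong[of _ _ "emeasure lborel"]) (auto simp: ip_simps)
  also have "\<dots> \<le> emeasure lborel (X \<inter> {u. ip u e \<le> 0}) + emeasure lborel (X \<inter> {u. ip u (- e) \<le> 0})"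
  proof (rule emeasure_subadditive)
    have "{u. ip u e' \<le> 0} \<in> sets borel" for e'
      by (intro borel_closed closed_Collect_le continuous_intros)
    then show "X \<inter> {u. ip u e \<le> 0} \<in> sets lborel" "X \<inter> {u. ip u (- e) \<le> 0} \<in> sets lborel"
      using X(1) by (simp_all only: sets_lborel sets.Int)
  qed
  also have "\<dots> \<le> ennreal ?c * emeasure lborel {v. nrm v \<le> r} + ennreal ?c * emeasure lborel {v. nrm v \<le> r}"
    by (intro add_mono half) auto
  also have "\<dots> = ennreal (?c + ?c) * emeasure lborel {v. nrm v \<le> r}"
    using r t0 by (subst ennreal_plus) (auto simp: distrib_right)
  also have "?c + ?c = 4 * sqrt (real DIM('e)) * t\<^sub>0 / r" by simp
  finally show ?thesis .
qed

end

section \<open>Second derivatives\<close>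

text \<open>Exhibits gradients and Hessians as limits of sequences of measurable functions.\<close>

lemma has_derivative_difference_quotient:
  assumes "(F has_derivative D) (at s)"
  shows "(\<lambda>n. real (Suc n) *\<^sub>R (F (s + (1 / real (Suc n)) *\<^sub>R v) - F s)) \<longlonglongrightarrow> D v"
proof (cases "v = 0")
  case True
  then show ?thesis using linear_0[OF has_derivative_linear[OF assms]] by simp
next
  case False
  let ?k = "\<lambda>n. (1 / real (Suc n)) *\<^sub>R v"
  let ?R = "\<lambda>n. F (s + ?k n) - F s - D (?k n)"
  have lim: "(\<lambda>k. norm (F (s + k) - F s - D k) / norm k) \<midarrow>0\<rightarrow> 0"
    using assms unfolding has_derivative_at by blast
  have "(\<lambda>n. ?k n) \<longlonglongrightarrow> 0 *\<^sub>R v"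
    using lim_inverse_n' LIMSEQ_Suc by (intro tendsto_scaleR tendsto_const) blast
  then have "filterlim (\<lambda>n. ?k n) (at 0) sequentially"
    using False by (auto simp: filterlim_at)
  then have "(\<lambda>n. norm (?R n) /
      norm (?k n)) \<longlonglongrightarrow> 0"
    by (rule filterlim_compose[OF lim])
  then have "(\<lambda>n. norm v * (norm (?R n) /
      norm (?k n))) \<longlonglongrightarrow> 0"
    by (rule tendsto_mult_right_zero)
  moreover have "norm v * (norm (?R n) /
      norm (?k n)) =
      norm (real (Suc n) *\<^sub>R (F (s + ?k n) - F s) - D v)" for n
  proof -
    have "real (Suc n) *\<^sub>R (F (s + ?k n) - F s) - D v =
        real (Suc n) *\<^sub>R (?R n)"
      using linear_cmul[OF has_derivative_linear[OF assms], of "1 / real (Suc n)" v]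
      by (simp add: scaleR_diff_right del: of_nat_Suc)
    then show ?thesis using False by (simp del: of_nat_Suc)
  qed
  ultimately have "(\<lambda>n. norm (real (Suc n) *\<^sub>R (F (s + ?k n) - F s) - D v)) \<longlonglongrightarrow> 0"
    by simp
  then show ?thesis by (simp only: tendsto_norm_zero_iff LIM_zero_iff)
qed

text \<open>The second difference \<open>\<Delta> t\<close> is symmetric in \<open>u\<close> and
  \<open>v\<close>. The mean value theorem along \<open>u\<close> evaluates it as
  \<open>t\<^sup>2 * ip (H v) u\<close> up to smaller order, and along \<open>v\<close> it gives the
  same with \<open>u\<close> and \<open>v\<close> exchanged.\<close>

lemma (in posdef_form) hessian_symmetric:
  assumes grad: "\<And>s. (h has_derivative ip (G s)) (at s)" and hess: "(G has_derivative H) (at 0)"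
  shows "ip (H u) v = ip u (H v)"
proof -
  obtain K where K: "0 < K" "\<And>a b. norm (ip a b) \<le> norm a * norm b * K"
    using bounded_bilinear.pos_bounded[OF bounded_bilinear] by blast
  define C where "C = norm u + norm v"
  define \<Delta> where "\<Delta> t = h (t *\<^sub>R u + t *\<^sub>R v) - h (t *\<^sub>R u) - h (t *\<^sub>R v) + h 0" for t
  have lin: "linear H" using hess by (rule has_derivative_linear)
  \<comment> \<open>All data are bound again here, so that the estimate also applies with
    \<open>u\<close> and \<open>v\<close> exchanged.\<close>
  have key: "\<bar>\<Delta> t - t\<^sup>2 * ip (H v) u\<bar> \<le> t\<^sup>2 * (\<epsilon> * (2 * C\<^sup>2 * K))"
    if \<epsilon>: "0 < \<epsilon>" and G: "\<And>y. norm y \<le> t * C \<Longrightarrow> norm (G y - G 0 - H y) \<le> \<epsilon> * norm y"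
      and t: "0 < t" and C: "C = norm u + norm v"
      and D: "\<Delta> = (\<lambda>t. h (t *\<^sub>R u + t *\<^sub>R v) - h (t *\<^sub>R u) - h (t *\<^sub>R v) + h 0)" for \<epsilon> t u v \<Delta> C
  proof -
    define \<phi> where "\<phi> s = h (s *\<^sub>R u + t *\<^sub>R v) - h (s *\<^sub>R u)" for s
    have der: "(\<phi> has_real_derivative ip (G (s *\<^sub>R u + t *\<^sub>R v) - G (s *\<^sub>R u)) u) (at s)" for s
    proof -
      have "((\<lambda>s. h (s *\<^sub>R u + w)) has_derivative (\<lambda>x. ip (G (s *\<^sub>R u + w)) (x *\<^sub>R u))) (at s)" for w
        by (rule has_derivative_compose[OF _ grad]) (auto intro!: derivative_eq_intros)
      from has_derivative_diff[OF this[of "t *\<^sub>R v"] this[of 0]] show ?thesis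
        by (simp add: \<phi>_def[abs_def] has_field_derivative_def ip_simps mult_commute_abs
            flip: right_diff_distrib)
    qed
    obtain s where s: "0 < s" "s < t" "\<phi> t - \<phi> 0 = (t - 0) * ip (G (s *\<^sub>R u + t *\<^sub>R v) - G (s *\<^sub>R u)) u"
      using MVT2[of 0 t \<phi> "\<lambda>s. ip (G (s *\<^sub>R u + t *\<^sub>R v) - G (s *\<^sub>R u)) u"] der t by auto
    define e1 where "e1 = G (s *\<^sub>R u + t *\<^sub>R v) - G 0 - H (s *\<^sub>R u + t *\<^sub>R v)"
    define e2 where "e2 = G (s *\<^sub>R u) - G 0 - H (s *\<^sub>R u)"
    have su: "norm (s *\<^sub>R u) \<le> t * norm u" using s by (simp add: mult_right_mono)
    have n1: "norm (s *\<^sub>R u + t *\<^sub>R v) \<le> t * C"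
      using norm_triangle_ineq[of "s *\<^sub>R u" "t *\<^sub>R v"] su t by (simp add: C algebra_simps)
    have "t * norm u \<le> t * C" using t by (intro mult_left_mono) (auto simp: C)
    then have n2: "norm (s *\<^sub>R u) \<le> t * C" using su by linarith
    have "norm e1 \<le> \<epsilon> * (t * C)" "norm e2 \<le> \<epsilon> * (t * C)"
      using G[OF n1] G[OF n2] n1 n2 \<epsilon> unfolding e1_def e2_def
      by (auto intro: order_trans mult_left_mono less_imp_le)
    then have e: "norm (e1 - e2) \<le> 2 * (\<epsilon> * (t * C))"
      using norm_triangle_ineq4[of e1 e2] by linarith
    have "G (s *\<^sub>R u + t *\<^sub>R v) - G (s *\<^sub>R u) = t *\<^sub>R H v + (e1 - e2)"
      by (simp add: e1_def e2_def linear_add[OF lin] linear_cmul[OF lin] algebra_simps)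
    then have "\<phi> t - \<phi> 0 = t * (t * ip (H v) u + ip (e1 - e2) u)"
      using s(3) by (simp add: ip_simps)
    then have "\<Delta> t - t\<^sup>2 * ip (H v) u = t * ip (e1 - e2) u"
      by (simp add: D \<phi>_def distrib_left power2_eq_square)
    then have "\<bar>\<Delta> t - t\<^sup>2 * ip (H v) u\<bar> = t * \<bar>ip (e1 - e2) u\<bar>" using t by (simp add: abs_mult)
    also have "\<dots> \<le> t * (norm (e1 - e2) * norm u * K)" using K(2)[of "e1 - e2" u] t by (intro mult_left_mono) auto
    also have "\<dots> \<le> t * (2 * (\<epsilon> * (t * C)) * C * K)"
      using e t K(1) \<epsilon> by (intro mult_left_mono mult_right_mono mult_mono) (auto simp: C)
    finally show ?thesis by (simp add: power2_eq_square mult_ac)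
  qed
  have le: "\<bar>ip (H v) u - ip (H u) v\<bar> \<le> \<epsilon> * (4 * C\<^sup>2 * K)" if \<epsilon>: "0 < \<epsilon>" for \<epsilon>
  proof -
    have "\<forall>\<epsilon>>0. \<exists>\<delta>>0. \<forall>y. norm (y - 0) < \<delta> \<longrightarrow> norm (G y - G 0 - H (y - 0)) \<le> \<epsilon> * norm (y - 0)"
      using hess unfolding has_derivative_at_alt by blast
    then obtain \<delta> where \<delta>: "0 < \<delta>" "\<And>y. norm y < \<delta> \<Longrightarrow> norm (G y - G 0 - H y) \<le> \<epsilon> * norm y"
      using \<epsilon> by auto
    have C0: "0 \<le> C" by (simp add: C_def)
    define t where "t = \<delta> / (2 * (C + 1))"
    have t: "0 < t" using \<delta> C0 by (simp add: t_def)
    have tC: "t * C < \<delta>"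
    proof -
      have "t * C \<le> t * (C + 1)" using t by simp
      also have "\<dots> = \<delta> / 2" using C0 by (simp add: t_def field_simps)
      finally show ?thesis using \<delta> by simp
    qed
    have 1: "\<bar>\<Delta> t - t\<^sup>2 * ip (H v) u\<bar> \<le> t\<^sup>2 * (\<epsilon> * (2 * C\<^sup>2 * K))"
      by (rule key) (use \<epsilon> t tC \<delta>(2) in \<open>auto simp: C_def \<Delta>_def[abs_def]\<close>)
    have 2: "\<bar>\<Delta> t - t\<^sup>2 * ip (H u) v\<bar> \<le> t\<^sup>2 * (\<epsilon> * (2 * C\<^sup>2 * K))"
      by (rule key) (use \<epsilon> t tC \<delta>(2) in \<open>auto simp: C_def \<Delta>_def[abs_def] add.commute\<close>)
    have "t\<^sup>2 * \<bar>ip (H v) u - ip (H u) v\<bar> = \<bar>t\<^sup>2 * ip (H v) u - t\<^sup>2 * ip (H u) v\<bar>"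
      by (simp add: abs_mult flip: right_diff_distrib)
    also have "\<dots> \<le> t\<^sup>2 * (\<epsilon> * (2 * C\<^sup>2 * K)) + t\<^sup>2 * (\<epsilon> * (2 * C\<^sup>2 * K))" using 1 2 by linarith
    also have "\<dots> = t\<^sup>2 * (\<epsilon> * (4 * C\<^sup>2 * K))" by (simp add: algebra_simps)
    finally show ?thesis using t by simp
  qed
  have "\<bar>ip (H v) u - ip (H u) v\<bar> \<le> 0 + \<epsilon>" if "0 < \<epsilon>" for \<epsilon>
  proof -
    have p: "0 < 4 * C\<^sup>2 * K + 1" using K(1) by (simp add: add_nonneg_pos)
    have "\<bar>ip (H v) u - ip (H u) v\<bar> \<le> \<epsilon> / (4 * C\<^sup>2 * K + 1) * (4 * C\<^sup>2 * K)"
      using that p by (intro le) simp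
    also have "\<dots> \<le> \<epsilon> / (4 * C\<^sup>2 * K + 1) * (4 * C\<^sup>2 * K + 1)"
      using that p by (intro mult_left_mono) auto
    finally show ?thesis using p by simp
  qed
  then have "\<bar>ip (H v) u - ip (H u) v\<bar> \<le> 0" by (rule field_le_epsilon)
  then show ?thesis using sym[of u "H v"] by simp
qed

text \<open>Weaker than \<open>Ck_on 2\<close>, which also asks for continuous second derivatives.
  Existence is enough to speak of the Hessians of the pullbacks, and it passes through compositions
  more easily.\<close>

definition twice_differentiable_on :: "'a::real_normed_vector set \<Rightarrow> ('a \<Rightarrow> 'b::real_normed_vector) \<Rightarrow> bool" where
  "twice_differentiable_on S h \<longleftrightarrow> (\<forall>z\<in>S. h differentiable (at z) \<and>
     (\<forall>v. (\<lambda>z. frechet_derivative h (at z) v) differentiable (at z)))"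

lemma Ck_on_2_imp_twice_differentiable: "Ck_on 2 S h \<Longrightarrow> twice_differentiable_on S h"
  by (auto simp: numeral_2_eq_2 twice_differentiable_on_def)

section \<open>Second-order differentiability of compositions, partial maps and gradients\<close>

lemma twice_differentiable_on_cong:
  assumes "open S" and eq: "\<And>z. z \<in> S \<Longrightarrow> h z = k z" and h: "twice_differentiable_on S h"
  shows "twice_differentiable_on S k"
proof -
  have 1: "k differentiable (at z) \<and> frechet_derivative k (at z) = frechet_derivative h (at z)" if z: "z \<in> S" for z
  proof -
    have "(h has_derivative frechet_derivative h (at z)) (at z)"
      using h z unfolding twice_differentiable_on_def by (intro frechet_derivative_works[THEN iffD1]) auto
    then have "(k has_derivative frechet_derivative h (at z)) (at z)"
      using assms(1) z eq by (rule has_derivative_transform_within_open)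
    then show ?thesis using frechet_derivative_at differentiableI by metis
  qed
  show ?thesis unfolding twice_differentiable_on_def
  proof (intro ballI conjI allI)
    fix z v assume z: "z \<in> S"
    show "k differentiable (at z)" using 1 z by blast
    have "((\<lambda>z. frechet_derivative h (at z) v) has_derivative
        frechet_derivative (\<lambda>z. frechet_derivative h (at z) v) (at z)) (at z)"
      using h z unfolding twice_differentiable_on_def by (intro frechet_derivative_works[THEN iffD1]) auto
    then have "((\<lambda>z. frechet_derivative k (at z) v) has_derivative
        frechet_derivative (\<lambda>z. frechet_derivative h (at z) v) (at z)) (at z)"
      using assms(1) z by (rule has_derivative_transform_within_open) (simp add: 1)
    then show "(\<lambda>z. frechet_derivative k (at z) v) differentiable (at z)" by (rule differentiableI)
  qed
qed

text \<open>Derivatives are known to be differentiable in fixed directions only, but the chain rule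
  evaluates \<open>?E z\<close> in the moving direction \<open>?D z v\<close>. Expanding that
  direction in \<open>Basis\<close> leaves a sum of products of differentiable functions.\<close>

lemma twice_differentiable_on_compose:
  fixes \<Psi> :: "'a::real_normed_vector \<Rightarrow> 'e::euclidean_space" and F :: "'e \<Rightarrow> real"
  assumes W: "open W" and \<Psi>: "twice_differentiable_on W \<Psi>" and F: "twice_differentiable_on V F"
    and sub: "\<Psi> ` W \<subseteq> V"
  shows "twice_differentiable_on W (\<lambda>z. F (\<Psi> z))"
proof -
  let ?D = "\<lambda>z. frechet_derivative \<Psi> (at z)" and ?E = "\<lambda>z. frechet_derivative F (at (\<Psi> z))"
  have D\<Psi>: "(\<Psi> has_derivative ?D z) (at z)" if "z \<in> W" for z
    using \<Psi> that unfolding twice_differentiable_on_def by (intro frechet_derivative_works[THEN iffD1]) auto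
  have DF: "(F has_derivative ?E z) (at (\<Psi> z))" if "z \<in> W" for z
    using F that sub unfolding twice_differentiable_on_def by (intro frechet_derivative_works[THEN iffD1]) auto
  have D: "((\<lambda>z. F (\<Psi> z)) has_derivative (\<lambda>v. ?E z (?D z v))) (at z)"
    if "z \<in> W" for z
    by (rule has_derivative_compose[OF D\<Psi> DF]) (use that in auto)
  have eq: "frechet_derivative (\<lambda>z. F (\<Psi> z)) (at z) v =
      (\<Sum>i\<in>Basis. (?D z v \<bullet> i) * ?E z i)" if "z \<in> W" for z v
  proof -
    have lin: "linear (?E z)" using DF[OF that] by (rule has_derivative_linear)
    have "frechet_derivative (\<lambda>z. F (\<Psi> z)) (at z) v = ?E z (?D z v)"
      using frechet_derivative_at[OF D[OF that]] by metis
    also have "\<dots> = ?E z (\<Sum>i\<in>Basis. (?D z v \<bullet> i) *\<^sub>R i)"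
      by (simp only: euclidean_representation)
    also have "\<dots> = (\<Sum>i\<in>Basis. (?D z v \<bullet> i) * ?E z i)"
      by (simp add: linear_sum[OF lin] linear_cmul[OF lin])
    finally show ?thesis .
  qed
  show ?thesis unfolding twice_differentiable_on_def
  proof (intro ballI conjI allI)
    fix z v assume z: "z \<in> W"
    show "(\<lambda>z. F (\<Psi> z)) differentiable (at z)" using D[OF z] by (rule differentiableI)
    have 1: "(\<lambda>z. ?D z v) differentiable (at z)"
      using \<Psi> z unfolding twice_differentiable_on_def by blast
    have 2: "(\<lambda>z. ?E z i) differentiable (at z)" for i
    proof -
      have "((\<lambda>y. frechet_derivative F (at y) i) has_derivative
          frechet_derivative (\<lambda>y. frechet_derivative F (at y) i) (at (\<Psi> z))) (at (\<Psi> z))"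
        using F z sub unfolding twice_differentiable_on_def by (intro frechet_derivative_works[THEN iffD1]) auto
      from has_derivative_compose[OF D\<Psi>[OF z] this] show ?thesis by (rule differentiableI)
    qed
    let ?S = "\<lambda>z. \<Sum>i\<in>Basis. (?D z v \<bullet> i) * ?E z i"
    have 3: "(\<lambda>z. ?D z v \<bullet> i) differentiable (at z)" for i
      using 1 bounded_linear.has_derivative[OF bounded_linear_inner_left] unfolding differentiable_def by blast
    have "?S differentiable (at z)"
      by (intro differentiable_sum finite_Basis ballI differentiable_mult 2 3)
    then obtain D' where "(?S has_derivative D') (at z)"
      by (auto simp: differentiable_def)
    then have "((\<lambda>z. frechet_derivative (\<lambda>z. F (\<Psi> z)) (at z) v) has_derivative D') (at z)"
      using W z by (rule has_derivative_transform_within_open) (simp add: eq)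
    then show "(\<lambda>z. frechet_derivative (\<lambda>z. F (\<Psi> z)) (at z) v) differentiable (at z)" by (rule differentiableI)
  qed
qed

lemma twice_differentiable_on_section:
  fixes h :: "'a::real_normed_vector \<times> 'c::real_normed_vector \<Rightarrow> 'b::real_normed_vector"
  assumes W: "open W" and h: "twice_differentiable_on W h"
  shows "twice_differentiable_on {u. (y, u) \<in> W} (\<lambda>u. h (y, u))"
proof -
  have pair: "((\<lambda>u. (y, u)) has_derivative (\<lambda>v. (0, v))) (at u)" for u
    by (auto intro!: derivative_eq_intros)
  have D: "((\<lambda>u. h (y, u)) has_derivative (\<lambda>v. frechet_derivative h (at (y, u)) (0, v))) (at u)"
    if "(y, u) \<in> W" for u
  proof -
    have "(h has_derivative frechet_derivative h (at (y, u))) (at (y, u))"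
      using h that unfolding twice_differentiable_on_def by (intro frechet_derivative_works[THEN iffD1]) auto
    from has_derivative_compose[OF pair this] show ?thesis .
  qed
  have op: "open {u. (y, u) \<in> W}"
  proof -
    have "open ((\<lambda>u. (y, u)) -` W)" using W by (intro open_vimage continuous_intros)
    then show ?thesis by (simp add: vimage_def)
  qed
  show ?thesis unfolding twice_differentiable_on_def
  proof (intro ballI conjI allI)
    fix u v assume u: "u \<in> {u. (y, u) \<in> W}"
    show "(\<lambda>u. h (y, u)) differentiable (at u)" using D u by (auto intro: differentiableI)
    have "((\<lambda>z. frechet_derivative h (at z) (0, v)) has_derivative
        frechet_derivative (\<lambda>z. frechet_derivative h (at z) (0, v)) (at (y, u))) (at (y, u))"
      using h u unfolding twice_differentiable_on_def by (intro frechet_derivative_works[THEN iffD1]) auto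
    from has_derivative_compose[OF pair this]
    have "((\<lambda>u. frechet_derivative (\<lambda>u. h (y, u)) (at u) v) has_derivative
        (\<lambda>w. frechet_derivative (\<lambda>z. frechet_derivative h (at z) (0, v)) (at (y, u)) (0, w))) (at u)"
      using op u by (rule has_derivative_transform_within_open)
        (use frechet_derivative_at[OF D] in \<open>auto dest!: fun_cong\<close>)
    then show "(\<lambda>u. frechet_derivative (\<lambda>u. h (y, u)) (at u) v) differentiable (at u)"
      by (rule differentiableI)
  qed
qed

lemma (in posdef_form) gradient_wrt_differentiable:
  assumes h: "twice_differentiable_on UNIV h"
  shows "(h has_derivative ip (gradient_wrt ip h s)) (at s)"
    and "gradient_wrt ip h differentiable (at s)"
proof -
  show D: "(h has_derivative ip (gradient_wrt ip h s)) (at s)" for s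
    using h by (intro gradient_wrt_derivative) (auto simp: twice_differentiable_on_def)
  \<comment> \<open>The vectors \<open>R i\<close> represent the coordinate functionals. The
    gradient becomes a combination of these constant vectors with the partial derivatives as
    coefficients, so its differentiability reduces to theirs.\<close>
  define R where "R i = (SOME w. \<forall>v. ip w v = v \<bullet> i)" for i
  have R: "ip (R i) v = v \<bullet> i" for i v
  proof -
    have "linear (\<lambda>v. v \<bullet> i)" by (simp add: linear_iff inner_add_left)
    then obtain w where "\<And>v. ip w v = v \<bullet> i" using riesz by blast
    then have "\<exists>w. \<forall>v. ip w v = v \<bullet> i" by blast
    from someI_ex[OF this] show ?thesis by (simp add: R_def)
  qed
  have "gradient_wrt ip h = (\<lambda>s. \<Sum>i\<in>Basis. frechet_derivative h (at s) i *\<^sub>R R i)"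
  proof
    fix s
    show "gradient_wrt ip h s = (\<Sum>i\<in>Basis. frechet_derivative h (at s) i *\<^sub>R R i)"
    proof (rule ip_eqI)
      fix v
      have fd: "frechet_derivative h (at s) = ip (gradient_wrt ip h s)"
        using frechet_derivative_at[OF D] by simp
      have "ip (\<Sum>i\<in>Basis. frechet_derivative h (at s) i *\<^sub>R R i) v =
          (\<Sum>i\<in>Basis. (v \<bullet> i) * ip (gradient_wrt ip h s) i)"
        by (simp add: bounded_bilinear.sum_left[OF bounded_bilinear] ip_simps R fd mult.commute)
      also have "\<dots> = ip (gradient_wrt ip h s) (\<Sum>i\<in>Basis. (v \<bullet> i) *\<^sub>R i)"
        by (simp add: bounded_bilinear.sum_right[OF bounded_bilinear] ip_simps)
      finally show "ip (gradient_wrt ip h s) v = ip (\<Sum>i\<in>Basis. frechet_derivative h (at s) i *\<^sub>R R i) v"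
        by (simp add: euclidean_representation)
    qed
  qed
  moreover have "(\<lambda>s. \<Sum>i\<in>Basis. frechet_derivative h (at s) i *\<^sub>R R i) differentiable (at s)"
    using h by (intro differentiable_sum finite_Basis ballI differentiable_scaleR differentiable_const)
      (auto simp: twice_differentiable_on_def)
  ultimately show "gradient_wrt ip h differentiable (at s)" by simp
qed

section \<open>Charts and the pullbacks of the cost function\<close>

locale C2_on_manifold =
  fixes A :: "('m::{t2_space, second_countable_topology}, 'e::euclidean_space) chart set"
    and g :: "'m \<Rightarrow> 'e \<Rightarrow> 'e \<Rightarrow> real" and Retr :: "'m \<Rightarrow> 'e \<Rightarrow> 'm" and f :: "'m \<Rightarrow> real"
  assumes atlas: "smooth_atlas A" and metric: "riemannian_metric A g"
    and retraction: "manifold_retraction A Retr" and f_C2: "C2_fun A f"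
begin

lemma form: "posdef_form (g x)"
  using metric unfolding riemannian_metric_def by (intro posdef_form.intro) blast+

text \<open>The choice in \<open>chart_enum\<close> is possible: Lindelof's theorem gives a
  countable subcover, which \<open>from_nat_into\<close> enumerates, possibly with
  repetitions.\<close>

lemma chart_enum: "range (chart_enum A) \<subseteq> A" "(\<Union>i. fst (chart_enum A i)) = UNIV"
proof -
  have op: "openin (top_of_set UNIV) S" if "S \<in> fst ` A" for S
    using that atlas by (auto simp: smooth_atlas_def is_chart_def)
  obtain \<F> where \<F>: "\<F> \<subseteq> fst ` A" "countable \<F>" "\<Union>\<F> = \<Union>(fst ` A)"
    using Lindelof_openin[OF op] by blast
  then have cover: "\<Union>\<F> = UNIV" using atlas by (simp add: smooth_atlas_def)
  obtain c where c: "\<And>S. S \<in> \<F> \<Longrightarrow> c S \<in> A \<and> fst (c S) = S"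
  proof -
    have "\<forall>S\<in>\<F>. \<exists>c. c \<in> A \<and> fst c = S" using \<F>(1) by blast
    from bchoice[OF this] show thesis using that by blast
  qed
  have "\<F> \<noteq> {}" using cover by auto
  then have r: "range (from_nat_into \<F>) = \<F>" using \<F>(2) by (rule range_from_nat_into)
  let ?e = "\<lambda>i. c (from_nat_into \<F> i)"
  have fst_e: "fst (?e i) = from_nat_into \<F> i" "?e i \<in> A" for i
    using c r by auto
  have "\<exists>e :: nat \<Rightarrow> ('m, 'e) chart. range e \<subseteq> A \<and> (\<Union>i. fst (e i)) = UNIV"
    by (rule exI[of _ ?e]) (use fst_e r cover in auto)
  from someI_ex[OF this] have "range (chart_enum A) \<subseteq> A \<and> (\<Union>i. fst (chart_enum A i)) = UNIV"
    unfolding chart_enum_def .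
  then show "range (chart_enum A) \<subseteq> A" "(\<Union>i. fst (chart_enum A i)) = UNIV" by blast+
qed

text \<open>The points that prefer the \<open>i\<close>-th chart: a Borel partition on whose members
  maps expressed through \<open>chart_at\<close> become continuous.\<close>

definition piece :: "nat \<Rightarrow> 'm set" where
  "piece i = fst (chart_enum A i) - (\<Union>j<i. fst (chart_enum A j))"

lemma enum_in: "chart_enum A i \<in> A"
  using chart_enum(1) by auto

lemma chart_at_piece:
  assumes "p \<in> piece i" shows "chart_at A p = chart_enum A i"
proof -
  have "(LEAST i. p \<in> fst (chart_enum A i)) = i"
    by (rule Least_equality) (use assms in \<open>force simp: piece_def not_less[symmetric]\<close>)+
  then show ?thesis by (simp add: chart_at_def)
qed

lemma chart_at: "chart_at A p \<in> A" "p \<in> fst (chart_at A p)" "\<exists>i. p \<in> piece i"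
proof -
  have ex: "\<exists>i. p \<in> fst (chart_enum A i)" using chart_enum(2) by auto
  show "chart_at A p \<in> A" by (simp add: chart_at_def enum_in)
  show "p \<in> fst (chart_at A p)" unfolding chart_at_def by (rule LeastI_ex[OF ex])
  have "p \<in> piece (LEAST i. p \<in> fst (chart_enum A i))"
    using LeastI_ex[OF ex] not_less_Least by (auto simp: piece_def)
  then show "\<exists>i. p \<in> piece i" ..
qed

lemma chart_open: "c \<in> A \<Longrightarrow> open (fst c)" "c \<in> A \<Longrightarrow> open (chart_im c)"
  and chart_inv_chart: "c \<in> A \<Longrightarrow> p \<in> fst c \<Longrightarrow> chart_inv c (snd c p) = p"
  and chart_chart_inv: "c \<in> A \<Longrightarrow> y \<in> chart_im c \<Longrightarrow> snd c (chart_inv c y) = y"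
  and chart_in_im: "c \<in> A \<Longrightarrow> p \<in> fst c \<Longrightarrow> snd c p \<in> chart_im c"
  and chart_cont: "c \<in> A \<Longrightarrow> continuous_on (fst c) (snd c)"
  using atlas by (auto simp: smooth_atlas_def is_chart_def homeomorphism_def chart_im_def)

lemma piece_sets [measurable]: "piece i \<in> sets borel"
  unfolding piece_def using chart_open(1)[OF enum_in] by (intro sets.Diff sets.finite_UN) auto

lemma piece_subset: "piece i \<subseteq> fst (chart_enum A i)"
  by (auto simp: piece_def)

lemma transition_deriv_id:
  assumes c: "c \<in> A" and p: "p \<in> fst c"
  shows "transition_deriv c c p = (\<lambda>v. v)"
proof -
  have "((\<lambda>v. v) has_derivative (\<lambda>v. v)) (at (snd c p))" by (rule has_derivative_ident)
  then have "((snd c \<circ> chart_inv c) has_derivative (\<lambda>v. v)) (at (snd c p))"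
    by (rule has_derivative_transform_within_open[OF _ chart_open(2)[OF c] chart_in_im[OF c p]])
      (simp add: chart_chart_inv[OF c])
  then show ?thesis unfolding transition_deriv_def using frechet_derivative_at by metis
qed

text \<open>The preferred chart of \<open>p\<close> induces the identity on the tangent space at
  \<open>p\<close>. The smoothness assumptions, stated in bundle charts, thereby speak of
  \<open>Retr p u\<close> and \<open>g p u v\<close> themselves.\<close>

lemma bundle_chart_inv_at:
  assumes "chart_at A p = c" shows "bundle_chart_inv A c (snd c p, u) = (p, u)"
  using chart_at(1,2)[of p] assms
  by (simp add: bundle_chart_inv_def chart_inv_chart transition_deriv_id)

lemma f_continuous: "continuous_on UNIV f"
proof -
  have "continuous_on (fst c) f" if c: "c \<in> A" for c
  proof -
    have "Ck_on 2 (chart_im c) (f \<circ> chart_inv c)" using f_C2 c by (simp add: C2_fun_def)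
    then have "\<forall>y\<in>chart_im c. (f \<circ> chart_inv c) differentiable (at y)"
      unfolding numeral_2_eq_2 Ck_on.simps by blast
    then have "continuous_on (chart_im c) (f \<circ> chart_inv c)"
      by (intro differentiable_imp_continuous_on) (auto simp only: differentiable_on_def intro: differentiable_at_withinI)
    then have "continuous_on (fst c) (\<lambda>p. (f \<circ> chart_inv c) (snd c p))"
      by (rule continuous_on_compose2[OF _ chart_cont[OF c]]) (auto simp: chart_in_im[OF c])
    then show ?thesis by (rule continuous_on_eq) (simp add: chart_inv_chart[OF c])
  qed
  then have "continuous_on (\<Union>c\<in>A. fst c) f"
    by (intro continuous_on_open_UN) (auto simp: chart_open)
  then show ?thesis using atlas by (simp add: smooth_atlas_def)
qed

lemma measurable_f [measurable]: "f \<in> borel_measurable borel"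
  using f_continuous by (rule borel_measurable_continuous_onI)

text \<open>Coordinates of tangent vectors jump where the preferred chart changes, so a smooth map
  on the tangent bundle need not be continuous on \<open>'m \<times> 'e\<close>; but it is on each
  of countably many Borel pieces.\<close>

lemma measurable_on_pieces:
  fixes F :: "'m \<times> 'e \<Rightarrow> 'b::topological_space"
  assumes "\<And>i. continuous_on (fst (chart_enum A i) \<times> UNIV) (K i)"
    and "\<And>i p u. p \<in> piece i \<Longrightarrow> F (p, u) = K i (p, u)"
  shows "F \<in> borel_measurable borel"
proof (rule measurable_piecewise_restrict[of "range (\<lambda>i. piece i \<times> UNIV)"])
  show "\<Omega> \<inter> space borel \<in> sets borel" if "\<Omega> \<in> range (\<lambda>i. piece i \<times> (UNIV :: 'e set))" for \<Omega>
    using that by (auto intro!: borel_Times)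
  show "space borel \<subseteq> (\<Union> (range (\<lambda>i. piece i \<times> (UNIV :: 'e set))))" using chart_at(3) by auto
  show "F \<in> borel_measurable (restrict_space borel \<Omega>)" if *: "\<Omega> \<in> range (\<lambda>i. piece i \<times> (UNIV :: 'e set))" for \<Omega>
  proof -
    obtain i where \<Omega>: "\<Omega> = piece i \<times> UNIV" using * by blast
    have "continuous_on \<Omega> (K i)"
      by (rule continuous_on_subset[OF assms(1)]) (use piece_subset in \<open>auto simp: \<Omega>\<close>)
    then have "K i \<in> borel_measurable (restrict_space borel \<Omega>)"
      by (rule borel_measurable_continuous_on_restrict)
    moreover have "F z = K i z" if "z \<in> space (restrict_space borel \<Omega>)" for z
      using that assms(2) by (auto simp: \<Omega> space_restrict_space)
    ultimately show ?thesis by (simp cong: measurable_cong)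
  qed
qed auto

lemma measurable_Retr: "(\<lambda>z. Retr (fst z) (snd z)) \<in> borel_measurable borel"
proof (rule measurable_on_pieces)
  fix i
  let ?c = "chart_enum A i"
  have "continuous_on (chart_im ?c \<times> UNIV) (case_prod Retr \<circ> bundle_chart_inv A ?c)"
    using retraction enum_in by (auto simp: manifold_retraction_def)
  moreover have "continuous_on (fst ?c \<times> UNIV) (\<lambda>z. (snd ?c (fst z), snd z))"
    by (intro continuous_on_Pair continuous_on_compose2[OF chart_cont[OF enum_in]] continuous_intros) auto
  ultimately show "continuous_on (fst ?c \<times> UNIV) (\<lambda>z. (case_prod Retr \<circ> bundle_chart_inv A ?c) (snd ?c (fst z), snd z))"
    by (rule continuous_on_compose2) (auto simp: chart_in_im[OF enum_in])
  fix p u assume "p \<in> piece i"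
  then show "Retr (fst (p, u)) (snd (p, u)) = (case_prod Retr \<circ> bundle_chart_inv A ?c) (snd ?c (fst (p, u)), snd (p, u))"
    by (simp add: bundle_chart_inv_at[OF chart_at_piece])
qed

lemma measurable_metric: "(\<lambda>x. g x u v) \<in> borel_measurable borel"
proof -
  let ?k = "\<lambda>i p. g p (snd (bundle_chart_inv A (chart_enum A i) (snd (chart_enum A i) p, u)))
    (snd (bundle_chart_inv A (chart_enum A i) (snd (chart_enum A i) p, v)))"
  have "(\<lambda>z::'m \<times> 'e. g (fst z) u v) \<in> borel_measurable borel"
  proof (rule measurable_on_pieces[where K = "\<lambda>i z. ?k i (fst z)"])
    fix i
    let ?c = "chart_enum A i"
    let ?h = "\<lambda>y. g (chart_inv ?c y) (snd (bundle_chart_inv A ?c (y, u))) (snd (bundle_chart_inv A ?c (y, v)))"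
    have "smooth_on (chart_im ?c) ?h"
      using metric enum_in by (auto simp: riemannian_metric_def)
    then have "Ck_on 0 (chart_im ?c) ?h" unfolding smooth_on_def by blast
    then have "continuous_on (chart_im ?c) ?h" by simp
    then have "continuous_on (fst ?c) (\<lambda>p. ?h (snd ?c p))"
      by (rule continuous_on_compose2[OF _ chart_cont[OF enum_in]]) (auto simp: chart_in_im[OF enum_in])
    then have "continuous_on (fst ?c) (?k i)"
      by (rule continuous_on_eq) (simp add: chart_inv_chart[OF enum_in])
    then show "continuous_on (fst ?c \<times> (UNIV :: 'e set)) (\<lambda>z. ?k i (fst z))"
      by (rule continuous_on_compose2) (auto intro!: continuous_intros)
    fix p and w :: 'e assume "p \<in> piece i"
    then show "g (fst (p, w)) u v = ?k i (fst (p, w))"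
      by (simp add: bundle_chart_inv_at[OF chart_at_piece])
  qed
  \<comment> \<open>\<open>measurable_on_pieces\<close> is about the tangent bundle, so the metric
    was given a dummy vector argument, now set to \<open>0\<close>.\<close>
  then have "(\<lambda>x. (\<lambda>z::'m \<times> 'e. g (fst z) u v) (x, 0)) \<in> borel_measurable borel"
    by (rule measurable_compose[rotated]) (auto intro!: borel_measurable_continuous_onI continuous_intros)
  then show ?thesis by simp
qed

abbreviation pb :: "'m \<Rightarrow> 'e \<Rightarrow> real" where "pb \<equiv> pullback f Retr"
abbreviation pg :: "'m \<Rightarrow> 'e \<Rightarrow> 'e" where "pg \<equiv> pb_grad g Retr f"
abbreviation ph :: "'m \<Rightarrow> 'e \<Rightarrow> 'e \<Rightarrow> 'e" where "ph \<equiv> pb_hess g Retr f"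

lemma Retr_zero: "Retr x 0 = x"
  using retraction by (simp add: manifold_retraction_def)

lemma Retr_continuous: "continuous_on UNIV (Retr x)"
proof -
  let ?c = "chart_at A x"
  have "continuous_on (chart_im ?c \<times> UNIV) (case_prod Retr \<circ> bundle_chart_inv A ?c)"
    using retraction chart_at by (auto simp: manifold_retraction_def)
  then have "continuous_on UNIV (\<lambda>u. (case_prod Retr \<circ> bundle_chart_inv A ?c) (snd ?c x, u))"
    by (rule continuous_on_compose2) (auto intro!: continuous_intros simp: chart_in_im chart_at)
  then show ?thesis by (simp add: bundle_chart_inv_at)
qed

text \<open>Near \<open>u\<close> the pullback is \<open>f\<close> in a chart around
  \<open>Retr x u\<close>, composed with the retraction in bundle coordinates and restricted to the
  fibre over \<open>x\<close>. The chart depends on \<open>u\<close>, hence the pointwise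
  argument.\<close>

lemma pullback_twice_differentiable: "twice_differentiable_on UNIV (pb x)"
  unfolding twice_differentiable_on_def
proof (rule ballI)
  fix u :: 'e
  define c where "c = chart_at A x"
  define c' where "c' = chart_at A (Retr x u)"
  have c: "c \<in> A" "x \<in> fst c" and c': "c' \<in> A" "Retr x u \<in> fst c'"
    using chart_at by (auto simp: c_def c'_def)
  define \<Psi> where "\<Psi> = snd c' \<circ> case_prod Retr \<circ> bundle_chart_inv A c"
  define W where "W = {z \<in> chart_im c \<times> UNIV. case_prod Retr (bundle_chart_inv A c z) \<in> fst c'}"
  have W: "open W"
  proof -
    have "continuous_on (chart_im c \<times> UNIV) (case_prod Retr \<circ> bundle_chart_inv A c)"
      using retraction c by (auto simp: manifold_retraction_def)
    moreover have "open (chart_im c \<times> (UNIV :: 'e set))" using chart_open(2)[OF c(1)] by (intro open_Times) auto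
    ultimately have "open ((chart_im c \<times> UNIV) \<inter> (case_prod Retr \<circ> bundle_chart_inv A c) -` fst c')"
      using chart_open(1)[OF c'(1)] by (rule continuous_open_preimage)
    then show ?thesis by (rule back_subst[of "open"]) (auto simp: W_def)
  qed
  have "smooth_on W \<Psi>" using retraction c(1) c'(1) by (auto simp: manifold_retraction_def W_def \<Psi>_def)
  then have "Ck_on 2 W \<Psi>" unfolding smooth_on_def by blast
  then have \<Psi>: "twice_differentiable_on W \<Psi>" by (rule Ck_on_2_imp_twice_differentiable)
  have F: "twice_differentiable_on (chart_im c') (f \<circ> chart_inv c')"
    using f_C2 c'(1) by (intro Ck_on_2_imp_twice_differentiable) (simp add: C2_fun_def)
  have "twice_differentiable_on W (\<lambda>z. (f \<circ> chart_inv c') (\<Psi> z))"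
    by (rule twice_differentiable_on_compose[OF W \<Psi> F]) (auto simp: \<Psi>_def W_def chart_in_im[OF c'(1)])
  from twice_differentiable_on_section[OF W this, of "snd c x"]
  have 1: "twice_differentiable_on {u. (snd c x, u) \<in> W} (\<lambda>u. (f \<circ> chart_inv c') (\<Psi> (snd c x, u)))" .
  have b: "bundle_chart_inv A c (snd c x, u) = (x, u)" for u by (rule bundle_chart_inv_at) (simp add: c_def)
  define U where "U = {u. Retr x u \<in> fst c'}"
  have U: "{u. (snd c x, u) \<in> W} = U" using chart_in_im[OF c] by (auto simp: W_def U_def b)
  have "open U"
    using open_vimage[OF chart_open(1)[OF c'(1)] Retr_continuous[of x]] by (simp add: U_def vimage_def)
  then have "twice_differentiable_on U (pb x)"
    by (rule twice_differentiable_on_cong[OF _ _ 1[unfolded U]])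
      (simp add: U_def \<Psi>_def b pullback_def chart_inv_chart[OF c'(1)])
  then show "pb x differentiable at u \<and> (\<forall>v. (\<lambda>z. frechet_derivative (pb x) (at z) v) differentiable at u)"
    using c'(2) unfolding twice_differentiable_on_def by (auto simp: U_def)
qed

lemma pg_derivative: "(pb x has_derivative g x (pg x s)) (at s)"
  using posdef_form.gradient_wrt_differentiable(1)[OF form pullback_twice_differentiable]
  by (simp add: pb_grad_def)

lemma ph_derivative: "(pg x has_derivative ph x s) (at s)"
proof -
  have "pg x = gradient_wrt (g x) (pb x)" by (simp add: pb_grad_def fun_eq_iff)
  then show ?thesis
    using posdef_form.gradient_wrt_differentiable(2)[OF form pullback_twice_differentiable]
    unfolding pb_hess_def by (simp flip: frechet_derivative_works)
qed

lemma ph_symmetric: "g x (ph x 0 u) v = g x u (ph x 0 v)"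
  by (rule posdef_form.hessian_symmetric[OF form pg_derivative ph_derivative])

lemma ph_linear: "linear (ph x s)"
  using ph_derivative by (rule has_derivative_linear)

text \<open>Chain rule, with the identity as the derivative of the retraction at \<open>0\<close>.
  It links the test in the while-loop to the gradient from which the tangent space descent
  starts.\<close>

lemma riem_grad_eq: "riem_grad A g f x = pg x 0"
proof -
  define c where "c = chart_at A x"
  have c: "c \<in> A" "x \<in> fst c" using chart_at by (auto simp: c_def)
  interpret posdef_form "g x" by (rule form)
  let ?F = "f \<circ> chart_inv c"
  have "Ck_on 2 (chart_im c) ?F" using f_C2 c by (simp add: C2_fun_def)
  then have "?F differentiable (at (snd c x))"
    using chart_in_im[OF c] by (auto simp: numeral_2_eq_2)
  then have D: "(?F has_derivative g x (gradient_wrt (g x) ?F (snd c x))) (at (snd c x))"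
    by (rule gradient_wrt_derivative)
  have R: "((snd c \<circ> Retr x) has_derivative (\<lambda>v. v)) (at 0)"
    using retraction by (simp add: manifold_retraction_def c_def)
  have "((\<lambda>u. ?F ((snd c \<circ> Retr x) u)) has_derivative (\<lambda>v. g x (gradient_wrt (g x) ?F (snd c x)) v)) (at 0)"
  proof (rule has_derivative_compose[OF R])
    have "(snd c \<circ> Retr x) 0 = snd c x" by (simp add: Retr_zero)
    then show "(?F has_derivative g x (gradient_wrt (g x) ?F (snd c x))) (at ((snd c \<circ> Retr x) 0))"
      using D by (simp only:)
  qed
  moreover have "open (Retr x -` fst c)"
    by (rule open_vimage[OF chart_open(1)[OF c(1)] Retr_continuous])
  ultimately have "(pb x has_derivative (\<lambda>v. g x (gradient_wrt (g x) ?F (snd c x)) v)) (at 0)"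
    by (rule has_derivative_transform_within_open)
      (use c in \<open>auto simp: Retr_zero pullback_def chart_inv_chart\<close>)
  then have "gradient_wrt (g x) (pb x) 0 = gradient_wrt (g x) ?F (snd c x)"
    by (rule gradient_wrt_eqI)
  then show ?thesis by (simp add: riem_grad_def pb_grad_def c_def)
qed

section \<open>Borel measurability of the pullbacks, their gradients and their Hessians\<close>

lemma measurable_pb: "(\<lambda>z. pb (fst z) (snd z)) \<in> borel_measurable (borel \<Otimes>\<^sub>M borel)"
  using measurable_compose[OF measurable_Retr measurable_f] by (simp add: pullback_def borel_prod)

lemma measurable_pg: "(\<lambda>z. pg (fst z) (snd z)) \<in> borel_measurable (borel \<Otimes>\<^sub>M borel)"
proof (rule riesz_measurable)
  show "posdef_form (g (fst z))" for z :: "'m \<times> 'e" by (rule form)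
  show "(\<lambda>z. g (fst z) u v) \<in> borel_measurable (borel \<Otimes>\<^sub>M borel)" for u v
    by (rule measurable_compose[OF measurable_fst measurable_metric])
  show "linear (\<lambda>v. g (fst z) (pg (fst z) (snd z)) v)" for z
    using pg_derivative by (rule has_derivative_linear)
  show "(\<lambda>z. g (fst z) (pg (fst z) (snd z)) v) \<in> borel_measurable (borel \<Otimes>\<^sub>M borel)" for v
  proof (rule borel_measurable_LIMSEQ_real)
    show "(\<lambda>n. real (Suc n) *\<^sub>R (pb (fst z) (snd z + (1 / real (Suc n)) *\<^sub>R v) - pb (fst z) (snd z)))
        \<longlonglongrightarrow> g (fst z) (pg (fst z) (snd z)) v" for z
      by (rule has_derivative_difference_quotient[OF pg_derivative])
    fix n
    have "(\<lambda>z. pb (fst (fst z, snd z + (1 / real (Suc n)) *\<^sub>R v)) (snd (fst z, snd z + (1 / real (Suc n)) *\<^sub>R v)))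
        \<in> borel_measurable (borel \<Otimes>\<^sub>M borel)"
      by (rule measurable_compose[OF _ measurable_pb]) measurable
    then show "(\<lambda>z. real (Suc n) *\<^sub>R (pb (fst z) (snd z + (1 / real (Suc n)) *\<^sub>R v) - pb (fst z) (snd z)))
        \<in> borel_measurable (borel \<Otimes>\<^sub>M borel)"
      using measurable_pb by simp
  qed
qed auto

lemma measurable_pg_compose:
  assumes "X \<in> measurable M borel" "S \<in> measurable M borel"
  shows "(\<lambda>z. pg (X z) (S z)) \<in> borel_measurable M"
  using measurable_compose[OF measurable_Pair[OF assms] measurable_pg] by simp

lemma measurable_Retr_compose:
  assumes "X \<in> measurable M borel" "S \<in> measurable M borel"
  shows "(\<lambda>z. Retr (X z) (S z)) \<in> borel_measurable M"
  using measurable_compose[OF measurable_Pair[OF assms] measurable_Retr[folded borel_prod]] by simp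

lemma measurable_metric_compose:
  assumes [measurable]: "X \<in> measurable M borel" "U \<in> borel_measurable M" "V \<in> borel_measurable M"
  shows "(\<lambda>z. g (X z) (U z) (V z)) \<in> borel_measurable M"
proof -
  have [measurable]: "(\<lambda>z. g (X z) i j) \<in> borel_measurable M" for i j
    by (rule measurable_compose[OF assms(1) measurable_metric])
  have "g x u v = (\<Sum>i\<in>Basis. \<Sum>j\<in>Basis. (u \<bullet> i) * (v \<bullet> j) * g x i j)" for x u v
  proof -
    interpret posdef_form "g x" by (rule form)
    have "g x u v = g x (\<Sum>i\<in>Basis. (u \<bullet> i) *\<^sub>R i) (\<Sum>j\<in>Basis. (v \<bullet> j) *\<^sub>R j)"
      by (simp only: euclidean_representation)
    also have "\<dots> = (\<Sum>i\<in>Basis. \<Sum>j\<in>Basis. (u \<bullet> i) * (v \<bullet> j) * g x i j)"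
      by (simp add: bounded_bilinear.sum_left[OF bounded_bilinear] bounded_bilinear.sum_right[OF bounded_bilinear]
          ip_simps sum_distrib_left mult_ac) (rule sum.swap)
    finally show ?thesis .
  qed
  then have "(\<lambda>z. g (X z) (U z) (V z)) =
      (\<lambda>z. \<Sum>i\<in>Basis. \<Sum>j\<in>Basis. (U z \<bullet> i) * (V z \<bullet> j) * g (X z) i j)"
    by (intro ext)
  then show ?thesis by simp
qed

lemma measurable_tnorm_compose:
  assumes "X \<in> measurable M borel" "U \<in> borel_measurable M"
  shows "(\<lambda>z. tnorm g (X z) (U z)) \<in> borel_measurable M"
  unfolding tnorm_def using measurable_metric_compose[OF assms(1,2,2)] by simp

lemma measurable_ph_zero: "(\<lambda>x. ph x 0 v) \<in> borel_measurable borel"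
proof (rule borel_measurable_LIMSEQ_metric)
  show "(\<lambda>n. real (Suc n) *\<^sub>R (pg x (0 + (1 / real (Suc n)) *\<^sub>R v) - pg x 0)) \<longlonglongrightarrow> ph x 0 v" for x
    by (rule has_derivative_difference_quotient[OF ph_derivative])
  show "(\<lambda>x. real (Suc n) *\<^sub>R (pg x (0 + (1 / real (Suc n)) *\<^sub>R v) - pg x 0)) \<in> borel_measurable borel" for n
    by (intro borel_measurable_scaleR borel_measurable_diff measurable_pg_compose) auto
qed

text \<open>A vector violating the quadratic form inequality has violating neighbours, so vectors of
  a countable dense set detect every violation.\<close>

lemma lambda_min_set:
  "{x. a \<le> lambda_min (ph x 0)} \<in> sets borel"
proof -
  obtain D :: "'e set" where D: "countable D" "\<And>X. open X \<Longrightarrow> X \<noteq> {} \<Longrightarrow> \<exists>d\<in>D. d \<in> X"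
    by (rule countable_dense_setE) blast
  have "a \<le> lambda_min (ph x 0) \<longleftrightarrow> (\<forall>v\<in>D. a * g x v v \<le> g x (ph x 0 v) v)" for x
  proof -
    interpret posdef_form "g x" by (rule form)
    have "open {v. g x (ph x 0 v) v < a * g x v v}"
      by (intro open_Collect_less continuous_intros linear_continuous_on
          linear_conv_bounded_linear[THEN iffD1] ph_linear)
    from D(2)[OF this]
    have "(\<forall>v\<in>D. a * g x v v \<le> g x (ph x 0 v) v) \<longleftrightarrow> (\<forall>v. a * g x v v \<le> g x (ph x 0 v) v)"
      by (auto simp: not_less[symmetric])
    then show ?thesis by (simp add: le_lambda_min_iff[OF ph_linear ph_symmetric])
  qed
  moreover have "{x \<in> space borel. \<forall>v\<in>D. a * g x v v \<le> g x (ph x 0 v) v} \<in> sets borel"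
  proof (rule sets.sets_Collect_countable_All'[OF _ D(1)])
    fix v
    have [measurable]: "(\<lambda>x. g x v v) \<in> borel_measurable borel" "(\<lambda>x. g x (ph x 0 v) v) \<in> borel_measurable borel"
      by (intro measurable_metric_compose measurable_ph_zero; simp)+
    show "{x \<in> space borel. a * g x v v \<le> g x (ph x 0 v) v} \<in> sets borel" by measurable
  qed
  ultimately show ?thesis by simp
qed

lemma opnorm_le:
  assumes "linear H" and "opnorm_at g x H \<le> a"
  shows "tnorm g x (H v) \<le> a * tnorm g x v"
proof (cases "v = 0")
  case True
  then show ?thesis
    unfolding tnorm_eq_ipnorm by (simp add: linear_0[OF assms(1)] posdef_form.nrm_zero[OF form])
next
  case False
  interpret posdef_form "g x" by (rule form)
  obtain c where c: "0 < c" "\<And>v. norm v \<le> c * nrm v" using norm_le_nrm by blast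
  obtain C where C: "0 < C" "\<And>v. nrm v \<le> C * norm v" using nrm_le_norm by blast
  obtain B where B: "0 < B" "\<And>v. norm (H v) \<le> norm v * B"
    using bounded_linear.pos_bounded[of H] assms(1) linear_conv_bounded_linear by blast
  \<comment> \<open>The supremum in \<open>opnorm_at\<close> is an upper bound only if the quotients
    are bounded, which follows from the equivalence of norms. At \<open>v = 0\<close> the quotient
    is \<open>0\<close> by division by zero.\<close>
  have "bdd_above (range (\<lambda>v. nrm (H v) / nrm v))"
  proof (rule bdd_aboveI2)
    fix v
    have "nrm (H v) \<le> C * (c * nrm v * B)"
    proof -
      have "nrm (H v) \<le> C * norm (H v)" by (rule C(2))
      also have "\<dots> \<le> C * (norm v * B)" using B C by (intro mult_left_mono) auto
      also have "\<dots> \<le> C * (c * nrm v * B)" using B C c by (intro mult_left_mono mult_right_mono) auto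
      finally show ?thesis .
    qed
    then show "nrm (H v) / nrm v \<le> C * c * B"
      using B(1) C(1) c(1) by (cases "v = 0") (auto simp: pos_divide_le_eq nrm_pos mult_ac)
  qed
  then have "nrm (H v) / nrm v \<le> opnorm_at g x H"
    unfolding opnorm_at_def tnorm_eq_ipnorm by (rule cSUP_upper[rotated]) simp
  then have "nrm (H v) / nrm v \<le> a" using assms(2) by simp
  then show ?thesis using nrm_pos[OF False] by (simp add: tnorm_eq_ipnorm pos_divide_le_eq)
qed

end

section \<open>One round of the algorithm\<close>

text \<open>\<open>\<kappa>\<close> and \<open>\<Lambda>\<close> are \<open>sqrt (\<rho> \<epsilon>)\<close> and \<open>sqrt (\<epsilon> / \<rho>)\<close>.\<close>

locale prgd_analysis = C2_on_manifold A g Retr f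
  for A :: "('m::{t2_space, second_countable_topology}, 'e::euclidean_space) chart set"
    and g :: "'m \<Rightarrow> 'e \<Rightarrow> 'e \<Rightarrow> real" and Retr :: "'m \<Rightarrow> 'e \<Rightarrow> 'm" and f :: "'m \<Rightarrow> real" +
  fixes \<rho> l \<epsilon> \<kappa> \<Lambda> \<eta> chi r F :: real and b :: ereal and N :: nat
  assumes \<kappa>_pos: "0 < \<kappa>" and \<Lambda>_pos: "0 < \<Lambda>" and \<epsilon>_eq: "\<epsilon> = \<kappa> * \<Lambda>" and \<rho>_eq: "\<rho> = \<kappa> / \<Lambda>"
    and l_ge: "\<kappa> \<le> l" and b_ge: "ereal \<Lambda> \<le> b"
    and lip: "\<And>x s s'. ereal (tnorm g x s) \<le> b \<Longrightarrow> ereal (tnorm g x s') \<le> b \<Longrightarrow>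
         tnorm g x (pb_grad g Retr f x s - pb_grad g Retr f x s') \<le> l * tnorm g x (s - s')"
    and hess_lip: "\<And>x s v. ereal (tnorm g x s) \<le> b \<Longrightarrow>
         tnorm g x (pb_hess g Retr f x s v - pb_hess g Retr f x 0 v) \<le> \<rho> * tnorm g x s * tnorm g x v"
    and chi: "1 / 4 < chi" and \<eta>_eq: "\<eta> = 1 / l" and r_eq: "r = \<epsilon> / (400 * chi ^ 3)"
    and N_eq: "real N = l * chi / \<kappa>" and F_eq: "F = \<epsilon> * \<Lambda> / (50 * chi ^ 3)"
begin

lemma l_pos: "0 < l" and \<rho>_pos: "0 < \<rho>" and \<epsilon>_pos: "0 < \<epsilon>" and \<eta>_pos: "0 < \<eta>" and chi_pos: "0 < chi"
  using \<kappa>_pos \<Lambda>_pos l_ge chi by (auto simp: \<rho>_eq \<epsilon>_eq \<eta>_eq)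

lemma r_pos: "0 < r" and F_pos: "0 < F"
  using \<epsilon>_pos \<Lambda>_pos chi_pos by (auto simp: r_eq F_eq)

lemma chi_sq: "1 \<le> 16 * chi\<^sup>2" and chi_cube: "1 \<le> 64 * chi ^ 3"
proof -
  have "(1/4)\<^sup>2 \<le> chi\<^sup>2" "(1/4)^3 \<le> chi^3" using chi by (intro power_mono; simp)+
  then show "1 \<le> 16 * chi\<^sup>2" "1 \<le> 64 * chi ^ 3" by (simp_all add: power2_eq_square power3_eq_cube)
qed

lemma b_pos: "0 < b"
  using \<Lambda>_pos by (intro order.strict_trans2[OF _ b_ge]) simp

lemma gd: "gd_space_hess (g x) (pb x) (pg x) l \<eta> b (ph x) \<rho>"
proof -
  interpret posdef_form "g x" by (rule form)
  show ?thesis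
  proof
    show "(pb x has_derivative g x (pg x s)) (at s)" for s by (rule pg_derivative)
    show "(pg x has_derivative ph x s) (at s)" for s by (rule ph_derivative)
    show "g x (ph x 0 u) v = g x u (ph x 0 v)" for u v by (rule ph_symmetric)
  qed (use l_pos \<eta>_eq b_pos \<rho>_pos lip[of x] hess_lip[of x] in \<open>auto simp: tnorm_eq_ipnorm\<close>)
qed

abbreviation tloop :: "'m \<Rightarrow> nat \<Rightarrow> 'e \<Rightarrow> 'e" where
  "tloop x \<equiv> tangent_loop (tnorm g x) (pg x) \<eta> b"

abbreviation gradient_step :: "'m \<Rightarrow> 'm" where
  "gradient_step x \<equiv> tangent_space_steps (tnorm g) pg Retr x 0 \<eta> b 1"
abbreviation perturbed_step :: "'m \<Rightarrow> 'e \<Rightarrow> 'm" where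
  "perturbed_step x v \<equiv> tangent_space_steps (tnorm g) pg Retr x (\<eta> *\<^sub>R v) \<eta> b N"

text \<open>The decrease is counted from the perturbed start, not from \<open>f x\<close>; what the
  perturbation itself may cost is charged separately in \<open>increase_bound\<close>.\<close>

definition fails :: "'m \<Rightarrow> 'e \<Rightarrow> bool" where
  "fails x v \<longleftrightarrow> pb x (\<eta> *\<^sub>R v) - pb x (tloop x N (\<eta> *\<^sub>R v)) < F"

lemma \<eta>_\<epsilon>_le: "\<eta> * \<epsilon> \<le> \<Lambda>"
  using l_ge l_pos \<Lambda>_pos by (simp add: \<eta>_eq \<epsilon>_eq field_simps)

lemma \<eta>_r_le: "\<eta> * r \<le> \<Lambda> / (25 * chi)" "\<eta> * r < \<Lambda>"
proof -
  have "\<eta> * r = \<eta> * \<epsilon> / (400 * chi ^ 3)" by (simp add: r_eq)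
  also have "\<dots> \<le> \<Lambda> / (400 * chi ^ 3)" using \<eta>_\<epsilon>_le chi_pos by (intro divide_right_mono) auto
  finally have le: "\<eta> * r \<le> \<Lambda> / (400 * chi ^ 3)" .
  \<comment> \<open>\<open>400 * chi ^ 3\<close> is the product of \<open>16 * chi\<^sup>2\<close>,
    which is at least 1, and \<open>25 * chi\<close>.\<close>
  have "25 * chi \<le> (16 * chi\<^sup>2) * (25 * chi)" using chi_sq chi_pos by (intro mult_le_cancel_right1[THEN iffD2]) auto
  then have "\<Lambda> / (400 * chi ^ 3) \<le> \<Lambda> / (25 * chi)"
    using \<Lambda>_pos chi_pos by (intro divide_left_mono) (auto simp: power2_eq_square power3_eq_cube)
  with le show 1: "\<eta> * r \<le> \<Lambda> / (25 * chi)" by linarith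
  have "\<Lambda> / (25 * chi) < \<Lambda>" using \<Lambda>_pos chi by (simp add: field_simps)
  with 1 show "\<eta> * r < \<Lambda>" by linarith
qed

lemma start_in_ball:
  assumes "v \<in> tball g r x" shows "tnorm g x (\<eta> *\<^sub>R v) \<le> \<eta> * r" "ereal (tnorm g x (\<eta> *\<^sub>R v)) < b"
proof -
  interpret gd_space_hess "g x" "pb x" "pg x" l \<eta> b "ph x" \<rho> by (rule gd)
  show 1: "tnorm g x (\<eta> *\<^sub>R v) \<le> \<eta> * r"
    using assms \<eta>_pos by (simp add: tball_def tnorm_eq_ipnorm)
  then have "ereal (tnorm g x (\<eta> *\<^sub>R v)) < ereal \<Lambda>" using \<eta>_r_le(2) by simp
  then show "ereal (tnorm g x (\<eta> *\<^sub>R v)) < b" using b_ge by (rule order.strict_trans2)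
qed

lemma large_gradient_step:
  assumes "\<epsilon> < tnorm g x (riem_grad A g f x)"
  shows "f (gradient_step x) \<le> f x - \<eta> * \<epsilon>\<^sup>2 / 2"
proof -
  interpret gd_space_hess "g x" "pb x" "pg x" l \<eta> b "ph x" \<rho> by (rule gd)
  have "pb x (tangent_loop (ipnorm (g x)) (pg x) \<eta> b 1 0) \<le> pb x 0 - \<eta> * \<epsilon>\<^sup>2 / 2"
    by (rule first_step_descent[OF b_pos \<Lambda>_pos b_ge \<eta>_\<epsilon>_le \<epsilon>_pos])
      (use assms in \<open>simp add: riem_grad_eq tnorm_eq_ipnorm\<close>)
  then show ?thesis
    unfolding tangent_space_steps_def tnorm_eq_ipnorm by (simp only: pullback_def comp_apply Retr_zero)
qed

text \<open>The radius is such that \<open>\<Lambda> * r = F / 8\<close>, and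
  \<open>chi > 1 / 4\<close> makes the quadratic term at most 2/25 of that. So 27/200 is 1/8 * (1 +
  2/25).\<close>

lemma increase_bound: "\<eta> * \<epsilon> * r + \<eta> * r\<^sup>2 / 2 \<le> 27 / 200 * F"
proof -
  have "\<eta> * \<epsilon> * r \<le> \<Lambda> * r" using \<eta>_\<epsilon>_le r_pos by (intro mult_right_mono) auto
  also have "\<Lambda> * r = F / 8" using chi_pos by (simp add: r_eq F_eq)
  finally have 1: "\<eta> * \<epsilon> * r \<le> F / 8" .
  have "\<eta> * r\<^sup>2 / 2 = \<eta> * \<epsilon> * r * (r / (2 * \<epsilon>))" using \<epsilon>_pos by (simp add: power2_eq_square)
  also have "r / (2 * \<epsilon>) = 1 / (800 * chi ^ 3)" using \<epsilon>_pos by (simp add: r_eq)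
  also have "\<eta> * \<epsilon> * r * (1 / (800 * chi ^ 3)) \<le> F / 8 * (2 / 25)"
  proof (rule mult_mono[OF 1])
    show "1 / (800 * chi ^ 3) \<le> 2 / 25" using chi_cube chi_pos by (simp add: field_simps)
  qed (use F_pos chi_pos in auto)
  finally show ?thesis using 1 by simp
qed

lemma perturbed_round:
  assumes small: "tnorm g x (riem_grad A g f x) \<le> \<epsilon>" and v: "v \<in> tball g r x"
  shows "f (perturbed_step x v) \<le> f x + 27 / 200 * F"
    and "\<not> fails x v \<Longrightarrow>
      f (perturbed_step x v) \<le> f x + 27 / 200 * F - F"
proof -
  interpret gd_space_hess "g x" "pb x" "pg x" l \<eta> b "ph x" \<rho> by (rule gd)
  have "pb x (\<eta> *\<^sub>R v) \<le> pb x 0 + \<eta> * \<epsilon> * r + \<eta> * r\<^sup>2 / 2"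
    by (rule perturbation_increase)
      (use b_pos start_in_ball[OF v] small r_pos in \<open>auto simp: riem_grad_eq tnorm_eq_ipnorm\<close>)
  then have 1: "pb x (\<eta> *\<^sub>R v) \<le> f x + 27 / 200 * F"
    using increase_bound by (simp add: pullback_def Retr_zero)
  have "pb x (tloop x N (\<eta> *\<^sub>R v)) \<le> pb x (\<eta> *\<^sub>R v)"
    using loop_props[of "\<eta> *\<^sub>R v" N] start_in_ball(2)[OF v] by (simp add: tnorm_eq_ipnorm)
  with 1 show "f (perturbed_step x v) \<le> f x + 27 / 200 * F"
    by (simp add: tangent_space_steps_def pullback_def)
  assume "\<not> fails x v"
  with 1 show "f (perturbed_step x v) \<le> f x + 27 / 200 * F - F"
    by (simp add: tangent_space_steps_def pullback_def fails_def)
qed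

text \<open>\<open>coupled_separation\<close> at radius \<open>6 * \<Lambda> / (25 * chi)\<close>
  gives this bound on the distance with 6/5 in place of 5/4; the larger factor makes the inequality
  strict.\<close>

definition gap :: real where "gap = 5 / 4 * l * \<Lambda> * exp (- chi / 2) / chi"

lemma gap_pos: "0 < gap"
  using l_pos \<Lambda>_pos chi_pos by (simp add: gap_def)

lemma fails_localized:
  assumes v: "v \<in> tball g r x" and "fails x v"
  shows "\<forall>j\<le>N. tnorm g x (((\<lambda>s. s - \<eta> *\<^sub>R pg x s) ^^ j) (\<eta> *\<^sub>R v)) \<le> 6 * \<Lambda> / (25 * chi)"
proof -
  interpret gd_space_hess "g x" "pb x" "pg x" l \<eta> b "ph x" \<rho> by (rule gd)
  have st: "step = (\<lambda>s. s - \<eta> *\<^sub>R pg x s)" by (simp add: step_def fun_eq_iff)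
  have le: "tnorm g x (\<eta> *\<^sub>R v) + \<Lambda> / (5 * chi) \<le> 6 * \<Lambda> / (25 * chi)"
  proof -
    have "\<Lambda> / (25 * chi) + \<Lambda> / (5 * chi) = 6 * \<Lambda> / (25 * chi)" using chi_pos by (simp add: field_simps)
    then show ?thesis using start_in_ball(1)[OF v] \<eta>_r_le(1) by linarith
  qed
  \<comment> \<open>As \<open>chi > 1 / 4\<close>, the left side is below 24/25 of
    \<Lambda>.\<close>
  have lt: "6 * \<Lambda> / (25 * chi) < \<Lambda>" using \<Lambda>_pos chi by (simp add: field_simps)
  have "ereal (tnorm g x (\<eta> *\<^sub>R v) + \<Lambda> / (5 * chi)) < ereal \<Lambda>" using le lt by simp
  then have lb: "ereal (tnorm g x (\<eta> *\<^sub>R v) + \<Lambda> / (5 * chi)) < b" using b_ge by (rule order.strict_trans2)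
  \<comment> \<open>\<open>N\<close> and \<open>F\<close> are calibrated so that the distance
    allowed by "improve or localize" is \<open>\<Lambda> / (5 * chi)\<close>. The start adds
    \<open>\<Lambda> / (25 * chi)\<close>.\<close>
  have "2 * \<eta> * N * F = 2 * (1 / l * l) * (\<epsilon> / \<kappa>) * chi * \<Lambda> / (50 * chi ^ 3)"
    by (simp add: N_eq F_eq \<eta>_eq)
  also have "\<dots> = (\<Lambda> / (5 * chi))\<^sup>2"
    using l_pos \<kappa>_pos chi_pos by (simp add: \<epsilon>_eq power2_eq_square power3_eq_cube)
  finally have 2: "2 * \<eta> * N * F = (\<Lambda> / (5 * chi))\<^sup>2" .
  have "\<forall>j\<le>N. nrm ((step ^^ j) (\<eta> *\<^sub>R v)) \<le> nrm (\<eta> *\<^sub>R v) + \<Lambda> / (5 * chi)"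
    by (rule localize[where F = F])
      (use start_in_ball(2)[OF v] assms(2) 2 lb \<Lambda>_pos chi_pos in \<open>auto simp: fails_def tnorm_eq_ipnorm\<close>)
  then show ?thesis using le by (auto simp: st tnorm_eq_ipnorm intro: order_trans)
qed

lemma fails_thin:
  assumes e: "tnorm g x e = 1" "ph x 0 e = lambda_min (ph x 0) *\<^sub>R e" and saddle: "lambda_min (ph x 0) < - \<kappa>"
    and u: "u \<in> tball g r x" "fails x u" and w: "w \<in> tball g r x" "fails x w" and uw: "u - w = t *\<^sub>R e"
  shows "\<bar>t\<bar> < gap"
proof -
  interpret gd_space_hess "g x" "pb x" "pg x" l \<eta> b "ph x" \<rho> by (rule gd)
  define \<gamma> where "\<gamma> = - lambda_min (ph x 0)"
  have st: "step = (\<lambda>s. s - \<eta> *\<^sub>R pg x s)" by (simp add: step_def fun_eq_iff)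
  have \<gamma>: "\<kappa> < \<gamma>" using saddle by (simp add: \<gamma>_def)
  have "6 * \<Lambda> / (25 * chi) \<le> \<Lambda>" using \<Lambda>_pos chi by (simp add: field_simps)
  then have Rb: "ereal (6 * \<Lambda> / (25 * chi)) \<le> b" using b_ge by (intro order_trans[OF _ b_ge]) simp
  have "(1 + \<eta> * \<gamma>) ^ N * nrm (\<eta> *\<^sub>R u - \<eta> *\<^sub>R w) \<le> 5 * (6 * \<Lambda> / (25 * chi))"
  proof (rule coupled_separation[where e = e and \<tau> = "\<eta> * t"])
    show "ph x 0 e = - \<gamma> *\<^sub>R e" using e by (simp add: \<gamma>_def)
    show "- \<gamma> * g x v v \<le> g x (ph x 0 v) v" for v
      using lambda_min_props(2)[OF ph_linear[of x 0] ph_symmetric] by (simp add: \<gamma>_def)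
    show "\<eta> *\<^sub>R u - \<eta> *\<^sub>R w = (\<eta> * t) *\<^sub>R e" using uw by (simp flip: scaleR_diff_right)
    \<comment> \<open>The accumulated variation of the Hessian does not depend on
      \<open>chi\<close>: the radius shrinks with \<open>chi\<close> as fast as the round gets
      longer.\<close>
    have "\<eta> * \<rho> * (6 * \<Lambda> / (25 * chi)) * N = 6 / 25"
      using l_pos \<kappa>_pos \<Lambda>_pos chi_pos by (simp add: \<eta>_eq \<rho>_eq N_eq)
    then show "\<eta> * \<rho> * (6 * \<Lambda> / (25 * chi)) * N \<le> 2 / 5" by simp
  qed (use \<gamma> \<kappa>_pos Rb fails_localized[OF u] fails_localized[OF w] in \<open>auto simp: st tnorm_eq_ipnorm\<close>)
  moreover have "exp (chi / 2) \<le> (1 + \<eta> * \<gamma>) ^ N"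
  proof -
    \<comment> \<open>\<open>a \<le> 1\<close> by \<open>\<kappa> \<le> l\<close>, so
      \<open>exp (a / 2) \<le> 1 + a\<close>; and \<open>N * a = chi\<close>. Halving the exponent
      is the price for passing from a power of \<open>1 + a\<close> to an exponential.\<close>
    define a where "a = \<eta> * \<kappa>"
    have a: "0 \<le> a" "a \<le> 1" using \<eta>_pos \<kappa>_pos l_ge l_pos by (auto simp: a_def \<eta>_eq)
    have "exp (a / 2) \<le> 1 + a / 2 + (a / 2)\<^sup>2" using a by (intro exp_bound) auto
    also have "\<dots> \<le> 1 + a" using a mult_right_mono[of a 1 a] by (simp add: power2_eq_square)
    also have "\<dots> \<le> 1 + \<eta> * \<gamma>" using \<gamma> \<eta>_pos by (simp add: a_def)
    finally have "exp (a / 2) ^ N \<le> (1 + \<eta> * \<gamma>) ^ N" by (intro power_mono) auto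
    moreover have "exp (a / 2) ^ N = exp (chi / 2)"
      using l_pos \<kappa>_pos by (simp add: exp_of_nat_mult[symmetric] N_eq a_def \<eta>_eq)
    ultimately show ?thesis by simp
  qed
  then have "exp (chi / 2) * (\<eta> * \<bar>t\<bar>) \<le> (1 + \<eta> * \<gamma>) ^ N * (\<eta> * \<bar>t\<bar>)"
    using \<eta>_pos by (intro mult_right_mono) auto
  moreover have "nrm (\<eta> *\<^sub>R u - \<eta> *\<^sub>R w) = \<eta> * \<bar>t\<bar>"
    using uw e(1) \<eta>_pos by (simp add: tnorm_eq_ipnorm abs_mult flip: scaleR_diff_right)
  ultimately have "exp (chi / 2) * (\<eta> * \<bar>t\<bar>) \<le> 6 * \<Lambda> / (5 * chi)" by simp
  then have "(l * exp (- chi / 2)) * (exp (chi / 2) * (\<eta> * \<bar>t\<bar>)) \<le> (l * exp (- chi / 2)) * (6 * \<Lambda> / (5 * chi))"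
    using l_pos by (intro mult_left_mono) auto
  moreover have "(l * exp (- chi / 2)) * (exp (chi / 2) * (\<eta> * \<bar>t\<bar>)) = \<bar>t\<bar>"
    using l_pos by (simp add: \<eta>_eq exp_minus)
  moreover have "(l * exp (- chi / 2)) * (6 * \<Lambda> / (5 * chi)) < gap"
    using l_pos \<Lambda>_pos chi_pos by (simp add: gap_def field_simps)
  ultimately show ?thesis by linarith
qed

text \<open>This is \<open>4 * sqrt DIM('e) * gap / r\<close>, the factor from
  \<open>emeasure_thin\<close>, after cancelling \<Lambda>.\<close>

definition fail_prob :: real where
  "fail_prob = 2000 * sqrt DIM('e) * (l / \<kappa>) * chi\<^sup>2 * exp (- chi / 2)"

text \<open>Measurability of the failing set is assumed at this stage; it is obtained later from the
  measurable copy of the loop.\<close>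

lemma fails_probability:
  assumes saddle: "lambda_min (ph x 0) < - \<kappa>" and meas: "{v \<in> tball g r x. fails x v} \<in> sets borel"
  shows "emeasure lborel {v \<in> tball g r x. fails x v} / emeasure lborel (tball g r x) \<le> ennreal fail_prob"
proof -
  interpret gd_space_hess "g x" "pb x" "pg x" l \<eta> b "ph x" \<rho> by (rule gd)
  let ?X = "{v \<in> tball g r x. fails x v}"
  have ball: "tball g r x = {v. nrm v \<le> r}" by (simp add: tball_def tnorm_eq_ipnorm)
  obtain e where e: "nrm e = 1" "ph x 0 e = lambda_min (ph x 0) *\<^sub>R e"
    using lambda_min_props(1)[OF ph_linear[of x 0] ph_symmetric] by blast
  have "emeasure lborel ?X \<le> ennreal (4 * sqrt DIM('e) * gap / r) * emeasure lborel {v. nrm v \<le> r}"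
  proof (rule emeasure_thin[OF meas _ e(1) r_pos gap_pos])
    show "u \<in> ?X \<Longrightarrow> nrm u \<le> r" for u by (simp add: ball)
    show "\<bar>t\<bar> < gap" if "u \<in> ?X" "w \<in> ?X" "u - w = t *\<^sub>R e" for u w t
      by (rule fails_thin[of x e u w]) (use that e saddle in \<open>auto simp: tnorm_eq_ipnorm\<close>)
  qed
  also have "4 * sqrt DIM('e) * gap / r = fail_prob"
    using \<Lambda>_pos \<kappa>_pos chi_pos
    by (simp add: gap_def r_eq \<epsilon>_eq fail_prob_def power2_eq_square power3_eq_cube)
  finally have "emeasure lborel ?X / emeasure lborel (tball g r x)
      \<le> ennreal fail_prob * emeasure lborel {v. nrm v \<le> r} / emeasure lborel {v. nrm v \<le> r}"
    unfolding ball by (rule divide_right_mono_ennreal)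
  also have "\<dots> = ennreal fail_prob"
    using emeasure_nrm_ball_pos[OF r_pos] emeasure_nrm_ball_finite[of r]
    by (intro mult_divide_eq_ennreal) auto
  finally show ?thesis .
qed

end

section \<open>Counting the passes of a run\<close>

lemma card_less_Suc_filter: "card {j. j < Suc k \<and> P j} = card {j. j < k \<and> P j} + (if P k then 1 else 0)"
proof -
  have "{j. j < Suc k \<and> P j} = (if P k then insert k {j. j < k \<and> P j} else {j. j < k \<and> P j})"
    by (auto simp: less_Suc_eq)
  then show ?thesis by simp
qed

locale prgd_run = prgd_analysis A g Retr f \<rho> l \<epsilon> \<kappa> \<Lambda> \<eta> chi r F b N
  for A :: "('m::{t2_space, second_countable_topology}, 'e::euclidean_space) chart set"
    and g Retr f \<rho> l \<epsilon> \<kappa> \<Lambda> \<eta> chi r F b N +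
  fixes fstar T :: real and x\<^sub>0 :: 'm
  assumes lower: "\<And>x. fstar \<le> f x"
    and \<epsilon>\<Lambda>_le: "\<epsilon> * \<Lambda> \<le> 3 * (f x\<^sub>0 - fstar)"
    and T_ge: "8 / 3 * N \<le> T" "8 * (f x\<^sub>0 - fstar) * N / F \<le> T" "8 * (f x\<^sub>0 - fstar) / (\<eta> * \<epsilon>\<^sup>2) \<le> T"
begin

abbreviation run :: "(nat \<Rightarrow> 'e) \<Rightarrow> nat \<Rightarrow> nat \<times> 'm" where
  "run \<equiv> prgd (tnorm g) (riem_grad A g f) pg Retr x\<^sub>0 \<eta> N \<epsilon> T b"

definition visited :: "nat \<times> 'm \<Rightarrow> bool" where "visited st \<longleftrightarrow> real (fst st) \<le> T"
definition small :: "'m \<Rightarrow> bool" where "small x \<longleftrightarrow> tnorm g x (riem_grad A g f x) \<le> \<epsilon>"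
definition draws :: "nat \<times> 'm \<Rightarrow> bool" where "draws st \<longleftrightarrow> visited st \<and> small (snd st)"
definition good :: "'m \<Rightarrow> bool" where "good x \<longleftrightarrow> small x \<and> - \<kappa> \<le> lambda_min (ph x 0)"

abbreviation admissible :: "(nat \<Rightarrow> 'e) \<Rightarrow> bool" where
  "admissible \<equiv> admissible_draws g r run draws"

lemma N_pos: "1 \<le> N"
proof -
  have "0 < real N" using l_pos \<kappa>_pos chi_pos by (simp add: N_eq)
  then show ?thesis by simp
qed

lemma T_pos: "0 < T"
  using T_ge(1) N_pos by simp

lemma run_Suc:
  "\<not> visited (run w k) \<Longrightarrow> run w (Suc k) = run w k"
  "draws (run w k) \<Longrightarrow> run w (Suc k) =
     (fst (run w k) + N, perturbed_step (snd (run w k)) (w k))"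
  "visited (run w k) \<Longrightarrow> \<not> small (snd (run w k)) \<Longrightarrow> run w (Suc k) =
     (fst (run w k) + 1, gradient_step (snd (run w k)))"
  by (auto simp: visited_def small_def draws_def Let_def split_beta)

abbreviation n_large :: "(nat \<Rightarrow> 'e) \<Rightarrow> nat \<Rightarrow> nat" where
  "n_large w k \<equiv> card {j. j < k \<and> \<not> small (snd (run w j))}"
abbreviation n_small :: "(nat \<Rightarrow> 'e) \<Rightarrow> nat \<Rightarrow> nat" where
  "n_small w k \<equiv> card {j. j < k \<and> small (snd (run w j))}"
abbreviation n_success :: "(nat \<Rightarrow> 'e) \<Rightarrow> nat \<Rightarrow> nat" where
  "n_success w k \<equiv> card {j. j < k \<and> small (snd (run w j)) \<and> \<not> fails (snd (run w j)) (w j)}"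

lemma run_counter:
  assumes "\<forall>j<k. visited (run w j)"
  shows "fst (run w k) = n_large w k + N * n_small w k"
  using assms
proof (induction k)
  case (Suc k)
  then show ?case
    using run_Suc(2,3)[of w k] by (auto simp: card_less_Suc_filter draws_def simp del: prgd.simps(2))
qed simp

lemma run_counter_ge:
  assumes "\<forall>j<k. visited (run w j)"
  shows "k \<le> fst (run w k)"
proof -
  have "k = n_large w k + n_small w k"
    by (induction k) (auto simp: card_less_Suc_filter)
  also have "\<dots> \<le> fst (run w k)"
    unfolding run_counter[OF assms] using N_pos by (intro add_mono) auto
  finally show ?thesis .
qed

lemma run_frozen:
  assumes "\<not> visited (run w k)" "k \<le> j"
  shows "run w j = run w k"
  using assms(2)
proof (induction j rule: dec_induct)
  case (step j)
  then show ?case using assms(1) run_Suc(1)[of w j] by (simp only:) simp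
qed simp

text \<open>Each executed pass raises the counter by at least 1, so it exceeds \<open>T\<close>
  eventually. The last executed pass starts at a counter of at most \<open>T\<close> and adds at
  most \<open>N\<close>.\<close>

lemma run_terminates:
  obtains K where "\<forall>k<K. visited (run w k)" "\<not> visited (run w K)" "real (fst (run w K)) \<le> T + real N"
    "\<And>k. visited (run w k) \<longleftrightarrow> k < K"
proof -
  have "\<exists>k. \<not> visited (run w k)"
  proof (rule ccontr)
    assume "\<nexists>k. \<not> visited (run w k)"
    then have all: "visited (run w k)" for k by blast
    define k where "k = Suc (nat \<lceil>T\<rceil>)"
    have "real k \<le> real (fst (run w k))" using run_counter_ge[of k w] all by (simp del: prgd.simps)
    also have "\<dots> \<le> T" using all[of k] by (simp only: visited_def)
    finally have "real k \<le> T" .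
    moreover have "T < real k" unfolding k_def by linarith
    ultimately show False by simp
  qed
  then obtain K where K: "\<not> visited (run w K)" "\<forall>k<K. visited (run w k)"
    using exists_least_iff[of "\<lambda>k. \<not> visited (run w k)"] by auto
  have "visited (run w 0)" using T_pos by (simp add: visited_def)
  then have "K \<noteq> 0" using K(1) by metis
  then obtain k where k: "K = Suc k" by (cases K) auto
  then have v: "visited (run w k)" using K(2) by simp
  have "fst (run w K) \<le> fst (run w k) + N"
    unfolding k using run_Suc(2,3)[of w k] v N_pos by (cases "small (snd (run w k))") (auto simp: draws_def simp del: prgd.simps)
  then have "real (fst (run w K)) \<le> real (fst (run w k)) + real N" by (simp only: of_nat_add[symmetric] of_nat_le_iff)
  then have "real (fst (run w K)) \<le> T + real N" using v by (simp add: visited_def del: prgd.simps)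
  moreover have "visited (run w k) \<longleftrightarrow> k < K" for k
    using K run_frozen[OF K(1), of k] by (cases "k < K") (auto simp del: prgd.simps)
  ultimately show thesis using that K by blast
qed

text \<open>Every perturbed round is charged the possible cost of its perturbation, and it is
  credited \<open>F\<close> unless it fails. Rounds at points that are not saddles are treated
  alike.\<close>

lemma run_descent:
  assumes adm: "admissible w" and "\<forall>j<k. visited (run w j)"
  shows "f (snd (run w k)) \<le> f x\<^sub>0 - \<eta> * \<epsilon>\<^sup>2 / 2 * n_large w k
    + 27 / 200 * F * n_small w k
    - F * n_success w k"
  using assms(2)
proof (induction k)
  case (Suc k)
  let ?x = "snd (run w k)"
  have IH: "f ?x \<le> f x\<^sub>0 - \<eta> * \<epsilon>\<^sup>2 / 2 * n_large w k
    + 27 / 200 * F * n_small w k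
    - F * n_success w k"
    using Suc by simp
  have v: "visited (run w k)" using Suc.prems by simp
  show ?case
  proof (cases "small ?x")
    case True
    then have d: "draws (run w k)" using v by (simp add: draws_def)
    then have ball: "w k \<in> tball g r ?x" using adm by (simp add: admissible_draws_def del: prgd.simps)
    have x': "snd (run w (Suc k)) = perturbed_step ?x (w k)"
      using run_Suc(2)[OF d] by (simp del: prgd.simps)
    show ?thesis
    proof (cases "fails ?x (w k)")
      case f: True
      have "f (snd (run w (Suc k))) \<le> f ?x + 27 / 200 * F"
        unfolding x' by (rule perturbed_round(1)) (use True ball in \<open>auto simp: small_def\<close>)
      then show ?thesis using IH True f by (simp add: card_less_Suc_filter algebra_simps del: prgd.simps)
    next
      case f: False
      have "f (snd (run w (Suc k))) \<le> f ?x + 27 / 200 * F - F"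
        unfolding x' by (rule perturbed_round(2)) (use True ball f in \<open>auto simp: small_def\<close>)
      then show ?thesis using IH True f by (simp add: card_less_Suc_filter algebra_simps del: prgd.simps)
    qed
  next
    case False
    have "f (snd (run w (Suc k))) \<le> f ?x - \<eta> * \<epsilon>\<^sup>2 / 2"
      unfolding run_Suc(3)[OF v False] snd_conv
      by (rule large_gradient_step) (use False in \<open>auto simp: small_def\<close>)
    then show ?thesis using IH False by (simp add: card_less_Suc_filter algebra_simps del: prgd.simps)
  qed
qed simp

lemma visited_counts:
  assumes "\<And>k. visited (run w k) \<longleftrightarrow> k < K"
  shows "{k. visited (run w k) \<and> p (snd (run w k))} = {k. k < K \<and> p (snd (run w k))}"
  using assms by auto

text \<open>With at most one perturbed round, which takes \<open>N \<le> 3 / 8 * T\<close>, more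
  than \<open>5 / 8 * T\<close> large gradient steps remain. They would decrease \<open>f\<close> by
  more than \<open>5 / 2 * \<Delta>\<close>, but only \<Delta> plus 27/200 of
  \<open>F \<le> 4 * \<Delta>\<close> is available.\<close>

lemma at_least_two_small:
  assumes adm: "admissible w"
  shows "2 \<le> card {k. visited (run w k) \<and> small (snd (run w k))}"
proof -
  obtain K where K: "\<forall>k<K. visited (run w k)" "\<not> visited (run w K)" "\<And>k. visited (run w k) \<longleftrightarrow> k < K"
    using run_terminates[of w] by metis
  define nL where "nL = real (n_large w K)"
  define nS where "nS = n_small w K"
  define \<Delta> where "\<Delta> = f x\<^sub>0 - fstar"
  define a where "a = \<eta> * \<epsilon>\<^sup>2"
  have a: "0 < a" using \<eta>_pos \<epsilon>_pos by (simp add: a_def)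
  have \<Delta>: "0 < \<Delta>" using less_le_trans[OF mult_pos_pos[OF \<epsilon>_pos \<Lambda>_pos] \<epsilon>\<Lambda>_le] by (simp add: \<Delta>_def)
  have "0 \<le> F * n_success w K" using F_pos by simp
  then have d: "a / 2 * nL \<le> \<Delta> + 27 / 200 * F * nS"
    using run_descent[OF adm K(1)] lower[of "snd (run w K)"] by (simp add: nL_def nS_def \<Delta>_def a_def)
  have c: "T < nL + N * nS"
    using K(2) run_counter[OF K(1)] by (simp add: visited_def nL_def nS_def)
  have "2 \<le> nS"
  proof (rule ccontr)
    assume "\<not> 2 \<le> nS"
    then have nS: "real nS \<le> 1" by simp
    have "N * real nS \<le> real N * 1" using nS by (intro mult_left_mono) auto
    then have "5 / 8 * T < nL" using c T_ge(1) by simp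
    moreover have "8 * \<Delta> / a \<le> T" using T_ge(3) by (simp add: a_def \<Delta>_def)
    ultimately have "5 * \<Delta> / a < nL" by simp
    then have "5 * \<Delta> < a * nL" using a by (simp add: field_simps)
    moreover have "27 / 200 * F * nS \<le> 27 / 200 * F * 1" using nS F_pos by (intro mult_left_mono) auto
    moreover have "F \<le> 4 * \<Delta>"
    proof -
      have "F = \<epsilon> * \<Lambda> * (1 / (50 * chi ^ 3))" by (simp add: F_eq)
      also have "\<dots> \<le> 3 * \<Delta> * (64 / 50)"
      proof (rule mult_mono)
        show "1 / (50 * chi ^ 3) \<le> 64 / 50" using chi_cube chi_pos by (simp add: field_simps)
      qed (use \<epsilon>\<Lambda>_le \<Delta> chi_pos in \<open>auto simp: \<Delta>_def\<close>)
      finally show ?thesis using \<Delta> by simp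
    qed
    ultimately show False using d \<Delta> by simp
  qed
  then show ?thesis by (simp add: nS_def visited_counts[OF K(3)])
qed

text \<open>If more than a third of the perturbed rounds were at saddles, the gain \<open>F\<close>
  of each would have to pay the perturbation cost of at most three rounds, and 1 - 3 * 27/200 =
  119/200 of it would remain. The lower bound on \<open>f\<close> then limits the large gradient
  steps to \<open>T / 4\<close> and the queries in perturbed rounds to \<open>600 / 952 * T\<close>,
  together less than \<open>T\<close>.\<close>

lemma two_thirds_good:
  assumes adm: "admissible w"
    and succ: "\<And>k. draws (run w k) \<Longrightarrow> \<not> good (snd (run w k)) \<Longrightarrow> \<not> fails (snd (run w k)) (w k)"
  shows "2 / 3 * real (card {k. visited (run w k) \<and> small (snd (run w k))})
    \<le> real (card {k. visited (run w k) \<and> good (snd (run w k))})"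
proof -
  obtain K where K: "\<forall>k<K. visited (run w k)" "\<not> visited (run w K)" "\<And>k. visited (run w k) \<longleftrightarrow> k < K"
    using run_terminates[of w] by metis
  define nL where "nL = real (n_large w K)"
  define nS where "nS = real (n_small w K)"
  define nG where "nG = real (card {j. j < K \<and> good (snd (run w j))})"
  define nB where "nB = real (card {j. j < K \<and> small (snd (run w j)) \<and> \<not> good (snd (run w j))})"
  define \<Delta> where "\<Delta> = f x\<^sub>0 - fstar"
  define a where "a = \<eta> * \<epsilon>\<^sup>2"
  have a: "0 < a" using \<eta>_pos \<epsilon>_pos by (simp add: a_def)
  have nS: "nS = nG + nB"
  proof -
    let ?G = "{j. j < K \<and> good (snd (run w j))}"
    let ?B = "{j. j < K \<and> small (snd (run w j)) \<and> \<not> good (snd (run w j))}"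
    have "n_small w K = card (?G \<union> ?B)"
      by (rule arg_cong[of _ _ card]) (auto simp: good_def)
    also have "\<dots> = card ?G + card ?B" by (rule card_Un_disjoint) auto
    finally have "n_small w K = card ?G + card ?B" .
    then show ?thesis by (simp add: nS_def nG_def nB_def)
  qed
  have "card {j. j < K \<and> small (snd (run w j)) \<and> \<not> good (snd (run w j))} \<le>
      n_success w K"
    by (rule card_mono) (use succ K(1) in \<open>auto simp: draws_def\<close>)
  then have "F * nB \<le> F * n_success w K"
    using F_pos unfolding nB_def by (intro mult_left_mono) auto
  then have d: "a / 2 * nL + F * nB \<le> \<Delta> + 27 / 200 * F * nS"
    using run_descent[OF adm K(1)] lower[of "snd (run w K)"] by (simp add: nL_def nS_def \<Delta>_def a_def)
  have c: "T < nL + N * nS"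
    using K(2) run_counter[OF K(1)] by (simp add: visited_def nL_def nS_def)
  have "2 * nS \<le> 3 * nG"
  proof (rule ccontr)
    assume "\<not> ?thesis"
    then have lt: "nS \<le> 3 * nB" using nS by simp
    have "0 \<le> nB" "0 \<le> nL" by (simp_all add: nB_def nL_def)
    have "F * nS \<le> F * (3 * nB)" using lt F_pos by (intro mult_left_mono) auto
    then have d': "a / 2 * nL + 119 / 200 * (F * nB) \<le> \<Delta>" using d by simp
    have "0 \<le> F * nB" "0 \<le> a / 2 * nL" using F_pos a \<open>0 \<le> nB\<close> \<open>0 \<le> nL\<close> by auto
    then have 1: "a * nL \<le> 2 * \<Delta>" and 2: "F * nB \<le> 200 / 119 * \<Delta>" using d' by linarith+
    have "nL \<le> 2 * \<Delta> / a" using 1 a by (simp add: field_simps)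
    moreover have "8 * \<Delta> / a \<le> T" using T_ge(3) by (simp add: a_def \<Delta>_def)
    ultimately have nL: "nL \<le> T / 4" by simp
    have "nB \<le> 200 / 119 * \<Delta> / F" using 2 F_pos by (simp add: field_simps)
    then have "N * nS \<le> N * (3 * (200 / 119 * \<Delta> / F))" using lt by (intro mult_left_mono) auto
    also have "\<dots> = 600 / 952 * (8 * \<Delta> * N / F)" by simp
    also have "\<dots> \<le> 600 / 952 * T" using T_ge(2) unfolding \<Delta>_def by (intro mult_left_mono) auto
    finally show False using c nL T_pos by simp
  qed
  then show ?thesis
    unfolding visited_counts[OF K(3)] by (simp add: nS_def nG_def)
qed

text \<open>At the last drawing pass \<open>m\<close> the counter is at most \<open>T\<close>, and
  each earlier draw has added \<open>N\<close> to it. The summand 1 is for \<open>m\<close> itself,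
  whose round may go beyond \<open>T\<close>.\<close>

lemma number_of_draws: "real (card {k. k < n \<and> draws (run w k)}) \<le> T / N + 1"
proof -
  obtain K where K: "\<forall>k<K. visited (run w k)" "\<And>k. visited (run w k) \<longleftrightarrow> k < K"
    using run_terminates[of w] by metis
  define D where "D = {k. k < n \<and> draws (run w k)}"
  show ?thesis
  proof (cases "D = {}")
    case True
    then have "real (card {k. k < n \<and> draws (run w k)}) = 0" unfolding D_def by (simp only: card.empty of_nat_0)
    also have "\<dots> \<le> T / N + 1" using T_pos by simp
    finally show ?thesis .
  next
    case False
    have fin: "finite D" by (simp add: D_def)
    define m where "m = Max D"
    have m: "m \<in> D" using False fin by (simp add: m_def)
    then have vm: "visited (run w m)" "m < K" using K(2) by (auto simp: D_def draws_def)
    have "D \<subseteq> insert m {j. j < m \<and> small (snd (run w j))}"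
    proof
      fix k assume k: "k \<in> D"
      then have "k \<le> m" using fin by (simp add: m_def)
      then show "k \<in> insert m {j. j < m \<and> small (snd (run w j))}" using k by (auto simp: D_def draws_def)
    qed
    then have "card D \<le> card (insert m {j. j < m \<and> small (snd (run w j))})" by (rule card_mono[rotated]) simp
    also have "\<dots> \<le> Suc (n_small w m)" by (rule card_insert_le_m1) auto
    finally have 1: "real (card D) - 1 \<le> real (n_small w m)" by simp
    have "N * n_small w m \<le> fst (run w m)"
      using run_counter[of m w] K(1) vm(2) by simp
    then have "real N * real (n_small w m) \<le> T"
    proof -
      have "real N * real (n_small w m) \<le> real (fst (run w m))"
        using \<open>N * n_small w m \<le> fst (run w m)\<close>
        by (simp only: of_nat_mult[symmetric] of_nat_le_iff)
      also have "\<dots> \<le> T" using vm(1) by (simp only: visited_def)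
      finally show ?thesis .
    qed
    then have "real (n_small w m) \<le> T / N"
      using N_pos by (simp add: pos_le_divide_eq mult.commute)
    then show ?thesis using 1 by (simp add: D_def)
  qed
qed

end

section \<open>Measurability of the run\<close>

context prgd_run
begin

text \<open>Unlike the choice in \<open>tangent_loop\<close>, the root of the quadratic equation that determines the
  step factor of an exit step is visibly measurable.\<close>

definition exit_root :: "'m \<Rightarrow> 'e \<Rightarrow> real" where
  "exit_root x s = (let p = \<eta>\<^sup>2 * g x (pg x s) (pg x s); q = - \<eta> * g x s (pg x s);
     c = (real_of_ereal b)\<^sup>2 - g x s s in (sqrt (q\<^sup>2 + p * c) - q) / p)"

primrec mloop :: "'m \<Rightarrow> nat \<Rightarrow> 'e \<Rightarrow> 'e" where
  "mloop x 0 s = s"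
| "mloop x (Suc n) s = (if b \<le> ereal (tnorm g x (s - \<eta> *\<^sub>R pg x s))
     then s - (exit_root x s * \<eta>) *\<^sub>R pg x s else mloop x n (s - \<eta> *\<^sub>R pg x s))"

text \<open>Reaching the sphere is a quadratic equation for the factor. Its only positive root is
  the explicit one, so \<open>SOME\<close> has no freedom.\<close>

lemma exit_root_eq:
  assumes s: "ereal (tnorm g x s) < b" and s': "b \<le> ereal (tnorm g x (s - \<eta> *\<^sub>R pg x s))"
  shows "(SOME \<alpha>. 0 < \<alpha> \<and> \<alpha> \<le> 1 \<and> ereal (tnorm g x (s - (\<alpha> * \<eta>) *\<^sub>R pg x s)) = b) = exit_root x s"
proof -
  interpret gd_space_hess "g x" "pb x" "pg x" l \<eta> b "ph x" \<rho> by (rule gd)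
  define \<alpha> where "\<alpha> = exit_factor s"
  define G where "G = pg x s"
  define p where "p = \<eta>\<^sup>2 * g x G G"
  define q where "q = - \<eta> * g x s G"
  define c where "c = (real_of_ereal b)\<^sup>2 - g x s s"
  have \<alpha>: "0 < \<alpha>" "ereal (nrm (s - (\<alpha> * \<eta>) *\<^sub>R G)) = b"
    using exit_factor[of s] s s' unfolding \<alpha>_def G_def by (auto simp: tnorm_eq_ipnorm step_def)
  then have B: "real_of_ereal b = nrm (s - (\<alpha> * \<eta>) *\<^sub>R G)" by (metis real_of_ereal.simps(1))
  have "nrm s < real_of_ereal b" using s \<alpha>(2) B by (metis ereal_less_eq(3) not_less tnorm_eq_ipnorm)
  then have "(nrm s)\<^sup>2 < (real_of_ereal b)\<^sup>2" by (intro power_strict_mono) auto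
  then have c: "0 < c" by (simp add: c_def nrm_sq)
  have G: "G \<noteq> 0" using s \<alpha>(2) by (auto simp: tnorm_eq_ipnorm)
  then have p: "0 < p" using \<eta>_pos pos[OF G] by (simp add: p_def)
  have "(real_of_ereal b)\<^sup>2 = g x s s + 2 * \<alpha> * q + \<alpha>\<^sup>2 * p"
    unfolding B nrm_sq by (simp add: ip_simps sym[of G s] p_def q_def power2_eq_square algebra_simps)
  then have eq: "c = \<alpha> * (2 * q + \<alpha> * p)" by (simp add: c_def power2_eq_square algebra_simps)
  \<comment> \<open>Fixes the sign of the square root: as \<open>c\<close> and \<alpha> are
    positive, \<alpha> is the larger root.\<close>
  have "0 \<le> \<alpha> * p + q"
  proof (cases "0 \<le> q")
    case True
    then show ?thesis using \<alpha>(1) p by simp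
  next
    case False
    have "0 < 2 * q + \<alpha> * p" using eq c \<alpha>(1) by (simp add: zero_less_mult_iff)
    then show ?thesis using False by simp
  qed
  moreover have "(\<alpha> * p + q)\<^sup>2 = q\<^sup>2 + p * c" by (simp add: eq power2_eq_square algebra_simps)
  ultimately have "sqrt (q\<^sup>2 + p * c) = \<alpha> * p + q" by (rule real_sqrt_unique[rotated])
  moreover have "exit_root x s = (sqrt (q\<^sup>2 + p * c) - q) / p"
    by (simp only: exit_root_def Let_def p_def q_def c_def G_def)
  ultimately have "exit_root x s = \<alpha>" using p by simp
  then show ?thesis by (simp add: \<alpha>_def exit_factor_def tnorm_eq_ipnorm)
qed

lemma mloop_eq: "ereal (tnorm g x s) < b \<Longrightarrow> tloop x n s = mloop x n s"
proof (induction n arbitrary: s)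
  case (Suc n)
  show ?case
  proof (cases "b \<le> ereal (tnorm g x (s - \<eta> *\<^sub>R pg x s))")
    case True
    then show ?thesis using exit_root_eq[OF Suc.prems True] by (simp add: Let_def)
  next
    case False
    then show ?thesis using Suc.IH[of "s - \<eta> *\<^sub>R pg x s"] by (simp add: Let_def)
  qed
qed simp

lemma measurable_mloop:
  assumes X [measurable]: "X \<in> borel_measurable M" and "S \<in> borel_measurable M"
  shows "(\<lambda>z. mloop (X z) n (S z)) \<in> borel_measurable M"
  using assms(2)
proof (induction n arbitrary: S)
  case (Suc n)
  note S [measurable] = Suc.prems
  have G [measurable]: "(\<lambda>z. pg (X z) (S z)) \<in> borel_measurable M" by (rule measurable_pg_compose[OF X S])
  define S' where "S' z = S z - \<eta> *\<^sub>R pg (X z) (S z)" for z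
  have S' [measurable]: "S' \<in> borel_measurable M" unfolding S'_def by measurable
  have [measurable]: "(\<lambda>z. tnorm g (X z) (S' z)) \<in> borel_measurable M" by (rule measurable_tnorm_compose[OF X S'])
  have [measurable]: "(\<lambda>z. g (X z) (pg (X z) (S z)) (pg (X z) (S z))) \<in> borel_measurable M"
    "(\<lambda>z. g (X z) (S z) (pg (X z) (S z))) \<in> borel_measurable M"
    "(\<lambda>z. g (X z) (S z) (S z)) \<in> borel_measurable M"
    by (rule measurable_metric_compose[OF X G G] measurable_metric_compose[OF X S G] measurable_metric_compose[OF X S S])+
  have [measurable]: "(\<lambda>z. exit_root (X z) (S z)) \<in> borel_measurable M"
    unfolding exit_root_def Let_def by measurable
  have [measurable]: "(\<lambda>z. mloop (X z) n (S' z)) \<in> borel_measurable M" by (rule Suc.IH[OF S'])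
  have "(\<lambda>z. if b \<le> ereal (tnorm g (X z) (S' z)) then S z - (exit_root (X z) (S z) * \<eta>) *\<^sub>R pg (X z) (S z)
      else mloop (X z) n (S' z)) \<in> borel_measurable M"
    by measurable
  then show ?case unfolding S'_def mloop.simps .
qed simp

text \<open>The run with \<open>mloop\<close> in place of \<open>tangent_loop\<close>: measurable in
  arbitrary draws, and equal to the run for admissible ones, which start every descent inside the
  ball of radius \<open>b\<close>.\<close>

primrec mrun :: "(nat \<Rightarrow> 'e) \<Rightarrow> nat \<Rightarrow> nat \<times> 'm" where
  "mrun w 0 = (0, x\<^sub>0)"
| "mrun w (Suc k) = (if visited (mrun w k) then
     if small (snd (mrun w k)) then (fst (mrun w k) + N, Retr (snd (mrun w k)) (mloop (snd (mrun w k)) N (\<eta> *\<^sub>R w k)))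
     else (fst (mrun w k) + 1, Retr (snd (mrun w k)) (mloop (snd (mrun w k)) 1 0))
     else mrun w k)"

lemma mrun_eq_run: "admissible w \<Longrightarrow> mrun w k = run w k"
proof (induction k)
  case (Suc k)
  let ?x = "snd (run w k)"
  have IH: "mrun w k = run w k" using Suc by blast
  show ?case
  proof (cases "visited (run w k)")
    case v: True
    show ?thesis
    proof (cases "small ?x")
      case True
      then have d: "draws (run w k)" using v by (simp add: draws_def)
      then have "w k \<in> tball g r ?x" using Suc.prems by (simp add: admissible_draws_def del: prgd.simps)
      then have "tloop ?x N (\<eta> *\<^sub>R w k) = mloop ?x N (\<eta> *\<^sub>R w k)" by (intro mloop_eq start_in_ball)
      then show ?thesis unfolding run_Suc(2)[OF d] mrun.simps IH using v True
        by (simp add: tangent_space_steps_def del: prgd.simps)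
    next
      case False
      have "tnorm g ?x 0 = 0" by (simp add: tnorm_eq_ipnorm posdef_form.nrm_zero[OF form])
      then have "tloop ?x 1 0 = mloop ?x 1 0" using b_pos by (intro mloop_eq) (simp add: zero_ereal_def)
      then show ?thesis unfolding run_Suc(3)[OF v False] mrun.simps IH using v False
        by (simp add: tangent_space_steps_def del: prgd.simps mloop.simps tangent_loop.simps)
    qed
  next
    case False
    then show ?thesis unfolding run_Suc(1)[OF False] mrun.simps IH by simp
  qed
qed simp

text \<open>The state before pass \<open>k\<close> is a function of the earlier draws only, so it
  may be computed from their restriction, the form in which \<open>fresh_uniform_draws\<close>
  conditions on them.\<close>

lemma mrun_cong: "(\<And>j. j < k \<Longrightarrow> w j = w' j) \<Longrightarrow> mrun w k = mrun w' k"
proof (induction k)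
  case (Suc k)
  then have "mrun w k = mrun w' k" "w k = w' k" by auto
  then show ?case by simp
qed simp

lemma measurable_small:
  assumes "X \<in> borel_measurable M"
  shows "Measurable.pred M (\<lambda>z. small (X z))"
proof -
  have [measurable]: "(\<lambda>z. tnorm g (X z) (pg (X z) 0)) \<in> borel_measurable M"
    using assms by (intro measurable_tnorm_compose measurable_pg_compose) auto
  show ?thesis unfolding small_def riem_grad_eq by measurable
qed

lemma measurable_good:
  assumes [measurable]: "X \<in> borel_measurable M"
  shows "Measurable.pred M (\<lambda>z. good (X z))"
proof -
  note [measurable] = measurable_small[OF assms]
  have "Measurable.pred M (\<lambda>z. X z \<in> {x. - \<kappa> \<le> lambda_min (ph x 0)})"
    using lambda_min_set[of "- \<kappa>"] by measurable
  then have [measurable]: "Measurable.pred M (\<lambda>z. - \<kappa> \<le> lambda_min (ph (X z) 0))" by simp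
  show ?thesis unfolding good_def by measurable
qed

lemma measurable_mrun:
  assumes W: "\<And>k. (\<lambda>z. W z k) \<in> borel_measurable M"
  shows "(\<lambda>z. fst (mrun (W z) k)) \<in> measurable M (count_space UNIV)"
    and "(\<lambda>z. snd (mrun (W z) k)) \<in> borel_measurable M"
proof -
  have "(\<lambda>z. fst (mrun (W z) k)) \<in> measurable M (count_space UNIV) \<and>
    (\<lambda>z. snd (mrun (W z) k)) \<in> borel_measurable M"
  proof (induction k)
    case (Suc k)
    define t where "t z = fst (mrun (W z) k)" for z
    define x where "x z = snd (mrun (W z) k)" for z
    have t [measurable]: "t \<in> measurable M (count_space UNIV)" and x [measurable]: "x \<in> borel_measurable M"
      using Suc by (simp_all add: t_def[abs_def] x_def[abs_def])
    note [measurable] = measurable_small[OF x] W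
    have m [measurable]: "(\<lambda>z. mloop (x z) N (\<eta> *\<^sub>R W z k)) \<in> borel_measurable M"
      "(\<lambda>z. mloop (x z) 1 0) \<in> borel_measurable M"
      by (intro measurable_mloop x; measurable)+
    note [measurable] = measurable_Retr_compose[OF x m(1)] measurable_Retr_compose[OF x m(2)]
    have "(\<lambda>z. fst (mrun (W z) (Suc k))) =
        (\<lambda>z. if real (t z) \<le> T then if small (x z) then t z + N else t z + 1 else t z)"
      by (auto simp: t_def x_def visited_def fun_eq_iff)
    moreover have "\<dots> \<in> measurable M (count_space UNIV)" by measurable
    moreover have "(\<lambda>z. snd (mrun (W z) (Suc k))) =
        (\<lambda>z. if real (t z) \<le> T then if small (x z) then Retr (x z) (mloop (x z) N (\<eta> *\<^sub>R W z k))
          else Retr (x z) (mloop (x z) 1 0) else x z)"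
      by (auto simp: t_def x_def visited_def fun_eq_iff)
    moreover have "\<dots> \<in> borel_measurable M" by measurable
    ultimately show ?case by simp
  qed auto
  then show "(\<lambda>z. fst (mrun (W z) k)) \<in> measurable M (count_space UNIV)"
    and "(\<lambda>z. snd (mrun (W z) k)) \<in> borel_measurable M" by auto
qed

lemma measurable_mrun_pred:
  assumes W: "\<And>k. (\<lambda>z. W z k) \<in> borel_measurable M"
  shows "Measurable.pred M (\<lambda>z. visited (mrun (W z) k))"
    and "Measurable.pred M (\<lambda>z. small (snd (mrun (W z) k)))"
    and "Measurable.pred M (\<lambda>z. good (snd (mrun (W z) k)))"
proof -
  note [measurable] = measurable_mrun[OF W]
  show "Measurable.pred M (\<lambda>z. visited (mrun (W z) k))" unfolding visited_def by measurable
qed (intro measurable_small measurable_good measurable_mrun W)+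

definition mfails :: "'m \<Rightarrow> 'e \<Rightarrow> bool" where
  "mfails x v \<longleftrightarrow> pb x (\<eta> *\<^sub>R v) - pb x (mloop x N (\<eta> *\<^sub>R v)) < F"

lemma mfails_eq: "v \<in> tball g r x \<Longrightarrow> mfails x v \<longleftrightarrow> fails x v"
  using mloop_eq[OF start_in_ball(2)] by (simp add: mfails_def fails_def)

lemma measurable_mfails:
  assumes X [measurable]: "X \<in> borel_measurable M" and V [measurable]: "V \<in> borel_measurable M"
  shows "Measurable.pred M (\<lambda>z. mfails (X z) (V z))"
proof -
  have pbm: "(\<lambda>z. pb (X z) (S z)) \<in> borel_measurable M" if "S \<in> borel_measurable M" for S
    using measurable_compose[OF measurable_Pair[OF X that] measurable_pb] by simp
  have "(\<lambda>z. \<eta> *\<^sub>R V z) \<in> borel_measurable M" by measurable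
  note [measurable] = pbm[OF this] pbm[OF measurable_mloop[OF X this]]
  show ?thesis unfolding mfails_def by measurable
qed

section \<open>The union bound\<close>

lemma uniform_fails:
  assumes "lambda_min (ph x 0) < - \<kappa>"
  shows "emeasure (uniform_tball g r x) {v. mfails x v} \<le> ennreal fail_prob"
proof -
  interpret gd_space_hess "g x" "pb x" "pg x" l \<eta> b "ph x" \<rho> by (rule gd)
  have ball: "tball g r x \<in> sets borel" by (simp add: tball_def tnorm_eq_ipnorm)
  have "Measurable.pred borel (\<lambda>v. mfails x v)"
    by (rule measurable_mfails) auto
  then have m: "{v. mfails x v} \<in> sets borel" by (simp add: pred_def)
  have eq: "tball g r x \<inter> {v. mfails x v} = {v \<in> tball g r x. fails x v}" using mfails_eq by blast
  have "{v \<in> tball g r x. fails x v} \<in> sets borel" unfolding eq[symmetric] using ball m by (rule sets.Int)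
  then show ?thesis
    using fails_probability[OF assms] ball m by (simp add: uniform_tball_def emeasure_uniform_measure eq)
qed

definition failure :: "(nat \<Rightarrow> 'e) \<Rightarrow> nat \<Rightarrow> bool" where
  "failure w k \<longleftrightarrow> draws (run w k) \<and> \<not> good (snd (run w k)) \<and> fails (snd (run w k)) (w k)"

lemma fail_prob_nonneg: "0 \<le> fail_prob"
  using l_pos \<kappa>_pos by (simp add: fail_prob_def)

text \<open>Bounds the number of passes uniformly in the draws, which makes the union over passes
  and the counts of iterates finite.\<close>

lemma visited_less:
  assumes "visited (run w k)" shows "k < Suc (nat \<lfloor>T\<rfloor>)"
proof -
  obtain K where "\<And>k. visited (run w k) \<longleftrightarrow> k < K" "\<forall>k<K. visited (run w k)"
    using run_terminates[of w] by metis
  then have "k \<le> fst (run w k)" using assms by (intro run_counter_ge) auto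
  then have "real k \<le> T" using assms by (simp add: visited_def del: prgd.simps)
  then show ?thesis by linarith
qed

context
  fixes P :: "'w measure" and \<xi> :: "'w \<Rightarrow> nat \<Rightarrow> 'e"
  assumes P: "prob_space P" and \<xi>: "fresh_uniform_draws P g r run draws \<xi>"
begin

lemma \<xi>_measurable: "(\<lambda>y. \<xi> y k) \<in> borel_measurable P"
  and \<xi>_admissible: "y \<in> space P \<Longrightarrow> admissible (\<xi> y)"
  using \<xi> unfolding fresh_uniform_draws_def by blast+

lemma failure_iff:
  assumes "y \<in> space P"
  shows "failure (\<xi> y) k \<longleftrightarrow> draws (mrun (\<xi> y) k) \<and> \<not> good (snd (mrun (\<xi> y) k)) \<and> mfails (snd (mrun (\<xi> y) k)) (\<xi> y k)"
proof (cases "draws (run (\<xi> y) k)")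
  case True
  then have "\<xi> y k \<in> tball g r (snd (run (\<xi> y) k))"
    using \<xi>_admissible[OF assms] by (simp add: admissible_draws_def)
  then show ?thesis by (simp add: failure_def mrun_eq_run[OF \<xi>_admissible[OF assms]] mfails_eq)
qed (simp add: failure_def mrun_eq_run[OF \<xi>_admissible[OF assms]])

abbreviation Fail :: "nat \<Rightarrow> 'w set" where "Fail k \<equiv> {y \<in> space P. failure (\<xi> y) k}"
abbreviation drawn :: "nat \<Rightarrow> 'w \<Rightarrow> ennreal" where
  "drawn k y \<equiv> indicator {y. draws (run (\<xi> y) k)} y"

lemma failure_sets: "Fail k \<in> sets P"
proof -
  note [measurable] = measurable_mrun_pred[of \<xi> P, OF \<xi>_measurable]
    measurable_mfails[OF measurable_mrun(2)[of \<xi> P, OF \<xi>_measurable] \<xi>_measurable]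
  have "{y \<in> space P. visited (mrun (\<xi> y) k) \<and> small (snd (mrun (\<xi> y) k)) \<and>
      \<not> good (snd (mrun (\<xi> y) k)) \<and> mfails (snd (mrun (\<xi> y) k)) (\<xi> y k)} \<in> sets P"
    by measurable
  then show ?thesis
    by (rule back_subst[of "\<lambda>S. S \<in> sets P"]) (auto simp: failure_iff draws_def)
qed

text \<open>The indicator of a draw is kept under the integral. Summed over the passes it counts the
  draws, of which there are at most \<open>T / N + 1\<close>, whereas bounding each pass by
  \<open>fail_prob\<close> would count all passes.\<close>

lemma emeasure_failure:
  "emeasure P (Fail k) \<le>
    (\<integral>\<^sup>+y. ennreal fail_prob * drawn k y \<partial>P)"
proof -
  let ?Q = "PiM {..<k} (\<lambda>_. borel :: 'e measure) \<Otimes>\<^sub>M (borel :: 'e measure)"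
  define C where "C = {z \<in> space ?Q. \<not> good (snd (mrun (fst z) k)) \<and> mfails (snd (mrun (fst z) k)) (snd z)}"
  \<comment> \<open>\<open>measurable_mrun\<close> asks for all coordinates of the draws; those from
    \<open>k\<close> on are constantly \<open>undefined\<close> on the product space.\<close>
  have comp: "(\<lambda>z. fst z j) \<in> borel_measurable ?Q" for j
  proof (cases "j < k")
    case False
    then have "fst z j = undefined" if "z \<in> space ?Q" for z
      using that by (auto simp: space_pair_measure space_PiM PiE_def extensional_def)
    then show ?thesis by (subst measurable_cong[of _ _ "\<lambda>_. undefined"]) auto
  qed measurable
  note [measurable] = measurable_mrun_pred[of fst ?Q, OF comp]
    measurable_mfails[OF measurable_mrun(2)[of fst ?Q, OF comp] measurable_snd]
  have C: "C \<in> sets ?Q" unfolding C_def by measurable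
  have res: "mrun (restrict (\<xi> y) {..<k}) k = mrun (\<xi> y) k" for y by (rule mrun_cong) simp
  have "Fail k =
      {y \<in> space P. draws (run (\<xi> y) k) \<and> (restrict (\<xi> y) {..<k}, \<xi> y k) \<in> C}"
    by (auto simp: failure_iff C_def res mrun_eq_run[OF \<xi>_admissible] space_pair_measure space_PiM simp del: prgd.simps)
  then have "emeasure P (Fail k) =
      (\<integral>\<^sup>+y. drawn k y *
         emeasure (uniform_tball g r (snd (run (\<xi> y) k))) {v. (restrict (\<xi> y) {..<k}, v) \<in> C} \<partial>P)"
    using \<xi> C unfolding fresh_uniform_draws_def by simp
  also have "\<dots> \<le> (\<integral>\<^sup>+y. ennreal fail_prob * drawn k y \<partial>P)"
  proof (rule nn_integral_mono)
    fix y assume y: "y \<in> space P"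
    let ?x = "snd (run (\<xi> y) k)"
    show "drawn k y *
         emeasure (uniform_tball g r ?x) {v. (restrict (\<xi> y) {..<k}, v) \<in> C}
        \<le> ennreal fail_prob * drawn k y"
    proof (cases "draws (run (\<xi> y) k)")
      case True
      have "{v. (restrict (\<xi> y) {..<k}, v) \<in> C} = (if good ?x then {} else {v. mfails ?x v})"
        by (auto simp: C_def res mrun_eq_run[OF \<xi>_admissible[OF y]] space_pair_measure space_PiM simp del: prgd.simps)
      moreover have "emeasure (uniform_tball g r ?x) {v. mfails ?x v} \<le> ennreal fail_prob" if "\<not> good ?x"
        using that True by (intro uniform_fails) (auto simp: good_def draws_def)
      ultimately show ?thesis using True by simp
    qed simp
  qed
  finally show ?thesis .
qed

lemma draws_sets: "{y \<in> space P. draws (run (\<xi> y) k)} \<in> sets P"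
proof -
  note [measurable] = measurable_mrun_pred[of \<xi> P, OF \<xi>_measurable]
  have "{y \<in> space P. visited (mrun (\<xi> y) k) \<and> small (snd (mrun (\<xi> y) k))} \<in> sets P" by measurable
  then show ?thesis
    by (rule back_subst[of "\<lambda>S. S \<in> sets P"]) (auto simp: draws_def mrun_eq_run[OF \<xi>_admissible])
qed

lemma emeasure_any_failure:
  "emeasure P (\<Union>k<n. Fail k) \<le> ennreal (fail_prob * (T / N + 1))"
proof -
  have "emeasure P (\<Union>k<n. Fail k) \<le> (\<Sum>k<n. emeasure P (Fail k))"
    by (rule emeasure_subadditive_finite) (use failure_sets in auto)
  also have "\<dots> \<le> (\<Sum>k<n. \<integral>\<^sup>+y. ennreal fail_prob * drawn k y \<partial>P)"
    by (intro sum_mono emeasure_failure)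
  also have "\<dots> = (\<Sum>k<n. \<integral>\<^sup>+y. ennreal fail_prob * indicator {y \<in> space P. draws (run (\<xi> y) k)} y \<partial>P)"
    by (intro sum.cong refl nn_integral_cong) (auto simp: indicator_def)
  also have "\<dots> = (\<integral>\<^sup>+y. (\<Sum>k<n. ennreal fail_prob * indicator {y \<in> space P. draws (run (\<xi> y) k)} y) \<partial>P)"
    using draws_sets by (intro nn_integral_sum[symmetric]) auto
  also have "\<dots> \<le> (\<integral>\<^sup>+y. ennreal (fail_prob * (T / N + 1)) \<partial>P)"
  proof (rule nn_integral_mono)
    fix y assume y: "y \<in> space P"
    have "(\<Sum>k<n. ennreal fail_prob * indicator {y \<in> space P. draws (run (\<xi> y) k)} y)
        = ennreal fail_prob * (\<Sum>k<n. ennreal (if draws (run (\<xi> y) k) then 1 else 0))"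
      unfolding sum_distrib_left using y by (intro sum.cong) (auto simp: indicator_def)
    also have "(\<Sum>k<n. ennreal (if draws (run (\<xi> y) k) then 1 else 0))
        = ennreal (\<Sum>k<n. if draws (run (\<xi> y) k) then 1 else 0)"
      by (rule sum_ennreal) auto
    also have "(\<Sum>k<n. if draws (run (\<xi> y) k) then 1 else 0 :: real) = real (card {k. k < n \<and> draws (run (\<xi> y) k)})"
      by (simp add: sum.If_cases Int_def del: prgd.simps)
    also have "ennreal fail_prob * ennreal (real (card {k. k < n \<and> draws (run (\<xi> y) k)})) \<le> ennreal fail_prob * ennreal (T / N + 1)"
      by (intro mult_left_mono ennreal_leI number_of_draws) auto
    also have "\<dots> = ennreal (fail_prob * (T / N + 1))" using fail_prob_nonneg by (rule ennreal_mult'[symmetric])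
    finally show "(\<Sum>k<n. ennreal fail_prob * indicator {y \<in> space P. draws (run (\<xi> y) k)} y)
        \<le> ennreal (fail_prob * (T / N + 1))" .
  qed
  also have "\<dots> = ennreal (fail_prob * (T / N + 1))"
    using P by (simp add: prob_space.emeasure_space_1)
  finally show ?thesis .
qed

lemma probability_two_thirds_good:
  "1 - fail_prob * (T / N + 1) \<le> measure P {y \<in> space P.
     2 / 3 * real (card {k. visited (run (\<xi> y) k) \<and> small (snd (run (\<xi> y) k))})
       \<le> real (card {k. visited (run (\<xi> y) k) \<and> good (snd (run (\<xi> y) k))})}" (is "_ \<le> measure P ?S")
proof -
  interpret prob_space P by (rule P)
  define n where "n = Suc (nat \<lfloor>T\<rfloor>)"
  define B where "B = (\<Union>k<n. Fail k)"
  have B: "B \<in> events" unfolding B_def using failure_sets by auto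
  \<comment> \<open>As finite sums over passes the two counts are visibly measurable.\<close>
  have card_eq: "real (card {k. visited (run w k) \<and> p (snd (run w k))}) =
      (\<Sum>k<n. if visited (run w k) \<and> p (snd (run w k)) then 1 else 0)" for w p
  proof -
    have "{k. visited (run w k) \<and> p (snd (run w k))} = {k. k < n \<and> visited (run w k) \<and> p (snd (run w k))}"
      using visited_less by (auto simp: n_def simp del: prgd.simps)
    then show ?thesis by (simp add: sum.If_cases Int_def del: prgd.simps)
  qed
  note [measurable] = measurable_mrun_pred[of \<xi> P, OF \<xi>_measurable]
  have "{y \<in> space P. 2 / 3 * (\<Sum>k<n. if visited (mrun (\<xi> y) k) \<and> small (snd (mrun (\<xi> y) k)) then 1 else 0)
      \<le> (\<Sum>k<n. if visited (mrun (\<xi> y) k) \<and> good (snd (mrun (\<xi> y) k)) then 1 else 0 :: real)} \<in> events"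
    by measurable
  then have S: "?S \<in> events"
    by (rule back_subst[of "\<lambda>S. S \<in> events"]) (auto simp: card_eq mrun_eq_run[OF \<xi>_admissible] simp del: prgd.simps)
  have "space P - B \<subseteq> ?S"
  proof
    fix y assume y: "y \<in> space P - B"
    have "2 / 3 * real (card {k. visited (run (\<xi> y) k) \<and> small (snd (run (\<xi> y) k))})
       \<le> real (card {k. visited (run (\<xi> y) k) \<and> good (snd (run (\<xi> y) k))})"
    proof (rule two_thirds_good)
      show "admissible (\<xi> y)" using y \<xi>_admissible by blast
      fix k assume k: "draws (run (\<xi> y) k)" "\<not> good (snd (run (\<xi> y) k))"
      then have "k < n" using visited_less[of "\<xi> y" k] by (simp add: n_def draws_def)
      then show "\<not> fails (snd (run (\<xi> y) k)) (\<xi> y k)" using y k by (auto simp: B_def failure_def)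
    qed
    then show "y \<in> ?S" using y by blast
  qed
  then have "prob (space P - B) \<le> prob ?S" by (rule finite_measure_mono[OF _ S])
  moreover have "prob (space P - B) = 1 - prob B" using B by (rule prob_compl)
  moreover have "prob B \<le> fail_prob * (T / N + 1)"
  proof -
    have "ennreal (prob B) \<le> ennreal (fail_prob * (T / N + 1))"
      using emeasure_any_failure[of n] unfolding B_def[symmetric] emeasure_eq_measure .
    moreover have "0 \<le> fail_prob * (T / N + 1)" using fail_prob_nonneg T_pos by simp
    ultimately show ?thesis by (simp only: ennreal_le_iff)
  qed
  ultimately show ?thesis by linarith
qed

end

end

section \<open>The parameters\<close>

lemma Max_three: "Max {a, b, c :: real} = max a (max b c)"
  by simp

context
  fixes \<kappa> \<Lambda> \<epsilon> \<rho> l :: real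
  assumes \<kappa>: "0 < \<kappa>" and \<Lambda>: "0 < \<Lambda>" and \<epsilon>: "\<epsilon> = \<kappa> * \<Lambda>" and \<rho>: "\<rho> = \<kappa> / \<Lambda>" and l: "\<kappa> \<le> l"
begin

lemma sqrt_parameters: "sqrt (\<rho> * \<epsilon>) = \<kappa>" "sqrt (\<epsilon> ^ 3 / \<rho>) = \<epsilon> * \<Lambda>" "sqrt \<rho> * \<epsilon> powr (5/2) = \<kappa> * \<epsilon>\<^sup>2"
proof -
  have pos: "0 < \<epsilon>" "0 < \<rho>" using \<kappa> \<Lambda> by (auto simp: \<epsilon> \<rho>)
  have "\<rho> * \<epsilon> = \<kappa>\<^sup>2" using \<Lambda> by (simp add: \<epsilon> \<rho> power2_eq_square)
  then show 1: "sqrt (\<rho> * \<epsilon>) = \<kappa>" using \<kappa> by simp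
  have "\<epsilon> ^ 3 / \<rho> = (\<epsilon> * \<Lambda>)\<^sup>2" using \<kappa> \<Lambda> by (simp add: \<epsilon> \<rho> power2_eq_square power3_eq_cube)
  then show "sqrt (\<epsilon> ^ 3 / \<rho>) = \<epsilon> * \<Lambda>" using pos \<Lambda> by simp
  have "\<epsilon> powr (5/2) = \<epsilon> powr (1/2 + 2)" by simp
  also have "\<dots> = sqrt \<epsilon> * \<epsilon>\<^sup>2" using pos by (simp only: powr_add powr_half_sqrt less_imp_le powr_numeral)
  finally show "sqrt \<rho> * \<epsilon> powr (5/2) = \<kappa> * \<epsilon>\<^sup>2" using 1 by (simp add: real_sqrt_mult)
qed

lemma round_length_eq: "round_length l \<rho> \<epsilon> chi = l * chi / \<kappa>"
  and round_decrease_eq: "round_decrease \<rho> \<epsilon> chi = \<epsilon> * \<Lambda> / (50 * chi ^ 3)"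
  by (simp_all add: round_length_def round_decrease_def sqrt_parameters)

lemma horizon_eq:
  assumes "0 < chi"
  shows "horizon l \<Delta> \<rho> \<epsilon> chi = 8 * max (l * chi / (3 * \<kappa>)) (max (50 * chi ^ 4 * (l * \<Delta> / \<epsilon>\<^sup>2)) (l * \<Delta> / \<epsilon>\<^sup>2))"
proof -
  have "\<Delta> * (l * chi / \<kappa>) / (\<epsilon> * \<Lambda> / (50 * chi ^ 3)) = 50 * chi ^ 4 * (l * \<Delta> / \<epsilon>\<^sup>2)"
    using \<kappa> \<Lambda> assms by (simp add: \<epsilon> power2_eq_square eval_nat_numeral mult_ac)
  then show ?thesis
    unfolding horizon_def round_length_eq round_decrease_eq Max_three by (simp add: mult.commute)
qed

text \<open>\<open>chi > 1 / 4\<close> gives \<open>1 \<le> 256 * chi ^ 4\<close>, and the lower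
  bound on \<Delta> brings the first of the three terms into the same form. The factor 2048 is 8 *
  256.\<close>

lemma horizon_le:
  assumes \<Delta>: "\<epsilon> * \<Lambda> \<le> 3 * \<Delta>" and chi: "1 / 4 < chi"
  shows "horizon l \<Delta> \<rho> \<epsilon> chi \<le> 2048 * (l * \<Delta> / \<epsilon>\<^sup>2) * chi ^ 4"
proof -
  have pos: "0 < \<epsilon>" "0 < l" "0 < chi" using \<kappa> \<Lambda> l chi by (auto simp: \<epsilon>)
  have \<Delta>0: "0 < \<Delta>" using less_le_trans[OF mult_pos_pos[OF pos(1) \<Lambda>] \<Delta>] by simp
  let ?X = "l * \<Delta> / \<epsilon>\<^sup>2"
  have X: "0 < ?X" using pos \<Delta>0 by simp
  have c4: "1 \<le> 256 * chi ^ 4"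
  proof -
    have "(1 / 4) ^ 4 \<le> chi ^ 4" using chi by (intro power_mono) auto
    then show ?thesis by (simp add: eval_nat_numeral)
  qed
  have c3: "chi \<le> 64 * chi ^ 4"
  proof -
    have "(1 / 4) ^ 3 \<le> chi ^ 3" using chi by (intro power_mono) auto
    then have "chi * 1 \<le> chi * (64 * chi ^ 3)" using pos(3) by (intro mult_left_mono) (auto simp: eval_nat_numeral)
    then show ?thesis by (simp add: eval_nat_numeral mult_ac)
  qed
  have "\<epsilon>\<^sup>2 = \<kappa> * (\<epsilon> * \<Lambda>)" by (simp add: \<epsilon> power2_eq_square)
  also have "\<dots> \<le> \<kappa> * (3 * \<Delta>)" using \<Delta> \<kappa> by (intro mult_left_mono) auto
  finally have "1 / (3 * \<kappa>) \<le> \<Delta> / \<epsilon>\<^sup>2" using \<kappa> pos by (simp add: field_simps)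
  then have "(l * chi) * (1 / (3 * \<kappa>)) \<le> (l * chi) * (\<Delta> / \<epsilon>\<^sup>2)" using pos by (intro mult_left_mono) auto
  then have "l * chi / (3 * \<kappa>) \<le> ?X * chi" by (simp add: mult_ac)
  also have "\<dots> \<le> ?X * (64 * chi ^ 4)" using X c3 by (intro mult_left_mono) auto
  finally have 1: "l * chi / (3 * \<kappa>) \<le> 64 * (?X * chi ^ 4)" by simp
  have 2: "?X \<le> 256 * (?X * chi ^ 4)"
    using mult_left_mono[OF c4, of ?X] X by (simp only: mult_1_right mult.left_commute[of ?X] less_imp_le)
  have "0 \<le> ?X * chi ^ 4" by (rule mult_nonneg_nonneg[OF less_imp_le[OF X]]) simp
  moreover have "50 * chi ^ 4 * ?X = 50 * (?X * chi ^ 4)" by simp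
  ultimately have "max (l * chi / (3 * \<kappa>)) (max (50 * chi ^ 4 * ?X) ?X) \<le> 256 * (?X * chi ^ 4)"
    using 1 2 by (intro max.boundedI) linarith+
  then show ?thesis unfolding horizon_eq[OF pos(3)] by linarith
qed

text \<open>In the dimensionless quantities \<open>l / \<kappa>\<close> and \<open>D\<close>, the
  argument of the logarithm is \<open>2 ^ 31 * Q / \<delta>\<close>. The lower bound on
  \<open>chi\<close> hence bounds \<open>Q\<close> by a multiple of
  \<open>\<delta> * exp (chi / 4)\<close>.\<close>

lemma total_failure_probability_le:
  fixes \<Delta> \<delta> chi :: real and d :: nat
  assumes \<Delta>: "\<epsilon> * \<Lambda> \<le> 3 * \<Delta>" and chi: "1 / 4 < chi" "chi_bound d l \<Delta> \<delta> \<rho> \<epsilon> \<le> chi"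
    and \<delta>: "0 < \<delta>" "\<delta> < 1" and d: "1 \<le> d"
  shows "2000 * sqrt d * (l / \<kappa>) * chi\<^sup>2 * exp (- chi / 2) * (horizon l \<Delta> \<rho> \<epsilon> chi / (l * chi / \<kappa>) + 1) \<le> \<delta>"
proof -
  let ?H = "horizon l \<Delta> \<rho> \<epsilon> chi" and ?N = "l * chi / \<kappa>" and ?X = "l * \<Delta> / \<epsilon>\<^sup>2"
    and ?Y = "l * chi / (3 * \<kappa>)" and ?B = "chi_bound d l \<Delta> \<delta> \<rho> \<epsilon>"
  have pos: "0 < \<epsilon>" "0 < l" "0 < chi" using \<kappa> \<Lambda> l chi by (auto simp: \<epsilon>)
  define D where "D = \<Delta> / (\<epsilon> * \<Lambda>)"
  have D: "1 / 3 \<le> D" using \<Delta> pos(1) \<Lambda> by (simp add: D_def field_simps)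
  define Q where "Q = (l / \<kappa>)\<^sup>2 * sqrt d * D"
  have lk: "1 \<le> l / \<kappa>" using l \<kappa> by simp
  have sd: "1 \<le> sqrt d" using d by simp
  have "1 * 1 * (1 / 3) \<le> Q" unfolding Q_def using lk sd D by (intro mult_mono) auto
  then have Q: "1 / 3 \<le> Q" by simp
  have "?B = 4 * log 2 (2 ^ 31 * Q / \<delta>)"
  proof -
    have "\<delta> * sqrt \<rho> * \<epsilon> powr (5/2) = \<delta> * (\<kappa> * \<epsilon>\<^sup>2)" using sqrt_parameters(3) by (simp add: mult.assoc)
    moreover have "2 ^ 31 * (l\<^sup>2 * sqrt d * \<Delta>) / (\<delta> * (\<kappa> * \<epsilon>\<^sup>2)) = 2 ^ 31 * Q / \<delta>"
      using \<kappa> \<Lambda> by (simp add: Q_def D_def \<epsilon> power2_eq_square mult_ac)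
    ultimately show ?thesis unfolding chi_bound_def by (simp only:)
  qed
  then have log: "log 2 (2 ^ 31 * Q / \<delta>) \<le> chi / 4" using chi(2) by simp
  have "(2::real) ^ 29 \<le> 2 ^ 31 * Q / 1" using Q by simp
  also have "\<dots> \<le> 2 ^ 31 * Q / \<delta>" using \<delta> Q by (intro divide_left_mono) auto
  finally have big: "(2::real) ^ 29 \<le> 2 ^ 31 * Q / \<delta>" .
  \<comment> \<open>\<open>Q \<ge> 1 / 3\<close> and \<open>\<delta> < 1\<close> make the argument
    of the logarithm at least 2^29, so \<open>chi\<close> is at least 4 * 29.\<close>
  have "29 = log 2 ((2::real) ^ 29)" by (subst log_nat_power) auto
  also have "\<dots> \<le> log 2 (2 ^ 31 * Q / \<delta>)" using big by (intro log_mono) auto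
  finally have c116: "116 \<le> chi" using log by simp
  have "2 ^ 31 * Q / \<delta> \<le> 2 powr (chi / 4)" using log big by (subst (asm) log_le_iff) auto
  also have "\<dots> = exp (chi / 4 * ln 2)" by (simp add: powr_def)
  also have "\<dots> \<le> exp (chi / 4 * 1)" using pos ln_2_less_1 by (intro exp_le_cancel_iff[THEN iffD2] mult_left_mono) auto
  finally have Qle: "Q \<le> \<delta> / 2 ^ 31 * exp (chi / 4)" using \<delta> by (simp add: field_simps)
  have "1 \<le> chi ^ 3" using c116 by (intro one_le_power) auto
  then have "1 * D \<le> chi ^ 3 * D" using D by (intro mult_right_mono) auto
  then have c3D: "D \<le> chi ^ 3 * D" "1 / 3 \<le> chi ^ 3 * D" using D by linarith+
  \<comment> \<open>403 is 8 * 50 for the horizon and 3 for the summand 1, which is at most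
    \<open>3 * (chi ^ 3 * D)\<close>.\<close>
  have "?H / ?N + 1 \<le> 403 * (chi ^ 3 * D)"
  proof -
    have eqs: "?Y / ?N = 1 / 3"
      "50 * chi ^ 4 * ?X / ?N = 50 * (chi ^ 3 * D)"
      "?X / ?N = D / chi"
      using pos \<kappa> \<Lambda> by (simp_all add: D_def \<epsilon> power2_eq_square eval_nat_numeral mult_ac)
    have "D / chi \<le> D / 1" using D c116 by (intro divide_left_mono) auto
    then have le: "?Y / ?N \<le> 50 * (chi ^ 3 * D)"
      "50 * chi ^ 4 * ?X / ?N \<le> 50 * (chi ^ 3 * D)"
      "?X / ?N \<le> 50 * (chi ^ 3 * D)"
      unfolding eqs using c3D by auto
    have p: "0 < ?N" using pos \<kappa> by simp
    have "max ?Y (max (50 * chi ^ 4 * ?X) ?X) \<le> 50 * (chi ^ 3 * D) * ?N"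
      using le by (intro max.boundedI) (simp_all only: pos_divide_le_eq[OF p])
    then have "?H \<le> 400 * (chi ^ 3 * D) * ?N"
      unfolding horizon_eq[OF pos(3)] by linarith
    then have "?H / ?N \<le> 400 * (chi ^ 3 * D)" by (simp only: pos_divide_le_eq[OF p])
    then show ?thesis using c3D(2) by linarith
  qed
  then have "2000 * sqrt d * (l / \<kappa>) * chi\<^sup>2 * exp (- chi / 2) * (?H / ?N + 1)
      \<le> 2000 * sqrt d * (l / \<kappa>) * chi\<^sup>2 * exp (- chi / 2) * (403 * (chi ^ 3 * D))"
    using pos \<kappa> by (intro mult_left_mono) auto
  also have "\<dots> = 806000 * (chi ^ 5 * exp (- chi / 2)) * (l / \<kappa> * (sqrt d * D))"
    by (simp add: eval_nat_numeral)
  also have "\<dots> \<le> 806000 * (chi ^ 5 * exp (- chi / 2)) * Q"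
  proof (rule mult_left_mono)
    have "l / \<kappa> \<le> (l / \<kappa>)\<^sup>2" using lk by (rule self_le_power) simp
    then have "l / \<kappa> * (sqrt d * D) \<le> (l / \<kappa>)\<^sup>2 * (sqrt d * D)"
      using D by (intro mult_right_mono) auto
    then show "l / \<kappa> * (sqrt d * D) \<le> Q" by (simp add: Q_def mult.assoc)
  qed (use pos in auto)
  also have "\<dots> \<le> 806000 * (chi ^ 5 * exp (- chi / 2)) * (\<delta> / 2 ^ 31 * exp (chi / 4))"
    using Qle pos by (intro mult_left_mono) auto
  also have "\<dots> = \<delta> * (806000 * chi ^ 5 * (exp (- chi / 2) * exp (chi / 4)) / 2 ^ 31)"
  proof -
    have "806000 * (c * x) * (\<delta> / p * y) = \<delta> * (806000 * c * (x * y) / p)" for c x y p :: real by simp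
    then show ?thesis .
  qed
  also have "exp (- chi / 2) * exp (chi / 4) = 1 / (exp (chi / 8) * exp (chi / 8))"
  proof -
    have "exp (- chi / 2) * exp (chi / 4) = exp (- (chi / 8 + chi / 8))" by (simp flip: exp_add)
    then show ?thesis by (simp only: exp_minus exp_add inverse_eq_divide)
  qed
  also have "\<delta> * (806000 * chi ^ 5 * (1 / (exp (chi / 8) * exp (chi / 8))) / 2 ^ 31) \<le> \<delta> * 1"
  proof (rule mult_left_mono)
    \<comment> \<open>One factor exp(- chi / 8) absorbs chi^5, as x \<le> exp x at x = chi / 40;
      102400000 is 40^5.\<close>
    have "chi / 40 \<le> exp (chi / 40)" using exp_ge_add_one_self[of "chi / 40"] by linarith
    then have "(chi / 40) ^ 5 \<le> exp (chi / 40) ^ 5" using pos by (intro power_mono) auto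
    also have "\<dots> = exp (chi / 8)" by (simp flip: exp_of_nat_mult)
    finally have 1: "chi ^ 5 \<le> 102400000 * exp (chi / 8)" by (simp add: power_divide)
    \<comment> \<open>The other factor exp(- chi / 8), with \<open>chi / 8 \<ge> 14\<close>, absorbs
      the numbers: 806000 * 40^5 / 2^31 is below 80000.\<close>
    have "(3 / 2 :: real) ^ 28 \<le> exp (1 / 2) ^ 28"
      using exp_ge_add_one_self[of "1 / 2"] by (intro power_mono) auto
    also have "\<dots> = exp 14" by (simp flip: exp_of_nat_mult)
    also have "\<dots> \<le> exp (chi / 8)" using c116 by simp
    finally have 2: "80000 \<le> exp (chi / 8)" by (simp add: eval_nat_numeral)
    have "806000 * chi ^ 5 \<le> 806000 * (102400000 * exp (chi / 8))" using 1 by simp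
    also have "\<dots> \<le> 2 ^ 31 * 80000 * exp (chi / 8)" by simp
    also have "\<dots> \<le> 2 ^ 31 * exp (chi / 8) * exp (chi / 8)" using 2 by simp
    finally show "806000 * chi ^ 5 * (1 / (exp (chi / 8) * exp (chi / 8))) / 2 ^ 31 \<le> 1" by (simp add: field_simps)
  qed (use \<delta> in simp)
  finally show ?thesis by simp
qed

end

text \<open>\<open>max 2 d\<close> keeps the logarithm of the dimension above 1/2, so a sum of the
  two logarithmic quantities is bounded by their product: 63 is 31 * 2 + 1, and 504 is 4 * 63 *
  2.\<close>

lemma chi_bound_le:
  fixes l \<Delta> \<delta> \<rho> \<epsilon> :: real and d :: nat
  assumes "1 \<le> d" "0 < \<delta>" "0 < \<rho>" "0 < \<epsilon>" "0 < l" "0 < \<Delta>"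
  shows "max (1/4) (chi_bound d l \<Delta> \<delta> \<rho> \<epsilon>) \<le> 504 * (ln (real (max 2 d)) *
    (1 + \<bar>ln l\<bar> + \<bar>ln \<Delta>\<bar> + \<bar>ln (1 / \<delta>)\<bar> + \<bar>ln (1 / \<rho>)\<bar> + \<bar>ln (1 / \<epsilon>)\<bar>))"
proof -
  define S where "S = 1 + \<bar>ln l\<bar> + \<bar>ln \<Delta>\<bar> + \<bar>ln (1 / \<delta>)\<bar> + \<bar>ln (1 / \<rho>)\<bar> + \<bar>ln (1 / \<epsilon>)\<bar>"
  define D where "D = ln (real (max 2 d))"
  have ln2: "1 / 2 \<le> ln (2::real)" using ln2_ge_two_thirds by simp
  have "ln 2 \<le> D" unfolding D_def by (intro ln_mono) auto
  then have D: "1 / 2 \<le> D" using ln2 by linarith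
  have S: "1 \<le> S" by (simp add: S_def)
  have lnd: "0 \<le> ln d" "ln d \<le> D" using assms(1) unfolding D_def by (auto intro!: ln_mono)
  have DS: "D \<le> D * S" "S \<le> 2 * (D * S)"
    using mult_left_mono[OF S, of D] mult_right_mono[OF D, of S] D S by auto
  let ?q = "2 ^ 31 * (l\<^sup>2 * sqrt d * \<Delta>) / (\<delta> * sqrt \<rho> * \<epsilon> powr (5/2))"
  have "ln ?q = 31 * ln 2 + 2 * ln l + ln d / 2 + ln \<Delta> - ln \<delta> - ln \<rho> / 2 - 5 / 2 * ln \<epsilon>"
    using assms ln_realpow[of 2 31] by (simp add: ln_div ln_mult ln_realpow ln_sqrt ln_powr)
  also have "\<dots> \<le> 31 * S + D"
  proof -
    have "ln 2 \<le> (1::real)" using ln_2_less_1 by simp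
    moreover have "ln (1 / \<delta>) = - ln \<delta>" "ln (1 / \<rho>) = - ln \<rho>" "ln (1 / \<epsilon>) = - ln \<epsilon>"
      using assms by (simp_all add: ln_div)
    ultimately show ?thesis using lnd unfolding S_def by (simp add: abs_if split: if_splits)
  qed
  also have "\<dots> \<le> 63 * (D * S)" using DS by linarith
  finally have ln_q: "ln ?q \<le> 63 * (D * S)" .
  have "chi_bound d l \<Delta> \<delta> \<rho> \<epsilon> = 4 * (ln ?q / ln 2)" by (simp add: chi_bound_def log_def)
  also have "\<dots> \<le> 4 * (63 * (D * S) / ln 2)" using ln_q ln2 by (intro mult_left_mono divide_right_mono) auto
  also have "\<dots> \<le> 4 * (63 * (D * S) / (1 / 2))"
    using ln2 D S by (intro mult_left_mono divide_left_mono) auto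
  finally have "chi_bound d l \<Delta> \<delta> \<rho> \<epsilon> \<le> 504 * (D * S)" by simp
  moreover have "1 / 4 \<le> 504 * (D * S)" using DS D by linarith
  ultimately show ?thesis by (simp add: D_def S_def)
qed

lemma horizon_order:
  "\<exists>(C::real) (p::nat). \<forall>(d::nat) l \<Delta> \<delta> \<rho> \<epsilon> chi.
     1 \<le> d \<longrightarrow> 0 < \<delta> \<longrightarrow> \<delta> < 1 \<longrightarrow> 0 < \<rho> \<longrightarrow> 0 < \<epsilon> \<longrightarrow> sqrt (\<rho> * \<epsilon>) \<le> l \<longrightarrow>
     \<epsilon> powr (3/2) \<le> 3 * sqrt \<rho> * \<Delta> \<longrightarrow>
     1/4 < chi \<longrightarrow> chi_bound d l \<Delta> \<delta> \<rho> \<epsilon> \<le> chi \<longrightarrow>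
     chi \<le> c * max (1/4) (chi_bound d l \<Delta> \<delta> \<rho> \<epsilon>) \<longrightarrow>
     horizon l \<Delta> \<rho> \<epsilon> chi \<le>
       C * (l * \<Delta> / \<epsilon>\<^sup>2 * (ln (real (max 2 d))) ^ 4) *
         (1 + \<bar>ln l\<bar> + \<bar>ln \<Delta>\<bar> + \<bar>ln (1 / \<delta>)\<bar> + \<bar>ln (1 / \<rho>)\<bar> + \<bar>ln (1 / \<epsilon>)\<bar>) ^ p"
\<comment> \<open>2048 comes from \<open>horizon_le\<close> and 504 from
  \<open>chi_bound_le\<close>; the exponent 4 is that of \<open>chi\<close> in the horizon.\<close>
proof (intro exI[of _ "2048 * (504 * \<bar>c\<bar>) ^ 4"] exI[of _ 4] allI impI)
  fix d :: nat and l \<Delta> \<delta> \<rho> \<epsilon> chi :: real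
  assume d: "1 \<le> d" and \<delta>: "0 < \<delta>" "\<delta> < 1" and pos: "0 < \<rho>" "0 < \<epsilon>" and l: "sqrt (\<rho> * \<epsilon>) \<le> l"
    and \<Delta>: "\<epsilon> powr (3/2) \<le> 3 * sqrt \<rho> * \<Delta>" and chi: "1/4 < chi" "chi_bound d l \<Delta> \<delta> \<rho> \<epsilon> \<le> chi"
    and le: "chi \<le> c * max (1/4) (chi_bound d l \<Delta> \<delta> \<rho> \<epsilon>)"
  let ?S = "1 + \<bar>ln l\<bar> + \<bar>ln \<Delta>\<bar> + \<bar>ln (1 / \<delta>)\<bar> + \<bar>ln (1 / \<rho>)\<bar> + \<bar>ln (1 / \<epsilon>)\<bar>"
  let ?D = "ln (real (max 2 d))"
  define \<Lambda> where "\<Lambda> = sqrt (\<epsilon> / \<rho>)"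
  have k: "0 < sqrt (\<rho> * \<epsilon>)" and \<Lambda>: "0 < \<Lambda>" using pos by (auto simp: \<Lambda>_def)
  have e1: "\<epsilon> = sqrt (\<rho> * \<epsilon>) * \<Lambda>" and e2: "\<rho> = sqrt (\<rho> * \<epsilon>) / \<Lambda>"
    using pos by (simp_all add: \<Lambda>_def real_sqrt_mult real_sqrt_divide)
  have "\<epsilon> powr (3/2) = \<epsilon> powr (1 + 1/2)" by simp
  also have "\<dots> = \<epsilon> * sqrt \<epsilon>" using pos by (simp only: powr_add powr_half_sqrt less_imp_le powr_one)
  finally have D3: "\<epsilon> * \<Lambda> \<le> 3 * \<Delta>" using \<Delta> pos by (simp add: \<Lambda>_def real_sqrt_divide pos_divide_le_eq mult_ac)
  have l0: "0 < l" using k l by linarith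
  have \<Delta>0: "0 < \<Delta>" using less_le_trans[OF mult_pos_pos[OF pos(2) \<Lambda>] D3] by simp
  have m: "0 < max (1/4) (chi_bound d l \<Delta> \<delta> \<rho> \<epsilon>)" by (simp add: less_max_iff_disj)
  have "chi \<le> \<bar>c\<bar> * max (1/4) (chi_bound d l \<Delta> \<delta> \<rho> \<epsilon>)"
    using le m by (intro order_trans[OF le] mult_right_mono) auto
  also have "\<dots> \<le> \<bar>c\<bar> * (504 * (?D * ?S))"
    using chi_bound_le[OF d \<delta>(1) pos l0 \<Delta>0] by (intro mult_left_mono) auto
  finally have "chi ^ 4 \<le> (\<bar>c\<bar> * (504 * (?D * ?S))) ^ 4" using chi(1) by (intro power_mono) auto
  also have "\<dots> = (504 * \<bar>c\<bar>) ^ 4 * (?D ^ 4 * ?S ^ 4)" by (simp only: power_mult_distrib mult_ac)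
  finally have c4: "chi ^ 4 \<le> (504 * \<bar>c\<bar>) ^ 4 * (?D ^ 4 * ?S ^ 4)" .
  have "horizon l \<Delta> \<rho> \<epsilon> chi \<le> 2048 * (l * \<Delta> / \<epsilon>\<^sup>2) * chi ^ 4"
    by (rule horizon_le[OF k \<Lambda> e1 e2 l D3 chi(1)])
  also have "\<dots> \<le> 2048 * (l * \<Delta> / \<epsilon>\<^sup>2) * ((504 * \<bar>c\<bar>) ^ 4 * (?D ^ 4 * ?S ^ 4))"
    using c4 l0 \<Delta>0 by (intro mult_left_mono) auto
  also have "\<dots> = 2048 * (504 * \<bar>c\<bar>) ^ 4 * (l * \<Delta> / \<epsilon>\<^sup>2 * ?D ^ 4) * ?S ^ 4" by (simp only: mult_ac)
  finally show "horizon l \<Delta> \<rho> \<epsilon> chi \<le> 2048 * (504 * \<bar>c\<bar>) ^ 4 * (l * \<Delta> / \<epsilon>\<^sup>2 * ?D ^ 4) * ?S ^ 4" .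
qed

theorem theorem3p4:
  fixes A :: "('m::{t2_space, second_countable_topology}, 'e::euclidean_space) chart set"
    and g :: "'m \<Rightarrow> 'e \<Rightarrow> 'e \<Rightarrow> real"
    and Retr :: "'m \<Rightarrow> 'e \<Rightarrow> 'm"
    and f :: "'m \<Rightarrow> real"
    and fstar L \<rho> l \<epsilon> \<delta> chi \<eta> r T :: real
    and b\<^sub>1 b\<^sub>2 b :: ereal
    and N d :: nat
    and x\<^sub>0 :: 'm
    and run :: "(nat \<Rightarrow> 'e) \<Rightarrow> nat \<Rightarrow> nat \<times> 'm"
    and small good :: "'m \<Rightarrow> bool"
    and visited draws :: "nat \<times> 'm \<Rightarrow> bool"
  assumes manifold: "smooth_atlas A" "riemannian_metric A g" "manifold_retraction A Retr"
    and dim: "d = DIM('e)"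
    and f_C2: "C2_fun A f"
    and A1: "\<And>x. fstar \<le> f x"
    and A2: "0 < b\<^sub>1" "0 < L"
      "\<And>x s. ereal (tnorm g x s) \<le> b\<^sub>1 \<Longrightarrow>
         tnorm g x (pb_grad g Retr f x s - pb_grad g Retr f x 0) \<le> L * tnorm g x s"
    and A3: "0 < b\<^sub>2" "0 < \<rho>"
      "\<And>x s. ereal (tnorm g x s) \<le> b\<^sub>2 \<Longrightarrow>
         opnorm_at g x (\<lambda>v. pb_hess g Retr f x s v - pb_hess g Retr f x 0 v) \<le> \<rho> * tnorm g x s"
    and b: "b = min b\<^sub>1 b\<^sub>2"
    and l: "L \<le> l" "ereal l \<le> ereal L + ereal \<rho> * b"
      "\<And>x s s'. ereal (tnorm g x s) \<le> b \<Longrightarrow> ereal (tnorm g x s') \<le> b \<Longrightarrow>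
         tnorm g x (pb_grad g Retr f x s - pb_grad g Retr f x s') \<le> l * tnorm g x (s - s')"
    and eps: "0 < \<epsilon>" "ereal \<epsilon> \<le> b\<^sup>2 * ereal \<rho>" "sqrt (\<rho> * \<epsilon>) \<le> L"
      "\<epsilon> powr (3/2) \<le> 3 * sqrt \<rho> * (f x\<^sub>0 - fstar)"
    and delta: "0 < \<delta>" "\<delta> < 1"
    and chi_bounds: "1/4 < chi" "chi_bound d l (f x\<^sub>0 - fstar) \<delta> \<rho> \<epsilon> \<le> chi"
    and params: "\<eta> = 1 / l" "r = \<epsilon> / (400 * chi ^ 3)" "real N = round_length l \<rho> \<epsilon> chi"
      "T = horizon l (f x\<^sub>0 - fstar) \<rho> \<epsilon> chi"
    and run: "run = prgd (tnorm g) (riem_grad A g f) (pb_grad g Retr f) Retr x\<^sub>0 \<eta> N \<epsilon> T b"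
    and visited: "\<And>t x. visited (t, x) \<longleftrightarrow> real t \<le> T"
    and small: "\<And>x. small x \<longleftrightarrow> tnorm g x (riem_grad A g f x) \<le> \<epsilon>"
    and draws: "\<And>t x. draws (t, x) \<longleftrightarrow> visited (t, x) \<and> small x"
    and good: "\<And>x. good x \<longleftrightarrow> small x \<and> - sqrt (\<rho> * \<epsilon>) \<le> lambda_min (pb_hess g Retr f x 0)"
  shows
    \<comment> \<open>order of the horizon (when \<open>chi\<close> is of the order of its lower bound);
      at least two iterates with small gradient in every run;
      with probability at least \<open>1 - \<delta>\<close>, at least two thirds of these are good;
      every run terminates after at most \<open>T + N \<le> 2 T\<close> gradient queries\<close>
    "(\<forall>c::real. \<exists>(C::real) (p::nat). \<forall>(d'::nat) l' \<Delta>' \<delta>' \<rho>' \<epsilon>' chi'.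
       1 \<le> d' \<longrightarrow> 0 < \<delta>' \<longrightarrow> \<delta>' < 1 \<longrightarrow> 0 < \<rho>' \<longrightarrow> 0 < \<epsilon>' \<longrightarrow> sqrt (\<rho>' * \<epsilon>') \<le> l' \<longrightarrow>
       \<epsilon>' powr (3/2) \<le> 3 * sqrt \<rho>' * \<Delta>' \<longrightarrow>
       1/4 < chi' \<longrightarrow> chi_bound d' l' \<Delta>' \<delta>' \<rho>' \<epsilon>' \<le> chi' \<longrightarrow>
       chi' \<le> c * max (1/4) (chi_bound d' l' \<Delta>' \<delta>' \<rho>' \<epsilon>') \<longrightarrow>
       horizon l' \<Delta>' \<rho>' \<epsilon>' chi' \<le>
         C * (l' * \<Delta>' / \<epsilon>'\<^sup>2 * (ln (real (max 2 d'))) ^ 4) *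
           (1 + \<bar>ln l'\<bar> + \<bar>ln \<Delta>'\<bar> + \<bar>ln (1 / \<delta>')\<bar> + \<bar>ln (1 / \<rho>')\<bar> + \<bar>ln (1 / \<epsilon>')\<bar>) ^ p) \<and>
     (\<forall>w. admissible_draws g r run draws w \<longrightarrow>
       2 \<le> card {k. visited (run w k) \<and> small (snd (run w k))}) \<and>
     (\<forall>(P :: 'w measure) \<xi>. prob_space P \<longrightarrow> fresh_uniform_draws P g r run draws \<xi> \<longrightarrow>
       1 - \<delta> \<le> measure P {\<omega> \<in> space P.
         2/3 * real (card {k. visited (run (\<xi> \<omega>) k) \<and> small (snd (run (\<xi> \<omega>) k))})
           \<le> real (card {k. visited (run (\<xi> \<omega>) k) \<and> good (snd (run (\<xi> \<omega>) k))})}) \<and>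
     (\<forall>w. admissible_draws g r run draws w \<longrightarrow>
       (\<exists>K. (\<forall>k<K. visited (run w k)) \<and> \<not> visited (run w K) \<and> real (fst (run w K)) \<le> T + real N)) \<and>
     T + real N \<le> 2 * T"
proof -
  define \<kappa> where "\<kappa> = sqrt (\<rho> * \<epsilon>)"
  define \<Lambda> where "\<Lambda> = sqrt (\<epsilon> / \<rho>)"
  define F where "F = \<epsilon> * \<Lambda> / (50 * chi ^ 3)"
  define \<Delta> where "\<Delta> = f x\<^sub>0 - fstar"
  have \<rho>0: "0 < \<rho>" and \<epsilon>0: "0 < \<epsilon>" using A3 eps by auto
  have \<kappa>: "0 < \<kappa>" and \<Lambda>: "0 < \<Lambda>" using \<rho>0 \<epsilon>0 by (auto simp: \<kappa>_def \<Lambda>_def)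
  have e1: "\<epsilon> = \<kappa> * \<Lambda>" and e2: "\<rho> = \<kappa> / \<Lambda>"
    using \<rho>0 \<epsilon>0 by (simp_all add: \<kappa>_def \<Lambda>_def real_sqrt_mult real_sqrt_divide)
  have \<kappa>l: "\<kappa> \<le> l" using eps(3) l(1) by (simp add: \<kappa>_def)
  have chi0: "0 < chi" using chi_bounds(1) by simp
  have b0: "0 < b" using A2(1) A3(1) by (simp add: b)
  \<comment> \<open>For finite \<open>b\<close> this is the assumption on \<epsilon>, divided by
    \<rho> and with the root taken.\<close>
  have \<Lambda>b: "ereal \<Lambda> \<le> b"
  proof (cases b)
    case (real B)
    then have "0 < B" "\<epsilon> / \<rho> \<le> B\<^sup>2" using b0 eps(2) \<rho>0 by (simp_all add: pos_divide_le_eq)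
    then have "\<Lambda> \<le> B" unfolding \<Lambda>_def by (intro real_le_lsqrt) (use \<rho>0 \<epsilon>0 in auto)
    then show ?thesis by (simp add: real)
  qed (use b0 in auto)
  have "\<epsilon> powr (3/2) = \<epsilon> powr (1 + 1/2)" by simp
  also have "\<dots> = \<epsilon> * sqrt \<epsilon>" using \<epsilon>0 by (simp only: powr_add powr_half_sqrt less_imp_le powr_one)
  finally have D3: "\<epsilon> * \<Lambda> \<le> 3 * \<Delta>"
    using eps(4) \<rho>0 by (simp add: \<Lambda>_def \<Delta>_def real_sqrt_divide pos_divide_le_eq mult_ac)
  note rl = round_length_eq[OF \<kappa> \<Lambda> e1 e2 \<kappa>l] and rd = round_decrease_eq[OF \<kappa> \<Lambda> e1 e2 \<kappa>l]
  have N: "real N = l * chi / \<kappa>" using params(3) rl by simp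
  have T: "T = 8 * max (N / 3) (max (\<Delta> * N / F) (\<Delta> / (\<eta> * \<epsilon>\<^sup>2)))"
    unfolding params(4) horizon_def rl rd N F_def \<Delta>_def params(1) Max_three ..
  interpret M: C2_on_manifold A g Retr f using manifold f_C2 by unfold_locales
  interpret S: prgd_run A g Retr f \<rho> l \<epsilon> \<kappa> \<Lambda> \<eta> chi r F b N fstar T x\<^sub>0
  proof
    fix x s s' v
    show "ereal (tnorm g x s) \<le> b \<Longrightarrow> ereal (tnorm g x s') \<le> b \<Longrightarrow>
         tnorm g x (pb_grad g Retr f x s - pb_grad g Retr f x s') \<le> l * tnorm g x (s - s')"
      by (rule l(3))
    assume "ereal (tnorm g x s) \<le> b"
    then have "ereal (tnorm g x s) \<le> b\<^sub>2" by (simp add: b)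
    then have "opnorm_at g x (\<lambda>v. pb_hess g Retr f x s v - pb_hess g Retr f x 0 v) \<le> \<rho> * tnorm g x s"
      by (rule A3(3))
    then show "tnorm g x (pb_hess g Retr f x s v - pb_hess g Retr f x 0 v) \<le> \<rho> * tnorm g x s * tnorm g x v"
      by (rule M.opnorm_le[rotated]) (intro linear_compose_sub M.ph_linear)
  next
    show "8 / 3 * N \<le> T" "8 * (f x\<^sub>0 - fstar) * N / F \<le> T" "8 * (f x\<^sub>0 - fstar) / (\<eta> * \<epsilon>\<^sup>2) \<le> T"
      unfolding T \<Delta>_def[symmetric] by (auto simp: max_def)
  qed (use \<kappa> \<Lambda> e1 e2 \<kappa>l \<Lambda>b chi_bounds(1) params N F_def A1 D3 in \<open>auto simp: \<Delta>_def\<close>)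
  have vis: "visited = S.visited" using visited by (auto simp: fun_eq_iff S.visited_def)
  have sm: "small = S.small" using small by (simp add: fun_eq_iff S.small_def)
  have dr: "draws = S.draws" using draws by (auto simp: fun_eq_iff S.draws_def vis sm)
  have gd: "good = S.good" using good by (simp add: fun_eq_iff S.good_def sm flip: \<kappa>_def)
  have fp: "S.fail_prob * (T / N + 1) \<le> \<delta>"
    unfolding S.fail_prob_def N params(4) dim[symmetric] \<Delta>_def[symmetric]
    by (rule total_failure_probability_le[OF \<kappa> \<Lambda> e1 e2 \<kappa>l D3 chi_bounds(1) _ delta])
      (use chi_bounds(2) dim in \<open>auto simp: \<Delta>_def Suc_le_eq\<close>)
  show ?thesis
    unfolding run vis sm dr gd
  proof (intro conjI allI impI)
    show "2 \<le> card {k. S.visited (S.run w k) \<and> S.small (snd (S.run w k))}" if "S.admissible w" for w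
      using that by (rule S.at_least_two_small)
    fix P :: "'w measure" and \<xi>
    assume P: "prob_space P" and \<xi>: "fresh_uniform_draws P g r S.run S.draws \<xi>"
    show "1 - \<delta> \<le> measure P {\<omega> \<in> space P.
         2/3 * real (card {k. S.visited (S.run (\<xi> \<omega>) k) \<and> S.small (snd (S.run (\<xi> \<omega>) k))})
           \<le> real (card {k. S.visited (S.run (\<xi> \<omega>) k) \<and> S.good (snd (S.run (\<xi> \<omega>) k))})}"
      using S.probability_two_thirds_good[OF P \<xi>] fp by linarith
  next
    show "\<exists>K. (\<forall>k<K. S.visited (S.run w k)) \<and> \<not> S.visited (S.run w K) \<and> real (fst (S.run w K)) \<le> T + real N" for w
      using S.run_terminates[of w] by metis
    show "T + real N \<le> 2 * T" using S.T_ge(1) S.N_pos by simp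
  qed (rule horizon_order)
qed

end
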